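(* Let $d\ge2$. For each $\mu,\nu\in\mathcal P_2(\mathbb R^d)$ there exists a curve $(\mu_t)_{t\in[0,1]}\in AC([0,1];\mathcal P_2(\mathbb R^d),SW)$ with $\mu_0=\mu$, $\mu_1=\nu$ and $$\ell_{SW}(\mu,\nu)=L_{SW}((\mu_t)_{t\in[0,1]}).$$ In particular, $(\mathcal P_2(\mathbb R^d),\ell_{SW})$ is a geodesic space.
   Context: $\mathcal P_2(\mathbb R^d)$ is the set of Borel probability measures on $\mathbb R^d$ with finite second moment, $W$ the quadratic Wasserstein distance, $\sigma$ the uniform probability measure on $\mathbb S^{d-1}$. For $\theta\in\mathbb S^{d-1}$, $\hat\mu^\theta$ is the pushforward of $\mu$ under $x\mapsto x\cdot\theta$, and $SW^2(\mu,\nu)=\int_{\mathbb S^{d-1}}W^2(\hat\mu^\theta,\hat\nu^\theta)\,d\sigma(\theta)$. $AC(I;\mathcal P_2(\mathbb R^d),SW)$ is the set of curves $(\mu_t)_{t\in I}$ for which there is $g\in L^1(I)$ with $SW(\mu_s,\mu_t)\le\int_s^tg$ for all $s\le t$ in $I$; the metric derivative $|\mu'|_{SW}(t)=\lim_{s\to t}SW(\mu_s,\mu_t)/|s-t|$ exists a.e.; $L_{SW}((\mu_t)_{t\in I})=\int_I|\mu'|_{SW}(t)\,dt$; and $\ell_{SW}(\mu,\nu)=\inf L_{SW}((\mu_t)_{t\in[0,1]})$ over all curves in $AC([0,1];\mathcal P_2(\mathbb R^d),SW)$ with $\mu_0=\mu$, $\mu_1=\nu$. A metric space is geodesic if any two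 points are joined by a curve whose length equals their distance. *)

theory Defs
  imports "HOL-Probability.Probability"
begin

section \<open>Curves in metric spaces\<close>

text \<open>
  A metric is given by a carrier \<open>X\<close> and a function \<open>dst\<close>, as in the library locale
  \<open>Metric_space\<close>; a curve on an interval \<open>I\<close> is a function on the reals of which only the
  restriction to \<open>I\<close> matters.
\<close>

definition AC :: "real set \<Rightarrow> 'b set \<Rightarrow> ('b \<Rightarrow> 'b \<Rightarrow> real) \<Rightarrow> (real \<Rightarrow> 'b) set" where
  "AC I X dst =
    {\<gamma>. (\<forall>t\<in>I. \<gamma> t \<in> X) \<and>
        (\<exists>g :: real \<Rightarrow> real. set_integrable lebesgue I g \<and>
          (\<forall>s\<in>I. \<forall>t\<in>I. s \<le> t \<longrightarrow> dst (\<gamma> s) (\<gamma> t) \<le> (LINT r:{s..t}|lebesgue. g r)))}"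

text \<open>
  \<open>Lim\<close> has no meaningful value where the limit fails to exist; along a curve in \<open>AC\<close> of an
  interval this is a null set, which the integral in \<open>curve_length\<close> does not see.
\<close>

definition metric_deriv :: "real set \<Rightarrow> ('b \<Rightarrow> 'b \<Rightarrow> real) \<Rightarrow> (real \<Rightarrow> 'b) \<Rightarrow> real \<Rightarrow> real" where
  "metric_deriv I dst \<gamma> t = Lim (at t within I) (\<lambda>s. dst (\<gamma> s) (\<gamma> t) / \<bar>s - t\<bar>)"

definition curve_length :: "real set \<Rightarrow> ('b \<Rightarrow> 'b \<Rightarrow> real) \<Rightarrow> (real \<Rightarrow> 'b) \<Rightarrow> real" where
  "curve_length I dst \<gamma> = (LINT t:I|lebesgue. metric_deriv I dst \<gamma> t)"

definition geodesic_space :: "'b set \<Rightarrow> ('b \<Rightarrow> 'b \<Rightarrow> real) \<Rightarrow> bool" where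
  "geodesic_space X dst \<longleftrightarrow>
    Metric_space X dst \<and>
    (\<forall>x\<in>X. \<forall>y\<in>X. \<exists>\<gamma>\<in>AC {0..1} X dst.
      \<gamma> 0 = x \<and> \<gamma> 1 = y \<and> curve_length {0..1} dst \<gamma> = dst x y)"

section \<open>Wasserstein and sliced Wasserstein distances\<close>

definition P2 :: "'a::euclidean_space measure set" where
  "P2 = {\<mu>. prob_space \<mu> \<and> sets \<mu> = sets borel \<and> integrable \<mu> (\<lambda>x. (norm x)\<^sup>2)}"

definition couplings ::
  "'a::euclidean_space measure \<Rightarrow> 'a measure \<Rightarrow> ('a \<times> 'a) measure set" where
  "couplings \<mu> \<nu> =
    {\<pi>. sets \<pi> = sets (borel \<Otimes>\<^sub>M borel) \<and> distr \<pi> borel fst = \<mu> \<and> distr \<pi> borel snd = \<nu>}"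

text \<open>The infimum below is finite for measures in \<open>P2\<close>.\<close>

definition W :: "'a::euclidean_space measure \<Rightarrow> 'a measure \<Rightarrow> real" where
  "W \<mu> \<nu> = sqrt (enn2real
    (INF \<pi>\<in>couplings \<mu> \<nu>. \<integral>\<^sup>+ p. ennreal ((dist (fst p) (snd p))\<^sup>2) \<partial>\<pi>))"

text \<open>
  The uniform probability measure on the unit sphere, as the normalised cone measure: the
  image of the uniform distribution on the unit ball under the radial projection
  \<open>sgn x = x /\<^sub>R norm x\<close>. It is taken as a Borel measure on the whole space that is concentrated
  on the sphere; the value \<open>sgn 0 = 0\<close> is attained on a null set only.
\<close>

definition sphere_measure :: "'a::euclidean_space measure" where
  "sphere_measure = distr (uniform_measure lborel (ball 0 1)) borel sgn"

definition proj_measure :: "'a::euclidean_space \<Rightarrow> 'a measure \<Rightarrow> real measure" where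
  "proj_measure \<theta> \<mu> = distr \<mu> borel (\<lambda>x. x \<bullet> \<theta>)"

definition SW :: "'a::euclidean_space measure \<Rightarrow> 'a measure \<Rightarrow> real" where
  "SW \<mu> \<nu> = sqrt (LINT \<theta>:sphere 0 1|sphere_measure.
    (W (proj_measure \<theta> \<mu>) (proj_measure \<theta> \<nu>))\<^sup>2)"

text \<open>
  The infimum is taken in \<open>ennreal\<close>, so that it is infinite when there is no admissible curve
  (hence \<open>ell_SW\<close> is 0 by convention outside \<open>P2\<close>, where a real infimum of the empty set would
  be unspecified).
\<close>

definition ell_SW :: "'a::euclidean_space measure \<Rightarrow> 'a measure \<Rightarrow> real" where
  "ell_SW \<mu> \<nu> = enn2real
    (INF \<gamma>\<in>{\<gamma>\<in>AC {0..1} P2 SW. \<gamma> 0 = \<mu> \<and> \<gamma> 1 = \<nu>}. ennreal (curve_length {0..1} SW \<gamma>))"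

end

theory Submission
  imports Defs
begin

text \<open>
  Reparametrised by arc length, an absolutely continuous curve of length \<open>L\<close> is \<open>L\<close>-Lipschitz, so
  \<open>ell_SW \<mu> \<nu>\<close> is the infimum of the Lipschitz constants of the curves from \<open>\<mu>\<close> to \<open>\<nu>\<close>. Sets bounded
  for \<open>SW\<close> have bounded second moments, hence are narrowly sequentially compact, and \<open>SW\<close> is
  narrowly lower semicontinuous. A diagonal argument over countably many times thus extracts from
  a minimising sequence a limit curve with the optimal constant. The minimiser is Lipschitz for
  \<open>ell_SW\<close> with the same constant, and by the triangle inequality it has constant speed.

  The metric derivative of a curve is the supremum of the derivatives of its distances to countably
  many of its points. On the line, \<open>W\<close> is the \<open>L\<^sup>2\<close> distance of the quantile functions; a layer cake
  formula in the distribution functions makes it lower semicontinuous. That \<open>SW\<close> separates points is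
  the Cramer-Wold theorem. Narrow compactness comes from coding points as real numbers and applying
  Helly's selection theorem to the distributions of the codes.
\<close>

section \<open>Lebesgue differentiation\<close>

text \<open>Two topologies are in play: sets bounded for \<open>SW\<close> are compact for narrow
  convergence, and for this convergence \<open>SW\<close> is merely lower semicontinuous. Upper
  bounds on distances survive such limits, and for a Lipschitz curve the length bound is nothing but
  a family of such bounds at pairs of times. The passage to Lipschitz curves requires that the
  length really dominates the distances, although it is defined as the integral of a
  \<open>Lim\<close> that may be meaningless on a null set. Hence Lebesgue differentiation, applied
  to integral representations of the distances along the curve. The codes are written in base 3 so
  that decoding is continuous, although coding is not; only decoding has to be compatible with weak
  limits. Infinity is kept as the boundary of the unit ball, and the second moments show that no
  mass arrives there. The Cramer-Wold theorem has to start from almost every direction only, since a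
  vanishing integral over the sphere says no more.\<close>

lemma integrable_absolutely_continuous:
  fixes f :: "'a \<Rightarrow> real"
  assumes f: "integrable M f" and e: "0 < e"
  obtains d where "0 < d"
    "\<And>S. S \<in> sets M \<Longrightarrow> emeasure M S < ennreal d \<Longrightarrow> (LINT x:S|M. \<bar>f x\<bar>) < e"
proof -
  have [measurable]: "f \<in> borel_measurable M" using f by auto
  \<comment> \<open>The function splits at level \<open>n\<close>: the excess over \<open>n\<close>
    has a small integral for large \<open>n\<close>, and the rest contributes at most
    \<open>n\<close> times the measure of the set.\<close>
  have "(\<lambda>n. LINT x|M. max (\<bar>f x\<bar> - real n) 0) \<longlonglongrightarrow> (LINT x|M. 0)"
  proof (rule integral_dominated_convergence[where w="\<lambda>x. \<bar>f x\<bar>"])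
    show "AE x in M. (\<lambda>n. max (\<bar>f x\<bar> - real n) 0) \<longlonglongrightarrow> 0"
    proof (rule AE_I2)
      fix x
      obtain N where "\<bar>f x\<bar> \<le> real N" using real_arch_simple by blast
      then have "\<forall>\<^sub>F n in sequentially. max (\<bar>f x\<bar> - real n) 0 = 0"
        by (intro eventually_sequentiallyI[of N]) (auto simp: max_def)
      then show "(\<lambda>n. max (\<bar>f x\<bar> - real n) 0) \<longlonglongrightarrow> 0"
        by (rule tendsto_eventually)
    qed
  qed (use f in auto)
  then have "\<forall>\<^sub>F n in sequentially. (LINT x|M. max (\<bar>f x\<bar> - real n) 0) < e/2"
    using e by (intro order_tendstoD(2)[of _ 0]) auto
  then obtain n where n: "(LINT x|M. max (\<bar>f x\<bar> - real n) 0) < e/2"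
    by (auto simp: eventually_sequentially)
  define d where "d = e / (2 * (real n + 1))"
  have d: "d > 0" unfolding d_def using e by (auto intro!: divide_pos_pos)
  show ?thesis
  proof (rule that[OF d])
    fix S assume S[measurable]: "S \<in> sets M" and Sd: "emeasure M S < ennreal d"
    have fin: "emeasure M S < \<infinity>" using Sd by (auto simp: less_top[symmetric])
    have int: "integrable M (\<lambda>x. max (\<bar>f x\<bar> - real n) 0)"
      by (rule Bochner_Integration.integrable_bound[OF integrable_abs[OF f]]) auto
    have ind: "integrable M (indicator S :: _ \<Rightarrow> real)" using fin by auto
    have mS: "measure M S < d"
      using Sd d fin by (simp add: measure_def enn2real_less_iff less_top)
    have "(LINT x:S|M. \<bar>f x\<bar>) \<le> (LINT x|M. max (\<bar>f x\<bar> - real n) 0 + real n * indicator S x)"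
      unfolding set_lebesgue_integral_def
      by (rule integral_mono) (use f int ind in \<open>auto split: split_indicator intro!: integrable_mult_indicator[where 'b=real, simplified]\<close>)
    also have "\<dots> = (LINT x|M. max (\<bar>f x\<bar> - real n) 0) + real n * measure M S"
      using int ind by simp
    also have "\<dots> < e/2 + e/2"
    proof -
      have "real n * measure M S \<le> real n * d" using mS by (intro mult_left_mono) auto
      also have "\<dots> \<le> e/2" unfolding d_def using e by (simp add: field_simps)
      finally show ?thesis using n by linarith
    qed
    finally show "(LINT x:S|M. \<bar>f x\<bar>) < e" by simp
  qed
qed

text \<open>Vitali's theorem covers almost all of the set by disjoint intervals on which the mean of
  \<open>f\<close> exceeds \<open>q\<close>, all inside an open set \<open>U\<close> that barely
  exceeds \<open>{f < p}\<close>. On their union \<open>V\<close> the integral of \<open>f\<close>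
  is at least \<open>q\<close> times the measure, but at most \<open>p\<close> times the measure up
  to small errors from \<open>U - A\<close>. As \<open>p < q\<close>, \<open>V\<close> is
  small.\<close>

lemma negligible_upper_density_gap:
  fixes f :: "real \<Rightarrow> real"
  assumes f: "integrable lborel f" and pq: "p < q"
  shows "negligible {t. f t < p \<and> (\<forall>d>0. \<exists>a b. a < b \<and> a \<le> t \<and> t \<le> b \<and> b - a < d \<and>
            q * (b - a) < (LINT x:{a..b}|lborel. f x))}" (is "negligible ?E")
  unfolding negligible_outer_le
proof (intro allI impI)
  fix e :: real assume e: "0 < e"
  have [measurable]: "f \<in> borel_measurable borel" using f by auto
  \<comment> \<open>There are two errors, each at most \<open>\<eta>\<close>, and together they
    amount to \<open>e * (q - p)\<close>.\<close>
  define \<eta> where "\<eta> = e * (q - p) / 2"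
  have \<eta>: "\<eta> > 0" unfolding \<eta>_def using e pq by auto
  obtain d0 where d0: "0 < d0"
    and small: "\<And>S. S \<in> sets lborel \<Longrightarrow> emeasure lborel S < ennreal d0 \<Longrightarrow> (LINT x:S|lborel. \<bar>f x\<bar>) < \<eta>"
    using integrable_absolutely_continuous[OF f \<eta>] by metis
  define A where "A = {t. f t < p}"
  have A[measurable]: "A \<in> sets borel" unfolding A_def by measurable
  \<comment> \<open>The first bound controls the integral of \<open>\<bar>f\<bar>\<close> over
    \<open>U - A\<close>, the second one controls \<open>\<bar>p\<bar>\<close> times its measure;
    the summand 1 covers \<open>p = 0\<close>.\<close>
  define d1 where "d1 = min d0 (\<eta> / (\<bar>p\<bar> + 1))"
  have d1: "d1 > 0" unfolding d1_def using d0 \<eta> by auto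
  obtain U where U: "open U" "A \<subseteq> U" "U - A \<in> lmeasurable" "emeasure lebesgue (U - A) < ennreal d1"
    using sets_lebesgue_outer_open[of A d1] d1 A by auto
  have Um[measurable]: "U \<in> sets borel" using U(1) by auto
  have UA: "emeasure lborel (U - A) < ennreal d1" using U(4) A Um by simp
  have UAd0: "emeasure lborel (U - A) < ennreal d0"
    using UA by (rule less_le_trans) (simp add: d1_def ennreal_leI)
  have UAfin: "emeasure lborel (U - A) < \<infinity>" using UA by (auto simp: less_top[symmetric])
  have UAm: "measure lborel (U - A) \<le> \<eta> / (\<bar>p\<bar> + 1)"
  proof -
    have "emeasure lborel (U - A) \<le> ennreal (\<eta> / (\<bar>p\<bar> + 1))"
      using UA by (rule order_trans[OF less_imp_le]) (simp add: d1_def ennreal_leI)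
    then show ?thesis using \<eta> by (simp add: measure_def enn2real_leI)
  qed
  have pUA: "\<bar>p\<bar> * measure lborel (U - A) \<le> \<eta>"
  proof -
    have "\<bar>p\<bar> * measure lborel (U - A) \<le> \<bar>p\<bar> * (\<eta> / (\<bar>p\<bar> + 1))"
      by (intro mult_left_mono UAm) auto
    also have "\<dots> \<le> \<eta>" using \<eta> by (simp add: field_simps)
    finally show ?thesis .
  qed
  define K where "K = {(a::real,b). a < b \<and> {a..b} \<subseteq> U \<and> q * (b - a) < (LINT x:{a..b}|lborel. f x)}"
  define c where "c = (\<lambda>i::real\<times>real. (fst i + snd i) / 2)"
  define r where "r = (\<lambda>i::real\<times>real. (snd i - fst i) / 2)"
  have cb: "cball (c i) (r i) = {fst i..snd i}" for i
    unfolding cball_eq_atLeastAtMost c_def r_def by (auto simp: field_simps)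
  obtain C where C: "countable C" "C \<subseteq> K"
     "pairwise (\<lambda>i j. disjnt (cball (c i) (r i)) (cball (c j) (r j))) C"
     "negligible (?E - (\<Union>i\<in>C. cball (c i) (r i)))"
  proof (rule Vitali_covering_theorem_cballs[of K r ?E c])
    show "0 < r i" if "i \<in> K" for i using that by (auto simp: K_def r_def)
    fix x d assume x: "x \<in> ?E" and d: "0 < (d::real)"
    have "x \<in> U" using x U(2) by (auto simp: A_def)
    then obtain \<rho> where \<rho>: "\<rho> > 0" "ball x \<rho> \<subseteq> U" using U(1) openE by blast
    obtain a b where ab: "a < b" "a \<le> x" "x \<le> b" "b - a < min \<rho> d" "q * (b - a) < (LINT x:{a..b}|lborel. f x)"
      using x \<rho>(1) d by (auto dest!: spec[of _ "min \<rho> d"])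
    have "{a..b} \<subseteq> ball x \<rho>" using ab by (auto simp: dist_real_def)
    then have "(a,b) \<in> K" using ab \<rho> by (auto simp: K_def)
    moreover have "x \<in> cball (c (a,b)) (r (a,b))" unfolding cb using ab by auto
    moreover have "r (a,b) < d" using ab by (auto simp: r_def)
    ultimately show "\<exists>i. i \<in> K \<and> x \<in> cball (c i) (r i) \<and> r i < d" by blast
  qed
  have arith: "v \<le> e" if "q * v \<le> p * v + 2 * \<eta>" for v
  proof -
    have "2 * \<eta> = e * (q - p)" by (simp add: \<eta>_def)
    with that have "(q - p) * v \<le> (q - p) * e" by (simp add: algebra_simps)
    then show ?thesis using pq by simp
  qed
  let ?I = "\<lambda>i::real\<times>real. {fst i..snd i}"
  have disj: "disjoint_family_on ?I C"
    using C(3) unfolding cb by (auto simp: disjoint_family_on_def pairwise_def disjnt_def)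
  \<comment> \<open>The estimate for finite subfamilies is uniform and therefore passes to the
    countable union.\<close>
  have bound: "measure lebesgue (\<Union>i\<in>C'. ?I i) \<le> e" if C': "C' \<subseteq> C" "finite C'" for C'
  proof -
    let ?V = "\<Union>i\<in>C'. ?I i"
    have Vm[measurable]: "?V \<in> sets borel" using C'(2) by (intro sets.finite_UN) auto
    have VU: "?V \<subseteq> U" using C' C(2) by (fastforce simp: K_def)
    have dj: "disjoint_family_on ?I C'" using disj C'(1) by (rule disjoint_family_on_mono[rotated])
    have iI: "integrable lborel (indicator (?I i) :: _ \<Rightarrow> real)" for i
      by (intro integrable_real_indicator) (auto simp: emeasure_lborel_Icc_eq)
    have indV: "indicator ?V x = (\<Sum>i\<in>C'. indicator (?I i) x :: real)" for x
      by (rule indicator_UN_disjoint[OF C'(2) dj])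
    have mV: "measure lborel ?V = (\<Sum>i\<in>C'. measure lborel (?I i))"
      by (rule measure_finite_Union[OF C'(2) _ dj]) (auto simp: emeasure_lborel_Icc_eq)
    have intV: "integrable lborel (indicator ?V :: _ \<Rightarrow> real)"
      unfolding indV[abs_def] using iI by (intro Bochner_Integration.integrable_sum)
    have fI: "integrable lborel (\<lambda>x. indicator S x * f x)" if "S \<in> sets borel" for S
      using integrable_mult_indicator[OF _ f, of S] that by simp
    have "q * measure lborel ?V = (\<Sum>i\<in>C'. q * (snd i - fst i))"
    proof -
      have "measure lborel (?I i) = snd i - fst i" if "i \<in> C'" for i
        using that C' C(2) by (force simp: K_def)
      then show ?thesis unfolding mV sum_distrib_left by (intro sum.cong) auto
    qed
    also have "\<dots> \<le> (\<Sum>i\<in>C'. LINT x:?I i|lborel. f x)"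
      by (intro sum_mono) (use C' C(2) in \<open>force simp: K_def\<close>)
    also have "\<dots> = (LINT x:?V|lborel. f x)"
      unfolding set_lebesgue_integral_def indV using fI by (simp add: sum_distrib_right)
    also have "\<dots> \<le> (LINT x|lborel. p * indicator ?V x + (indicator (U - A) x * \<bar>f x\<bar> + \<bar>p\<bar> * indicator (U - A) x))"
      unfolding set_lebesgue_integral_def
    proof (rule integral_mono)
      show "integrable lborel (\<lambda>x. indicator ?V x *\<^sub>R f x)" using fI[OF Vm] by simp
      show "integrable lborel (\<lambda>x. p * indicator ?V x + (indicator (U - A) x * \<bar>f x\<bar> + \<bar>p\<bar> * indicator (U - A) x))"
        using intV UAfin integrable_mult_indicator[OF _ integrable_abs[OF f], of "U - A"]
        by (intro Bochner_Integration.integrable_add integrable_mult_right) auto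
      fix x
      show "indicator ?V x *\<^sub>R f x \<le> p * indicator ?V x + (indicator (U - A) x * \<bar>f x\<bar> + \<bar>p\<bar> * indicator (U - A) x)"
        using subsetD[OF VU, of x] by (cases "x \<in> ?V"; cases "x \<in> A") (auto simp: A_def indicator_def)
    qed
    also have "\<dots> = p * measure lborel ?V + ((LINT x:U-A|lborel. \<bar>f x\<bar>) + \<bar>p\<bar> * measure lborel (U - A))"
      unfolding set_lebesgue_integral_def
      using intV UAfin integrable_mult_indicator[OF _ integrable_abs[OF f], of "U - A"]
      by (subst Bochner_Integration.integral_add) auto
    also have "\<dots> \<le> p * measure lborel ?V + 2 * \<eta>"
      using small[OF _ UAd0] pUA by auto
    finally have "measure lborel ?V \<le> e" by (rule arith)
    then show ?thesis using Vm by simp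
  qed
  let ?T = "(\<Union>i\<in>C. ?I i)"
  have T: "?T \<in> lmeasurable" "measure lebesgue ?T \<le> e"
    using fmeasurable_UN_bound[OF C(1), of ?I lebesgue e] measure_UN_bound[OF C(1), of ?I lebesgue e] bound
    by auto
  have N: "negligible (?E - ?T)" using C(4) unfolding cb .
  have "measure lebesgue (?T \<union> (?E - ?T)) = measure lebesgue ?T"
    by (intro measure_Un_null_set) (use N T in \<open>auto simp: negligible_iff_null_sets\<close>)
  moreover have "?T \<union> (?E - ?T) \<in> lmeasurable"
    using T N by (intro fmeasurable.Un) (auto intro: negligible_imp_measurable)
  ultimately show "\<exists>T. ?E \<subseteq> T \<and> T \<in> lmeasurable \<and> measure lebesgue T \<le> e"
    using T(2) by (intro exI[of _ "?T \<union> (?E - ?T)"]) auto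
qed

text \<open>An excess of the upper density over \<open>f t\<close> leaves room for rationals
  \<open>p < q\<close> between the two, so countably many of the preceding null sets suffice. The
  lower bound comes later from \<open>- f\<close>.\<close>

lemma AE_upper_density_le:
  fixes f :: "real \<Rightarrow> real"
  assumes f: "integrable lborel f"
  shows "AE t in lborel. \<forall>e>0. \<exists>d>0. \<forall>a b. a < b \<and> a \<le> t \<and> t \<le> b \<and> b - a < d \<longrightarrow>
           (LINT x:{a..b}|lborel. f x) \<le> (f t + e) * (b - a)"
proof -
  let ?E = "\<lambda>p q. {t. f t < p \<and> (\<forall>d>0. \<exists>a b. a < b \<and> a \<le> t \<and> t \<le> b \<and> b - a < d \<and>
            q * (b - a) < (LINT x:{a..b}|lborel. f x))}"
  have "AE t in lborel. \<forall>p\<in>\<rat>. \<forall>q\<in>\<rat>. p < q \<longrightarrow> t \<notin> ?E p q"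
  proof (intro AE_ball_countable[THEN iffD2] ballI countable_rat)
    fix p q :: real
    show "AE t in lborel. p < q \<longrightarrow> t \<notin> ?E p q"
    proof (cases "p < q")
      case True
      have "?E p q \<in> null_sets lebesgue"
        using negligible_upper_density_gap[OF f True] by (simp add: negligible_iff_null_sets)
      then have "AE t in lebesgue. t \<notin> ?E p q" by (rule AE_not_in)
      then have "AE t in lborel. t \<notin> ?E p q" unfolding AE_completion_iff .
      then show ?thesis by auto
    qed auto
  qed
  then show ?thesis
  proof (eventually_elim, intro allI impI)
    fix t e :: real assume *: "\<forall>p\<in>\<rat>. \<forall>q\<in>\<rat>. p < q \<longrightarrow> t \<notin> ?E p q" and e: "0 < e"
    obtain p where p: "p \<in> \<rat>" "f t < p" "p < f t + e" using Rats_dense_in_real[of "f t" "f t + e"] e by auto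
    obtain q where q: "q \<in> \<rat>" "p < q" "q < f t + e" using Rats_dense_in_real[of "p" "f t + e"] p by auto
    have "t \<notin> ?E p q" using * p q by blast
    then obtain d where d: "d > 0" "\<And>a b. a < b \<and> a \<le> t \<and> t \<le> b \<and> b - a < d \<Longrightarrow>
        (LINT x:{a..b}|lborel. f x) \<le> q * (b - a)"
      using p(2) by (force simp: not_less)
    show "\<exists>d>0. \<forall>a b. a < b \<and> a \<le> t \<and> t \<le> b \<and> b - a < d \<longrightarrow>
           (LINT x:{a..b}|lborel. f x) \<le> (f t + e) * (b - a)"
    proof (intro exI[of _ d] conjI allI impI d(1))
      fix a b assume ab: "a < b \<and> a \<le> t \<and> t \<le> b \<and> b - a < d"
      have "(LINT x:{a..b}|lborel. f x) \<le> q * (b - a)" by (rule d(2)[OF ab])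
      also have "\<dots> \<le> (f t + e) * (b - a)" using ab q by (intro mult_right_mono) auto
      finally show "(LINT x:{a..b}|lborel. f x) \<le> (f t + e) * (b - a)" .
    qed
  qed
qed

theorem Lebesgue_differentiation:
  fixes f :: "real \<Rightarrow> real"
  assumes f: "integrable lborel f"
  shows "AE t in lborel. ((\<lambda>s. (LINT x:{min s t..max s t}|lborel. f x) / \<bar>s - t\<bar>) \<longlongrightarrow> f t) (at t)"
proof -
  have "integrable lborel (\<lambda>x. - f x)" using f by simp
  from AE_upper_density_le[OF this] AE_upper_density_le[OF f] show ?thesis
  proof eventually_elim
    case (elim t)
    show ?case
    proof (rule tendstoI)
      fix e :: real assume e: "0 < e"
      obtain d1 where d1: "d1 > 0" "\<And>a b. a < b \<and> a \<le> t \<and> t \<le> b \<and> b - a < d1 \<Longrightarrow>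
           (LINT x:{a..b}|lborel. f x) \<le> (f t + e/2) * (b - a)"
        using elim(2) e by (metis half_gt_zero)
      obtain d2 where d2: "d2 > 0" "\<And>a b. a < b \<and> a \<le> t \<and> t \<le> b \<and> b - a < d2 \<Longrightarrow>
           (LINT x:{a..b}|lborel. - f x) \<le> (- f t + e/2) * (b - a)"
        using elim(1) e by (metis half_gt_zero)
      show "\<forall>\<^sub>F s in at t. dist ((LINT x:{min s t..max s t}|lborel. f x) / \<bar>s - t\<bar>) (f t) < e"
        unfolding eventually_at
      proof (intro exI[of _ "min d1 d2"] conjI ballI impI)
        fix s assume s: "s \<noteq> t \<and> dist s t < min d1 d2"
        let ?a = "min s t" and ?b = "max s t"
        have ab: "?a < ?b" "?a \<le> t" "t \<le> ?b" "?b - ?a = \<bar>s - t\<bar>" "\<bar>s - t\<bar> > 0" "\<bar>s-t\<bar> < d1" "\<bar>s-t\<bar> < d2"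
          using s by (auto simp: dist_real_def)
        have 1: "(LINT x:{?a..?b}|lborel. f x) \<le> (f t + e/2) * \<bar>s - t\<bar>"
          using d1(2)[of ?a ?b] ab by auto
        have "(LINT x:{?a..?b}|lborel. - f x) \<le> (- f t + e/2) * \<bar>s - t\<bar>"
          using d2(2)[of ?a ?b] ab by auto
        moreover have "(LINT x:{?a..?b}|lborel. - f x) = - (LINT x:{?a..?b}|lborel. f x)"
          by (simp add: set_lebesgue_integral_def)
        ultimately have 2: "(LINT x:{?a..?b}|lborel. f x) \<ge> (f t - e/2) * \<bar>s - t\<bar>"
          by (simp add: algebra_simps)
        have "(LINT x:{?a..?b}|lborel. f x) / \<bar>s - t\<bar> \<le> f t + e/2"
          using 1 ab(5) by (simp add: pos_divide_le_eq)
        moreover have "(LINT x:{?a..?b}|lborel. f x) / \<bar>s - t\<bar> \<ge> f t - e/2"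
          using 2 ab(5) by (simp add: pos_le_divide_eq)
        ultimately show "dist ((LINT x:{?a..?b}|lborel. f x) / \<bar>s - t\<bar>) (f t) < e"
          using e by (simp add: dist_real_def abs_less_iff)
      qed (use d1 d2 in auto)
    qed
  qed
qed

section \<open>Densities of functions with dominated increments\<close>

lemma set_integral_Icc_Ioc:
  fixes f :: "real \<Rightarrow> real"
  assumes [measurable]: "f \<in> borel_measurable borel"
  shows "(LINT x:{a..b}|lborel. f x) = (LINT x:{a<..b}|lborel. f x)"
  unfolding set_lebesgue_integral_def
proof (rule integral_cong_AE)
  show "AE x in lborel. indicat_real {a..b} x *\<^sub>R f x = indicat_real {a<..b} x *\<^sub>R f x"
    using AE_lborel_singleton[of a] by eventually_elim (auto simp: indicator_def)
qed auto

text \<open>The majorant in \<open>AC\<close> is only Lebesgue measurable, carries information on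
  \<open>{0..1}\<close> alone and may change sign. A Borel version of its absolute value, cut off
  outside \<open>{0..1}\<close>, can serve as the density of a finite measure on the line.\<close>

lemma lebesgue_integrable_borel_majorant:
  fixes g :: "real \<Rightarrow> real"
  assumes g: "set_integrable lebesgue {0..1} g"
  obtains k where "integrable lborel k" "\<And>x. 0 \<le> k x" "\<And>x. x \<notin> {0..1} \<Longrightarrow> k x = 0"
    "\<And>a b. 0 \<le> a \<Longrightarrow> b \<le> 1 \<Longrightarrow> (LINT r:{a..b}|lebesgue. g r) \<le> (LINT r:{a..b}|lborel. k r)"
proof -
  let ?g = "\<lambda>x. indicat_real {0..1} x *\<^sub>R g x"
  have gi: "integrable lebesgue ?g" using g by (simp add: set_integrable_def)
  then have "?g \<in> borel_measurable lebesgue" by auto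
  from completion_ex_borel_measurable_real[OF this]
  obtain g' where g'[measurable]: "g' \<in> borel_measurable lborel" and eq: "AE x in lborel. ?g x = g' x" by blast
  have eq': "AE x in lebesgue. ?g x = g' x" using eq by (rule AE_completion)
  have g'm: "g' \<in> borel_measurable lebesgue" using g' by (rule measurable_completion)
  have "integrable lebesgue g'"
    using integrable_cong_AE[THEN iffD1, OF _ g'm eq' gi] gi by auto
  then have g'i: "integrable lborel g'" using integrable_completion[OF g'] by simp
  define k where "k x = indicat_real {0..1} x * \<bar>g' x\<bar>" for x
  have ki: "integrable lborel k"
    unfolding k_def using integrable_mult_indicator[OF _ integrable_abs[OF g'i], of "{0..1}"] by simp
  have km[measurable]: "k \<in> borel_measurable borel" using ki by auto
  show ?thesis
  proof (rule that[OF ki])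
    fix a b :: real assume ab: "0 \<le> a" "b \<le> 1"
    have "(LINT r:{a..b}|lebesgue. g r) \<le> (LINT r:{a..b}|lebesgue. k r)"
      unfolding set_lebesgue_integral_def
    proof (rule integral_mono_AE)
      have *: "indicat_real {a..b} x *\<^sub>R g x = indicat_real {a..b} x *\<^sub>R ?g x" for x
        using ab by (auto simp: indicator_def)
      show "integrable lebesgue (\<lambda>x. indicat_real {a..b} x *\<^sub>R g x)"
        unfolding * by (rule integrable_mult_indicator[OF _ gi]) auto
      have "integrable lebesgue k" using ki integrable_completion[of k lborel] by auto
      then show "integrable lebesgue (\<lambda>x. indicat_real {a..b} x *\<^sub>R k x)"
        by (rule integrable_mult_indicator[rotated]) auto
      show "AE x in lebesgue. indicat_real {a..b} x *\<^sub>R g x \<le> indicat_real {a..b} x *\<^sub>R k x"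
        using eq' by eventually_elim (use ab in \<open>auto simp: indicator_def k_def split: if_splits\<close>)
    qed
    also have "\<dots> = (LINT r:{a..b}|lborel. k r)"
      unfolding set_lebesgue_integral_def by (rule integral_completion) auto
    finally show "(LINT r:{a..b}|lebesgue. g r) \<le> (LINT r:{a..b}|lborel. k r)" .
  qed (auto simp: k_def)
qed

lemma emeasure_density_integrable:
  fixes k :: "'a \<Rightarrow> real"
  assumes k: "integrable M k" "\<And>x. 0 \<le> k x" and A: "A \<in> sets M"
  shows "emeasure (density M (\<lambda>x. ennreal (k x))) A = ennreal (LINT x:A|M. k x)"
proof -
  have "emeasure (density M (\<lambda>x. ennreal (k x))) A = (\<integral>\<^sup>+ x. ennreal (indicat_real A x *\<^sub>R k x) \<partial>M)"
    using k(1) A by (subst emeasure_density) (auto split: split_indicator intro!: nn_integral_cong)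
  also have "\<dots> = ennreal (LINT x:A|M. k x)"
    unfolding set_lebesgue_integral_def
    using A by (intro nn_integral_eq_integral integrable_mult_indicator k(1)) (auto simp: k(2))
  finally show ?thesis .
qed

text \<open>Adding \<open>\<phi>\<close> to, and subtracting it from, the indefinite integral of \<open>k\<close> gives two Stieltjes measures
  with sum \<open>2 k dx\<close>. Hence both are absolutely continuous, and a density of the first one gives \<open>h\<close>.\<close>

lemma dominated_function_density:
  fixes k \<phi> :: "real \<Rightarrow> real"
  assumes k: "integrable lborel k" "\<And>x. 0 \<le> k x" "\<And>x. x \<notin> {0..1} \<Longrightarrow> k x = 0"
    and \<phi>: "\<And>s t. s \<le> t \<Longrightarrow> \<bar>\<phi> t - \<phi> s\<bar> \<le> (LINT x:{s..t}|lborel. k x)"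
  obtains h where "integrable lborel h" "\<And>s t. s \<le> t \<Longrightarrow> \<phi> t - \<phi> s = (LINT x:{s..t}|lborel. h x)"
proof -
  have [measurable]: "k \<in> borel_measurable borel" using k(1) by auto
  define N where "N = density lborel (\<lambda>x. ennreal (k x))"
  have finN: "finite_measure N"
    by (rule finite_measureI)
       (use k in \<open>simp add: N_def emeasure_density nn_integral_eq_integral\<close>)
  interpret N: finite_measure N by (rule finN)
  interpret N: finite_borel_measure N by standard (simp add: N_def)
  have emN: "emeasure N A = ennreal (LINT x:A|lborel. k x)" if "A \<in> sets borel" for A
    unfolding N_def using that by (intro emeasure_density_integrable k) simp
  have mN: "measure N A = (LINT x:A|lborel. k x)" if "A \<in> sets borel" for A
    unfolding measure_def emN[OF that] set_lebesgue_integral_def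
    by (intro enn2real_ennreal Bochner_Integration.integral_nonneg) (auto simp: k)
  have diff: "cdf N t - cdf N s = (LINT x:{s..t}|lborel. k x)" if "s \<le> t" for s t
  proof (cases "s < t")
    case True
    then show ?thesis using N.cdf_diff_eq[OF True] mN[of "{s<..t}"] by (simp add: set_integral_Icc_Ioc)
  next
    case False
    then have "s = t" using that by simp
    then show ?thesis by (subst set_integral_Icc_Ioc) (auto simp: set_lebesgue_integral_def)
  qed
  \<comment> \<open>For \<open>c = 1\<close> and \<open>c = -1\<close> the domination hypothesis
    makes \<open>F c\<close> increasing. Since \<open>k\<close> vanishes outside
    \<open>{0..1}\<close>, \<open>F c\<close> is constant up to -1 and from 2 on; subtracting the
    value at -1 normalises it to 0 at the left end.\<close>
  define F where "F c t = cdf N t + c * (\<phi> t - \<phi> (-1))" for c t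
  have F: "mono (F c)" "\<And>a. continuous (at_right a) (F c)" "(F c \<longlongrightarrow> 0) at_bot" "(F c \<longlongrightarrow> F c 2) at_top"
    if c: "c = 1 \<or> c = -1" for c
  proof -
    have zero: "(LINT x:{s..t}|lborel. k x) = 0" if "{s..t} \<inter> {0..1} = {}" for s t
    proof -
      have "indicat_real {s..t} x *\<^sub>R k x = 0" for x using k(3)[of x] that by (auto simp: indicator_def)
      then show ?thesis unfolding set_lebesgue_integral_def by (simp only:) simp
    qed
    have dF: "0 \<le> F c t - F c s \<and> F c t - F c s \<le> 2 * (cdf N t - cdf N s)" if "s \<le> t" for s t
      using \<phi>[OF that] diff[OF that] c by (auto simp: F_def abs_le_iff)
    show m: "mono (F c)" using dF by (intro monoI) (auto simp: le_diff_eq)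
    show "continuous (at_right a) (F c)" for a
    proof -
      have "((\<lambda>t. 2 * (cdf N t - cdf N a)) \<longlongrightarrow> 2 * (cdf N a - cdf N a)) (at_right a)"
        using N.cdf_is_right_cont[of a] by (intro tendsto_intros) (auto simp: continuous_within)
      then have z: "((\<lambda>t. 2 * (cdf N t - cdf N a)) \<longlongrightarrow> 0) (at_right a)" by simp
      have "((\<lambda>t. F c t - F c a) \<longlongrightarrow> 0) (at_right a)"
        by (rule tendsto_sandwich[OF _ _ tendsto_const z])
           (use dF[of a] in \<open>auto simp: eventually_at_filter\<close>)
      then show ?thesis by (simp add: continuous_within LIM_zero_iff)
    qed
    have Nm1: "cdf N t = 0" if "t \<le> -1" for t
    proof -
      have "indicat_real {..t} x *\<^sub>R k x = 0" for x using k(3)[of x] that by (auto simp: indicator_def)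
      then show ?thesis unfolding cdf_def set_lebesgue_integral_def mN[OF atMost_borel] by (simp only:) simp
    qed
    have "F c t = 0" if "t \<le> -1" for t
      using \<phi>[OF that] zero[of t "-1"] Nm1[OF that] by (auto simp: F_def)
    then have "\<forall>\<^sub>F t in at_bot. F c t = 0" unfolding eventually_at_bot_linorder by blast
    then show "(F c \<longlongrightarrow> 0) at_bot" by (rule tendsto_eventually)
    have "F c t = F c 2" if "2 \<le> t" for t
      using \<phi>[OF that] zero[of 2 t] diff[OF that] by (auto simp: F_def)
    then have "\<forall>\<^sub>F t in at_top. F c t = F c 2" unfolding eventually_at_top_linorder by blast
    then show "(F c \<longlongrightarrow> F c 2) at_top" by (rule tendsto_eventually)
  qed
  have F0: "0 \<le> F c 2" if c: "c = 1 \<or> c = -1" for c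
    using monoD[OF F(1)[OF c], of "-1" 2] N.cdf_nonneg[of "-1"] by (simp add: F_def)
  define Q where "Q c = interval_measure (F c)" for c
  have Ffin: "finite_borel_measure (Q c)" if c: "c = 1 \<or> c = -1" for c
    unfolding Q_def
    by (rule finite_borel_measure_interval_measure[OF _ F(2-4)[OF c]])
       (use F(1)[OF c] F0[OF c] in \<open>auto simp: mono_def\<close>)
  interpret Q1: finite_borel_measure "Q 1" by (rule Ffin) simp
  interpret Q2: finite_borel_measure "Q (-1)" by (rule Ffin) simp
  have QI: "emeasure (Q c) {a<..b} = ennreal (F c b - F c a)" if c: "c = 1 \<or> c = -1" and "a \<le> b" for c a b
    unfolding Q_def using F[OF c] that by (intro emeasure_interval_measure_Ioc) (auto simp: mono_def)
  have QU: "emeasure (Q c) UNIV = ennreal (F c 2)" if c: "c = 1 \<or> c = -1" for c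
    unfolding Q_def
    by (rule interval_measure_UNIV[OF _ F(2-4)[OF c]])
       (use F(1)[OF c] F0[OF c] in \<open>auto simp: mono_def\<close>)
  have NU: "measure N UNIV = cdf N 2"
  proof -
    have "indicat_real UNIV x *\<^sub>R k x = indicat_real {..2} x *\<^sub>R k x" for x
      using k(3)[of x] by (auto simp: indicator_def)
    then have "(LINT x:UNIV|lborel. k x) = (LINT x:{..2}|lborel. k x)"
      unfolding set_lebesgue_integral_def by (simp only:)
    then show ?thesis unfolding cdf_def using mN[of UNIV] mN[of "{..2}"] by simp
  qed
  \<comment> \<open>On half-open intervals the increments of \<open>\<phi>\<close> cancel; the
    identity extends to Borel sets since these intervals form a generator stable under
    intersection.\<close>
  have sum: "measure (Q 1) A + measure (Q (-1)) A = 2 * measure N A" if A: "A \<in> sets borel" for A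
  proof -
    let ?G = "range (\<lambda>(a, b). {a<..b::real})"
    have ss: "sigma_sets UNIV ?G = sets borel"
      unfolding borel_sigma_sets_Ioc by (rule sets_measure_of[symmetric]) auto
    have I: "Int_stable ?G" by (auto simp: Int_stable_def)
    have P: "?G \<subseteq> Pow UNIV" by simp
    have "A \<in> sigma_sets UNIV ?G" using A ss by simp
    from I P this show ?thesis
    proof (induction rule: sigma_sets_induct_disjoint)
      case (basic A)
      then obtain a b where A: "A = {a<..b}" by auto
      show ?case
      proof (cases "a \<le> b")
        case True
        have "measure (Q c) {a<..b} = F c b - F c a" if c: "c = 1 \<or> c = -1" for c
          using QI[OF that True] F(1)[OF c] True by (simp add: measure_def mono_def)
        moreover have "measure N {a<..b} = cdf N b - cdf N a"
          using diff[OF True] mN[of "{a<..b}"] by (simp add: set_integral_Icc_Ioc)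
        ultimately show ?thesis unfolding A by (simp add: F_def)
      qed (simp add: A)
    next
      case (compl A)
      then have A: "A \<in> sets borel" unfolding ss by simp
      have U: "measure (Q c) UNIV = F c 2" if c: "c = 1 \<or> c = -1" for c
        using QU[OF that] F0[OF c] by (simp add: measure_def)
      show ?case
        using Q1.finite_measure_compl[of A] Q2.finite_measure_compl[of A] N.finite_measure_compl[of A]
          A compl.IH U[of 1] U[of "-1"] NU
        by (simp add: Q1.M_is_borel Q2.M_is_borel N.M_is_borel Q1.borel_UNIV Q2.borel_UNIV N.borel_UNIV F_def)
    next
      case (union A)
      have r: "range A \<subseteq> sets borel" using union(2) unfolding ss .
      have "(\<lambda>i. measure (Q 1) (A i) + measure (Q (-1)) (A i)) sums (measure (Q 1) (\<Union>i. A i) + measure (Q (-1)) (\<Union>i. A i))"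
        using r union(1)
        by (intro sums_add Q1.finite_measure_UNION Q2.finite_measure_UNION) (auto simp: Q1.M_is_borel Q2.M_is_borel)
      moreover have "(\<lambda>i. 2 * measure N (A i)) sums (2 * measure N (\<Union>i. A i))"
        using r union(1) by (intro sums_mult N.finite_measure_UNION) (auto simp: N.M_is_borel)
      ultimately show ?case using union(3) by (simp add: sums_unique2)
    qed auto
  qed
  have sets_Q1: "sets (Q 1) = sets lborel" by (simp add: Q1.M_is_borel)
  \<comment> \<open>A null set has measure 0 for \<open>N\<close>, so the two nonnegative terms in
    \<open>sum\<close> vanish on it.\<close>
  have "absolutely_continuous lborel (Q 1)"
    unfolding absolutely_continuous_def
  proof
    fix A :: "real set" assume A: "A \<in> null_sets lborel"
    then have Ab: "A \<in> sets borel" by auto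
    have "emeasure N A = 0"
      unfolding N_def using A by (subst emeasure_density) (auto intro!: nn_integral_null_set)
    then have "measure N A = 0" by (simp add: measure_def)
    then have "measure (Q 1) A = 0"
      using sum[OF Ab] measure_nonneg[of "Q 1" A] measure_nonneg[of "Q (-1)" A] by linarith
    then show "A \<in> null_sets (Q 1)"
      using Ab by (auto simp: Q1.emeasure_eq_measure Q1.M_is_borel)
  qed
  note ac = this sets_Q1
  obtain h1 where h1m[measurable]: "h1 \<in> borel_measurable lborel"
    and h1eq: "AE x in lborel. RN_deriv lborel (Q 1) x = ennreal (h1 x)" and h10: "\<And>x. 0 \<le> h1 x"
    by (rule sigma_finite_measure.real_RN_deriv[OF sigma_finite_lborel Q1.finite_measure_axioms ac], rule that)
  have "density lborel (\<lambda>x. ennreal (h1 x)) = density lborel (RN_deriv lborel (Q 1))"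
    using h1eq by (intro density_cong) auto
  then have h1Q: "density lborel (\<lambda>x. ennreal (h1 x)) = Q 1"
    using sigma_finite_measure.density_RN_deriv[OF sigma_finite_lborel ac] by simp
  have h1: "integrable lborel h1"
  proof (rule integrableI_nonneg)
    have "(\<integral>\<^sup>+ x. ennreal (h1 x) \<partial>lborel) = emeasure (Q 1) UNIV"
      unfolding h1Q[symmetric] by (subst emeasure_density) auto
    then show "(\<integral>\<^sup>+ x. ennreal (h1 x) \<partial>lborel) < \<infinity>" using QU[of 1] by simp
  qed (auto simp: h10)
  have h1F: "(LINT x:{s<..t}|lborel. h1 x) = F 1 t - F 1 s" if st: "s \<le> t" for s t
  proof (rule ennreal_inj[THEN iffD1])
    show "ennreal (LINT x:{s<..t}|lborel. h1 x) = ennreal (F 1 t - F 1 s)"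
      using emeasure_density_integrable[OF h1 h10, of "{s<..t}"] QI[of 1 s t] st unfolding h1Q by simp
    show "0 \<le> (LINT x:{s<..t}|lborel. h1 x)" unfolding set_lebesgue_integral_def
      by (intro Bochner_Integration.integral_nonneg) (auto simp: h10)
    show "0 \<le> F 1 t - F 1 s" using F(1)[of 1] st by (auto simp: mono_def)
  qed
  \<comment> \<open>The increments of \<open>F 1\<close> are those of \<open>cdf N\<close> plus
    those of \<open>\<phi>\<close>. Removing \<open>k\<close> from the density leaves the density of
    \<open>\<phi>\<close>.\<close>
  show ?thesis
  proof (rule that[of "\<lambda>x. h1 x - k x"])
    show "integrable lborel (\<lambda>x. h1 x - k x)" using h1 k(1) by simp
    fix s t :: real assume st: "s \<le> t"
    have "(LINT x:{s..t}|lborel. h1 x - k x) = (LINT x:{s..t}|lborel. h1 x) - (LINT x:{s..t}|lborel. k x)"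
      unfolding set_lebesgue_integral_def using h1 k(1)
      by (simp add: right_diff_distrib integrable_mult_indicator[where 'b=real, simplified])
    also have "(LINT x:{s..t}|lborel. h1 x) = F 1 t - F 1 s"
      using h1F[OF st] by (simp add: set_integral_Icc_Ioc)
    also have "(LINT x:{s..t}|lborel. k x) = cdf N t - cdf N s" using diff[OF st] by simp
    finally show "\<phi> t - \<phi> s = (LINT x:{s..t}|lborel. h1 x - k x)" by (simp add: F_def)
  qed
qed

section \<open>Absolutely continuous curves\<close>

text \<open>The endpoints are included because a limit of curves is first constructed at the sampled
  times, and its endpoints have to be the prescribed ones.\<close>

lemma dense_time_sequence:
  obtains q :: "nat \<Rightarrow> real" where "\<And>n. q n \<in> {0..1}" "\<And>t e. t \<in> {0..1} \<Longrightarrow> 0 < e \<Longrightarrow> \<exists>n. \<bar>q n - t\<bar> < e"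
    "\<exists>n. q n = 0" "\<exists>n. q n = 1"
proof -
  define q where "q = from_nat_into (\<rat> \<inter> {0..1::real})"
  have q: "range q = \<rat> \<inter> {0..1}"
    unfolding q_def by (rule range_from_nat_into) (auto intro: countable_Int1 countable_rat exI[of _ 0])
  have "\<exists>n. \<bar>q n - t\<bar> < e" if t: "t \<in> {0..1}" "0 < e" for t e
  proof -
    have "\<exists>r\<in>range q. \<bar>r - t\<bar> < e"
      unfolding q
    proof (cases "t < 1")
      case True
      then obtain r where "r \<in> \<rat>" "t < r" "r < min 1 (t + e)"
        using Rats_dense_in_real[of t "min 1 (t + e)"] t by auto
      then show "\<exists>r\<in>\<rat> \<inter> {0..1}. \<bar>r - t\<bar> < e" using t by (intro bexI[of _ r]) auto
    next
      case False
      then show "\<exists>r\<in>\<rat> \<inter> {0..1}. \<bar>r - t\<bar> < e" using t by (intro bexI[of _ 1]) auto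
    qed
    then show ?thesis by blast
  qed
  moreover have "0 \<in> range q" "1 \<in> range q" unfolding q by auto
  then have "\<exists>n. q n = 0" "\<exists>n. q n = 1" by (auto simp: image_iff intro: sym)
  moreover have "q n \<in> {0..1}" for n using q by blast
  ultimately show ?thesis using that by blast
qed

context Metric_space
begin

text \<open>Two properties of \<open>m\<close> force it to be the metric derivative. Its integrals
  dominate the distances, which bounds the difference quotients from above; and it is the supremum
  of the densities \<open>\<bar>h n\<bar>\<close>, whose own quotients bound them from below because
  a distance function is 1-Lipschitz. The length thereby becomes an ordinary Borel integral that
  dominates the distance travelled.\<close>

lemma AC_curve_length:
  assumes \<gamma>: "\<gamma> \<in> AC {0..1} M d"
  obtains m where "integrable lborel m" "\<And>t. 0 \<le> m t"
    "AE t in lborel. t \<in> {0<..<1} \<longrightarrow>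
       ((\<lambda>s. d (\<gamma> s) (\<gamma> t) / \<bar>s - t\<bar>) \<longlongrightarrow> m t) (at t within {0..1})"
    "\<And>s t. 0 \<le> s \<Longrightarrow> s \<le> t \<Longrightarrow> t \<le> 1 \<Longrightarrow> d (\<gamma> s) (\<gamma> t) \<le> (LINT x:{s..t}|lborel. m x)"
    "curve_length {0..1} d \<gamma> = (LINT x:{0..1}|lborel. m x)"
proof -
  have \<gamma>M: "\<gamma> t \<in> M" if "t \<in> {0..1}" for t using \<gamma> that by (auto simp: AC_def)
  let ?J = "\<lambda>f s t. LINT x:{min s t..max s t}|lborel. f x"
  obtain g where g: "set_integrable lebesgue {0..1} g"
    and dg: "\<And>s t. s \<in> {0..1} \<Longrightarrow> t \<in> {0..1} \<Longrightarrow> s \<le> t \<Longrightarrow> d (\<gamma> s) (\<gamma> t) \<le> (LINT r:{s..t}|lebesgue. g r)"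
    using \<gamma> unfolding AC_def by blast
  from lebesgue_integrable_borel_majorant[OF g]
  obtain k where k: "integrable lborel k" "\<And>x. 0 \<le> k x" "\<And>x. x \<notin> {0..1} \<Longrightarrow> k x = 0"
    and gk: "\<And>a b. 0 \<le> a \<Longrightarrow> b \<le> 1 \<Longrightarrow> (LINT r:{a..b}|lebesgue. g r) \<le> (LINT r:{a..b}|lborel. k r)"
    by blast
  have dk: "d (\<gamma> s) (\<gamma> t) \<le> (LINT r:{s..t}|lborel. k r)" if "0 \<le> s" "s \<le> t" "t \<le> 1" for s t
    using dg[of s t] gk[of s t] that by auto
  have si: "integrable lborel (\<lambda>x. indicat_real {s..t} x *\<^sub>R f x)" if "integrable lborel f" for f :: "real \<Rightarrow> real" and s t
    using that by (intro integrable_mult_indicator) auto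
  have smono: "(LINT r:{s..t}|lborel. f r) \<le> (LINT r:{s'..t'}|lborel. f r)"
    if "integrable lborel f" "\<And>x. 0 \<le> f x" "s' \<le> s" "t \<le> t'" for f :: "real \<Rightarrow> real" and s t s' t'
    unfolding set_lebesgue_integral_def
    by (rule integral_mono) (use that si[of f] in \<open>auto simp: indicator_def\<close>)
  \<comment> \<open>Clamping time to \<open>{0..1}\<close> extends the distance functions to the
    whole line without enlarging their increments.\<close>
  define c where "c t = max 0 (min 1 t)" for t :: real
  have c01: "c t \<in> {0..1}" for t by (auto simp: c_def)
  have cid: "c t = t" if "t \<in> {0..1}" for t using that by (auto simp: c_def)
  have dck: "d (\<gamma> (c s)) (\<gamma> (c t)) \<le> (LINT r:{s..t}|lborel. k r)" if "s \<le> t" for s t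
  proof (cases "c s = c t")
    case True
    have "0 \<le> (LINT r:{s..t}|lborel. k r)" unfolding set_lebesgue_integral_def
      by (intro Bochner_Integration.integral_nonneg) (auto simp: k)
    then show ?thesis using True \<gamma>M[OF c01] by simp
  next
    case False
    then have "s \<le> c s" "c t \<le> t" "c s \<le> c t" using that by (auto simp: c_def)
    then show ?thesis
      using dk[of "c s" "c t"] smono[OF k(1,2), of s "c s" "c t" t] c01[of s] c01[of t] by auto
  qed
  obtain q :: "nat \<Rightarrow> real" where q01: "\<And>n. q n \<in> {0..1}"
    and q: "\<And>t e. t \<in> {0..1} \<Longrightarrow> 0 < e \<Longrightarrow> \<exists>n. \<bar>q n - t\<bar> < e"
    and "\<exists>n. q n = 0" "\<exists>n. q n = 1"
    by (rule dense_time_sequence, rule that)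
  define \<phi> where "\<phi> n t = d (\<gamma> (c t)) (\<gamma> (q n))" for n t
  have \<phi>d: "\<bar>\<phi> n t - \<phi> n s\<bar> \<le> d (\<gamma> (c s)) (\<gamma> (c t))" for n s t
    using triangle[OF \<gamma>M \<gamma>M \<gamma>M, OF c01[of s] c01[of t] q01[of n]]
      triangle[OF \<gamma>M \<gamma>M \<gamma>M, OF c01[of t] c01[of s] q01[of n]] commute[of "\<gamma> (c t)" "\<gamma> (c s)"]
    by (auto simp: \<phi>_def)
  have "\<exists>h. integrable lborel h \<and> (\<forall>s t. s \<le> t \<longrightarrow> \<phi> n t - \<phi> n s = (LINT x:{s..t}|lborel. h x))" for n
  proof -
    have "\<bar>\<phi> n t - \<phi> n s\<bar> \<le> (LINT x:{s..t}|lborel. k x)" if "s \<le> t" for s t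
      using \<phi>d[of n t s] dck[OF that] by linarith
    from dominated_function_density[OF k this] show ?thesis by metis
  qed
  then obtain h where h: "\<And>n. integrable lborel (h n)"
    "\<And>n s t. s \<le> t \<Longrightarrow> \<phi> n t - \<phi> n s = (LINT x:{s..t}|lborel. h n x)" by metis
  have [measurable]: "k \<in> borel_measurable borel" "\<And>n. h n \<in> borel_measurable borel" using k(1) h(1) by auto
  have mm: "min s t \<le> max s t" for s t :: real by (auto simp: min_def max_def)
  have hd: "\<bar>?J (h n) s t\<bar> \<le> d (\<gamma> (c (min s t))) (\<gamma> (c (max s t)))" for n s t
    using h(2)[OF mm, of n s t] \<phi>d[of n "max s t" "min s t"] by simp
  have hk: "AE t in lborel. \<forall>n. \<bar>h n t\<bar> \<le> k t"
  proof (subst AE_all_countable, intro allI)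
    fix n
    show "AE t in lborel. \<bar>h n t\<bar> \<le> k t"
      using Lebesgue_differentiation[OF h(1)[of n]] Lebesgue_differentiation[OF k(1)]
    proof eventually_elim
      case (elim t)
      show ?case
      proof (rule tendsto_le[OF _ elim(2) tendsto_rabs[OF elim(1)]])
        show "\<forall>\<^sub>F s in at t. \<bar>?J (h n) s t / \<bar>s - t\<bar>\<bar> \<le> ?J k s t / \<bar>s - t\<bar>"
        proof (rule always_eventually, rule allI)
          fix s
          have "\<bar>?J (h n) s t\<bar> \<le> ?J k s t"
            using hd[of s t n] dck[OF mm, of s t] by linarith
          then show "\<bar>?J (h n) s t / \<bar>s - t\<bar>\<bar> \<le> ?J k s t / \<bar>s - t\<bar>"
            by (simp add: abs_divide divide_right_mono)
        qed
      qed auto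
    qed
  qed
  \<comment> \<open>\<open>enn2real\<close> sends an infinite supremum to 0; by \<open>hk\<close>
    that happens on a null set only.\<close>
  define m where "m t = enn2real (SUP n. ennreal \<bar>h n t\<bar>)" for t
  have [measurable]: "m \<in> borel_measurable borel" unfolding m_def by measurable
  have m0: "0 \<le> m t" for t by (simp add: m_def)
  have mle: "m t \<le> C" if "0 \<le> C" "\<And>n. \<bar>h n t\<bar> \<le> C" for t C
  proof -
    have "(SUP n. ennreal \<bar>h n t\<bar>) \<le> ennreal C" using that by (intro SUP_least ennreal_leI) auto
    then show ?thesis unfolding m_def using that(1) by (simp add: enn2real_leI)
  qed
  have hm: "AE t in lborel. \<forall>n. \<bar>h n t\<bar> \<le> m t" using hk
  proof eventually_elim
    case (elim t)
    have "(SUP n. ennreal \<bar>h n t\<bar>) \<le> ennreal (k t)" using elim by (intro SUP_least ennreal_leI) auto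
    then have "(SUP n. ennreal \<bar>h n t\<bar>) < \<top>" using ennreal_less_top le_less_trans by blast
    then have "ennreal (m t) = (SUP n. ennreal \<bar>h n t\<bar>)" unfolding m_def by (simp add: ennreal_enn2real)
    then have "ennreal \<bar>h n t\<bar> \<le> ennreal (m t)" for n by (simp only:) (rule SUP_upper, simp)
    then show ?case using m0 by (simp add: ennreal_le_iff)
  qed
  have mi: "integrable lborel m"
  proof (rule Bochner_Integration.integrable_bound[OF k(1)])
    show "AE x in lborel. norm (m x) \<le> norm (k x)"
      using hk by eventually_elim (use mle k(2) m0 in auto)
  qed simp
  have \<phi>m: "\<bar>\<phi> n t - \<phi> n s\<bar> \<le> (LINT x:{s..t}|lborel. m x)" if "s \<le> t" for n s t
  proof -
    have "\<bar>\<phi> n t - \<phi> n s\<bar> \<le> (LINT x|lborel. \<bar>indicat_real {s..t} x *\<^sub>R h n x\<bar>)"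
      unfolding h(2)[OF that] set_lebesgue_integral_def by (rule integral_abs_bound)
    also have "\<dots> \<le> (LINT x:{s..t}|lborel. m x)"
      unfolding set_lebesgue_integral_def
      by (rule integral_mono_AE) (use hm si h(1) mi in \<open>auto simp: abs_mult mult_left_mono elim!: eventually_mono\<close>)
    finally show ?thesis .
  qed
  \<comment> \<open>The distance to \<open>\<gamma> t\<close> itself is not among the
    \<open>\<phi> n\<close>. A sampled time near \<open>t\<close> replaces it; the error is small
    because the integral of \<open>k\<close> over short intervals is.\<close>
  have dm: "d (\<gamma> s) (\<gamma> t) \<le> (LINT x:{s..t}|lborel. m x)" if st: "0 \<le> s" "s \<le> t" "t \<le> 1" for s t
  proof (rule field_le_epsilon)
    fix e :: real assume e: "0 < e"
    then have e2: "0 < e/2" by simp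
    obtain \<delta> where \<delta>: "0 < \<delta>" "\<And>S. S \<in> sets lborel \<Longrightarrow> emeasure lborel S < ennreal \<delta> \<Longrightarrow> (LINT x:S|lborel. \<bar>k x\<bar>) < e/2"
      using integrable_absolutely_continuous[OF k(1) e2] by metis
    obtain n where n: "\<bar>q n - t\<bar> < \<delta>" using q[of t \<delta>] st \<delta>(1) by auto
    have "d (\<gamma> (q n)) (\<gamma> t) \<le> (LINT r:{min (q n) t..max (q n) t}|lborel. k r)"
      using dk[of "q n" t] dk[of t "q n"] q01[of n] st commute[of "\<gamma> (q n)" "\<gamma> t"]
      by (cases "q n \<le> t") (auto simp: min_def max_def)
    also have "\<dots> < e/2"
    proof -
      have "max (q n) t - min (q n) t < \<delta>" using n by (auto simp: min_def max_def)
      then have "emeasure lborel {min (q n) t..max (q n) t} < ennreal \<delta>"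
        using mm[of "q n" t] by (simp add: emeasure_lborel_Icc_eq ennreal_less_iff)
      then show ?thesis using \<delta>(2)[of "{min (q n) t..max (q n) t}"] k(2) by simp
    qed
    finally have qt: "d (\<gamma> t) (\<gamma> (q n)) < e/2" by (simp add: commute)
    have "d (\<gamma> s) (\<gamma> t) \<le> d (\<gamma> s) (\<gamma> (q n)) + d (\<gamma> (q n)) (\<gamma> t)"
      using st q01[of n] by (intro triangle \<gamma>M) auto
    also have "\<dots> = \<phi> n s - \<phi> n t + 2 * d (\<gamma> t) (\<gamma> (q n))"
      using st by (simp add: \<phi>_def cid commute)
    also have "\<dots> \<le> (LINT x:{s..t}|lborel. m x) + e"
      using \<phi>m[OF st(2), of n] qt by linarith
    finally show "d (\<gamma> s) (\<gamma> t) \<le> (LINT x:{s..t}|lborel. m x) + e" .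
  qed
  have "AE t in lborel. \<forall>n. ((\<lambda>s. ?J (h n) s t / \<bar>s - t\<bar>) \<longlongrightarrow> h n t) (at t)"
    unfolding AE_all_countable using Lebesgue_differentiation[OF h(1)] by blast
  then have lim: "AE t in lborel. t \<in> {0<..<1} \<longrightarrow>
       ((\<lambda>s. d (\<gamma> s) (\<gamma> t) / \<bar>s - t\<bar>) \<longlongrightarrow> m t) (at t within {0..1})"
    using Lebesgue_differentiation[OF mi]
  proof (eventually_elim, intro impI)
    fix t :: real
    assume H: "\<forall>n. ((\<lambda>s. ?J (h n) s t / \<bar>s - t\<bar>) \<longlongrightarrow> h n t) (at t)"
      and Mt: "((\<lambda>s. ?J m s t / \<bar>s - t\<bar>) \<longlongrightarrow> m t) (at t)"
      and t: "t \<in> {0<..<1}"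
    have w: "((\<lambda>s. f s) \<longlongrightarrow> l) (at t within {0..1})" if "((\<lambda>s. f s) \<longlongrightarrow> l) (at t)" for f and l :: real
      using that by (rule tendsto_within_subset) simp
    have in01: "\<forall>\<^sub>F s in at t within {0..1}. s \<in> {0..1} \<and> s \<noteq> t"
      by (auto simp: eventually_at_filter)
    show "((\<lambda>s. d (\<gamma> s) (\<gamma> t) / \<bar>s - t\<bar>) \<longlongrightarrow> m t) (at t within {0..1})"
    proof (rule order_tendstoI)
      fix a assume a: "m t < a"
      from order_tendstoD(2)[OF w[OF Mt] a] in01
      show "\<forall>\<^sub>F s in at t within {0..1}. d (\<gamma> s) (\<gamma> t) / \<bar>s - t\<bar> < a"
      proof eventually_elim
        case (elim s)
        have "d (\<gamma> s) (\<gamma> t) \<le> ?J m s t"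
          using dm[of "min s t" "max s t"] elim t commute[of "\<gamma> s" "\<gamma> t"] by (cases "s \<le> t") (auto simp: min_def max_def)
        then have "d (\<gamma> s) (\<gamma> t) / \<bar>s - t\<bar> \<le> ?J m s t / \<bar>s - t\<bar>"
          by (rule divide_right_mono) simp
        then show ?case using elim by linarith
      qed
    next
      fix a assume a: "a < m t"
      \<comment> \<open>A number below the supremum is already exceeded by one
        \<open>\<bar>h n t\<bar>\<close>, and the distance to the single point
        \<open>\<gamma> (q n)\<close> then gives the lower bound.\<close>
      have "\<exists>n. a < \<bar>h n t\<bar>"
      proof (rule ccontr)
        assume "\<nexists>n. a < \<bar>h n t\<bar>"
        then have "\<bar>h n t\<bar> \<le> a" for n by (meson not_less)
        then show False using mle[of a t] a abs_ge_zero[of "h 0 t"] order_trans by (metis not_less)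
      qed
      then obtain n where n: "a < \<bar>h n t\<bar>" ..
      from order_tendstoD(1)[OF w[OF tendsto_rabs[OF H[rule_format, of n]]] n] in01
      show "\<forall>\<^sub>F s in at t within {0..1}. a < d (\<gamma> s) (\<gamma> t) / \<bar>s - t\<bar>"
      proof eventually_elim
        case (elim s)
        have "\<bar>?J (h n) s t\<bar> \<le> d (\<gamma> s) (\<gamma> t)"
          using hd[of s t n] elim t cid[of s] cid[of t] commute[of "\<gamma> s" "\<gamma> t"]
          by (cases "s \<le> t") (auto simp: min_def max_def)
        then have "\<bar>?J (h n) s t / \<bar>s - t\<bar>\<bar> \<le> d (\<gamma> s) (\<gamma> t) / \<bar>s - t\<bar>"
          by (simp add: abs_divide divide_right_mono)
        then show ?case using elim by linarith
      qed
    qed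
  qed
  let ?f = "\<lambda>t. indicat_real {0..1} t *\<^sub>R metric_deriv {0..1} d \<gamma> t"
  let ?g = "\<lambda>t. indicat_real {0..1} t *\<^sub>R m t"
  have "AE t in lborel. ?f t = ?g t"
    using lim AE_lborel_singleton[of 0] AE_lborel_singleton[of 1]
  proof eventually_elim
    case (elim t)
    show ?case
    proof (cases "t \<in> {0<..<1}")
      case True
      have "at t within {0..1} \<noteq> bot" using True at_within_Icc_at[of 0 t 1] by simp
      then show ?thesis using elim True by (auto simp: metric_deriv_def intro!: tendsto_Lim)
    qed (use elim in auto)
  qed
  then have eq: "AE t in lebesgue. ?f t = ?g t" by (rule AE_completion)
  have gm: "?g \<in> borel_measurable lebesgue" by (rule measurable_completion) simp
  \<comment> \<open>\<open>metric_deriv\<close> is uncontrolled on the exceptional null set;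
    completeness of \<open>lebesgue\<close> still makes it measurable.\<close>
  have fm: "?f \<in> borel_measurable lebesgue"
  proof (rule measurableI)
    fix B :: "real set" assume B: "B \<in> sets borel"
    have "AE t in lebesgue. t \<in> ?g -` B \<longleftrightarrow> t \<in> ?f -` B" using eq by eventually_elim auto
    moreover have "?g -` B \<in> sets lebesgue" using measurable_sets[OF gm B] by simp
    ultimately have "?f -` B \<in> sets lebesgue" by (rule completion.in_sets_AE) auto
    then show "?f -` B \<inter> space lebesgue \<in> sets lebesgue" by simp
  qed auto
  have "curve_length {0..1} d \<gamma> = (LINT t|lebesgue. ?g t)"
    unfolding curve_length_def set_lebesgue_integral_def by (rule integral_cong_AE[OF fm gm eq])
  also have "\<dots> = (LINT x:{0..1}|lborel. m x)"
    unfolding set_lebesgue_integral_def by (rule integral_completion) auto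
  finally show ?thesis using mi m0 lim dm by (intro that) auto
qed

end

section \<open>Length distances\<close>

definition Lip_curve :: "'b set \<Rightarrow> ('b \<Rightarrow> 'b \<Rightarrow> real) \<Rightarrow> real \<Rightarrow> (real \<Rightarrow> 'b) \<Rightarrow> bool" where
  "Lip_curve X dst L \<gamma> \<longleftrightarrow> (\<forall>t\<in>{0..1}. \<gamma> t \<in> X) \<and>
     (\<forall>s\<in>{0..1}. \<forall>t\<in>{0..1}. dst (\<gamma> s) (\<gamma> t) \<le> L * \<bar>s - t\<bar>)"

text \<open>This is \<open>ell_SW\<close> with an arbitrary metric in place of \<open>SW\<close>. It
  separates the argument on curves from the measures, and the two agree by unfolding.\<close>

definition length_dist :: "'b set \<Rightarrow> ('b \<Rightarrow> 'b \<Rightarrow> real) \<Rightarrow> 'b \<Rightarrow> 'b \<Rightarrow> real" where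
  "length_dist X dst x y = enn2real
    (INF \<gamma>\<in>{\<gamma>\<in>AC {0..1} X dst. \<gamma> 0 = x \<and> \<gamma> 1 = y}. ennreal (curve_length {0..1} dst \<gamma>))"

lemma set_integral_const_Icc:
  fixes c :: real
  assumes "s \<le> t"
  shows "(LINT r:{s..t}|lebesgue. c) = c * (t - s)" "(LINT r:{s..t}|lborel. c) = c * (t - s)"
  using assms by (simp_all add: set_lebesgue_integral_def)

lemma Lip_curve_AC:
  assumes "Lip_curve X dst L \<gamma>"
  shows "\<gamma> \<in> AC {0..1} X dst"
proof -
  have "set_integrable lebesgue {0..1} (\<lambda>_::real. L)" by (simp add: set_integrable_def)
  moreover have "dst (\<gamma> s) (\<gamma> t) \<le> (LINT r:{s..t}|lebesgue. L)" if "s \<in> {0..1}" "t \<in> {0..1}" "s \<le> t" for s t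
  proof -
    have "dst (\<gamma> s) (\<gamma> t) \<le> L * \<bar>s - t\<bar>" using assms that unfolding Lip_curve_def by blast
    then show ?thesis using that by (simp add: set_integral_const_Icc abs_if split: if_splits)
  qed
  ultimately show ?thesis using assms unfolding AC_def Lip_curve_def
    by (intro CollectI conjI exI[of _ "\<lambda>_. L"]) auto
qed

lemma mult_le_abs:
  fixes u B a :: real
  assumes "u \<le> B" "0 \<le> a" "a \<le> 1"
  shows "u * a \<le> \<bar>B\<bar>"
proof -
  have "u * a \<le> \<bar>B\<bar> * a" using assms by (intro mult_right_mono) auto
  also have "\<dots> \<le> \<bar>B\<bar>" using assms by (intro mult_left_le) auto
  finally show ?thesis .
qed

lemma Lip_curveD:
  assumes "Lip_curve X dst L \<gamma>" "s \<in> {0..1}" "t \<in> {0..1}"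
  shows "dst (\<gamma> s) (\<gamma> t) \<le> L * \<bar>s - t\<bar>"
  using assms unfolding Lip_curve_def by blast

lemma Lip_curve_mono:
  assumes "Lip_curve X dst L \<gamma>" "L \<le> L'"
  shows "Lip_curve X dst L' \<gamma>"
proof -
  have "L * \<bar>s - t\<bar> \<le> L' * \<bar>s - t\<bar>" for s t :: real using assms(2) by (intro mult_right_mono) auto
  then show ?thesis using assms(1) unfolding Lip_curve_def by (meson order_trans)
qed

context Metric_space
begin

lemma curve_length_nonneg:
  assumes "\<gamma> \<in> AC {0..1} M d"
  shows "0 \<le> curve_length {0..1} d \<gamma>"
proof (rule AC_curve_length[OF assms])
  fix m assume m: "integrable lborel m" "\<And>t. 0 \<le> m t" "curve_length {0..1} d \<gamma> = (LINT x:{0..1}|lborel. m x)"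
  show ?thesis unfolding m(3) set_lebesgue_integral_def
    by (intro Bochner_Integration.integral_nonneg) (auto simp: m(2))
qed

lemma Lip_curve_length_le:
  assumes L: "Lip_curve M d L \<gamma>" and "0 \<le> L"
  shows "curve_length {0..1} d \<gamma> \<le> L"
proof (rule AC_curve_length[OF Lip_curve_AC[OF L]])
  fix m assume m: "integrable lborel m" "\<And>t. 0 \<le> m t" "curve_length {0..1} d \<gamma> = (LINT x:{0..1}|lborel. m x)"
    and lim: "AE t in lborel. t \<in> {0<..<1} \<longrightarrow>
       ((\<lambda>s. d (\<gamma> s) (\<gamma> t) / \<bar>s - t\<bar>) \<longlongrightarrow> m t) (at t within {0..1})"
  have "(LINT x:{0..1}|lborel. m x) \<le> (LINT x:{0..1::real}|lborel. L)"
    unfolding set_lebesgue_integral_def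
  proof (rule integral_mono_AE)
    show "AE t in lborel. indicat_real {0..1} t *\<^sub>R m t \<le> indicat_real {0..1} t *\<^sub>R L"
      using lim AE_lborel_singleton[of 0] AE_lborel_singleton[of 1]
    proof eventually_elim
      case (elim t)
      show ?case
      proof (cases "t \<in> {0<..<1}")
        case True
        then have lt: "((\<lambda>s. d (\<gamma> s) (\<gamma> t) / \<bar>s - t\<bar>) \<longlongrightarrow> m t) (at t within {0..1})" using elim by auto
        have "m t \<le> L"
        proof (rule tendsto_upperbound[OF lt])
          show "\<forall>\<^sub>F s in at t within {0..1}. d (\<gamma> s) (\<gamma> t) / \<bar>s - t\<bar> \<le> L"
            using L True by (auto simp: eventually_at_filter Lip_curve_def pos_divide_le_eq)
          show "at t within {0..1} \<noteq> bot" using True at_within_Icc_at[of 0 t 1] by simp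
        qed
        then show ?thesis by (auto simp: indicator_def)
      qed (use elim in auto)
    qed
  qed (use m(1) in \<open>auto intro!: integrable_mult_indicator[where 'b=real, simplified]\<close>)
  also have "\<dots> = L" by (simp add: set_integral_const_Icc)
  finally show ?thesis using m(3) by simp
qed

text \<open>The reparametrised curve runs through \<open>\<gamma> t\<close> at the time \<open>r\<close> at which the length
  of \<open>\<gamma>\<close> up to \<open>t\<close> is \<open>r\<close> times the total length.\<close>

lemma AC_reparametrization:
  assumes \<gamma>: "\<gamma> \<in> AC {0..1} M d"
  obtains \<eta> where "Lip_curve M d (curve_length {0..1} d \<gamma>) \<eta>" "\<eta> 0 = \<gamma> 0" "\<eta> 1 = \<gamma> 1"
proof (rule AC_curve_length[OF \<gamma>])
  fix m assume m: "integrable lborel m" "\<And>t. 0 \<le> m t"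
    and dm: "\<And>s t. 0 \<le> s \<Longrightarrow> s \<le> t \<Longrightarrow> t \<le> 1 \<Longrightarrow> d (\<gamma> s) (\<gamma> t) \<le> (LINT x:{s..t}|lborel. m x)"
    and cl: "curve_length {0..1} d \<gamma> = (LINT x:{0..1}|lborel. m x)"
  define L where "L = curve_length {0..1} d \<gamma>"
  have si: "set_integrable lborel {s..t} m" for s t
    unfolding set_integrable_def using m(1) by (intro integrable_mult_indicator) auto
  note HK = set_borel_integral_eq_integral[OF si]
  define V where "V t = integral {0..t} m" for t
  have Vd: "V t - V s = (LINT x:{s..t}|lborel. m x)" if "0 \<le> s" "s \<le> t" for s t
    using Henstock_Kurzweil_Integration.integral_combine[OF that HK(1)] HK(2)[of s t] by (simp add: V_def)
  have Vc: "continuous_on {0..1} V"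
    unfolding V_def by (rule indefinite_integral_continuous_1[OF HK(1)])
  have V0: "V 0 = 0" by (simp add: V_def)
  have V1: "V 1 = L" using Vd[of 0 1] V0 cl by (simp add: L_def)
  have L0: "0 \<le> L" unfolding L_def by (rule curve_length_nonneg[OF \<gamma>])
  have dV: "d (\<gamma> s) (\<gamma> t) \<le> \<bar>V s - V t\<bar>" if "s \<in> {0..1}" "t \<in> {0..1}" for s t
    using dm[of s t] dm[of t s] Vd[of s t] Vd[of t s] that commute[of "\<gamma> s" "\<gamma> t"]
    by (cases "s \<le> t") auto
  \<comment> \<open>Any preimage will do: by \<open>dV\<close> the curve takes a single value on
    each level set of \<open>V\<close>.\<close>
  have "\<exists>t\<in>{0..1}. V t = r * L" if r: "r \<in> {0..1}" for r
  proof -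
    have "V 0 \<le> r * L" "r * L \<le> V 1" using r L0 V0 V1 by (auto simp: mult_left_le_one_le)
    from IVT'[OF this _ Vc] show ?thesis by auto
  qed
  then obtain \<tau> where \<tau>: "\<And>r. r \<in> {0..1} \<Longrightarrow> \<tau> r \<in> {0..1}" "\<And>r. r \<in> {0..1} \<Longrightarrow> V (\<tau> r) = r * L"
    by metis
  \<comment> \<open>\<open>V\<close> may be constant near an end of the interval, so the chosen
    preimages of 0 and \<open>L\<close> need not be the times 0 and 1.\<close>
  define \<tau>' where "\<tau>' r = (if r = 0 then 0 else if r = 1 then 1 else \<tau> r)" for r
  have \<tau>': "\<tau>' r \<in> {0..1}" "V (\<tau>' r) = r * L" if "r \<in> {0..1}" for r
    using that \<tau>[of r] V0 V1 by (auto simp: \<tau>'_def)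
  have "Lip_curve M d L (\<lambda>r. \<gamma> (\<tau>' r))"
    unfolding Lip_curve_def
  proof (intro conjI ballI)
    fix s t :: real assume st: "s \<in> {0..1}" "t \<in> {0..1}"
    have "d (\<gamma> (\<tau>' s)) (\<gamma> (\<tau>' t)) \<le> \<bar>s * L - t * L\<bar>"
      using dV[OF \<tau>'(1)[OF st(1)] \<tau>'(1)[OF st(2)]] \<tau>'(2)[OF st(1)] \<tau>'(2)[OF st(2)] by simp
    also have "\<dots> = L * \<bar>s - t\<bar>" using L0 by (simp add: left_diff_distrib[symmetric] abs_mult)
    finally show "d (\<gamma> (\<tau>' s)) (\<gamma> (\<tau>' t)) \<le> L * \<bar>s - t\<bar>" .
  qed (use \<tau>' \<gamma> in \<open>auto simp: AC_def\<close>)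
  then show ?thesis
    unfolding L_def by (rule that) (simp_all add: \<tau>'_def)
qed

abbreviation len :: "'a \<Rightarrow> 'a \<Rightarrow> real" where
  "len \<equiv> length_dist M d"

lemma length_dist_le:
  assumes L: "Lip_curve M d L \<gamma>" "0 \<le> L"
  shows "len (\<gamma> 0) (\<gamma> 1) \<le> L"
proof -
  have "(INF \<eta>\<in>{\<eta>\<in>AC {0..1} M d. \<eta> 0 = \<gamma> 0 \<and> \<eta> 1 = \<gamma> 1}. ennreal (curve_length {0..1} d \<eta>)) \<le> ennreal (curve_length {0..1} d \<gamma>)"
    by (rule INF_lower) (use Lip_curve_AC[OF L(1)] in auto)
  also have "\<dots> \<le> ennreal L" by (intro ennreal_leI Lip_curve_length_le L)
  finally show ?thesis unfolding length_dist_def using L(2) by (simp add: enn2real_leI)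
qed

section \<open>Restriction, reversal and concatenation of Lipschitz curves\<close>

lemma Lip_curve_sub:
  assumes L: "Lip_curve M d L \<gamma>" and st: "0 \<le> s" "s \<le> t" "t \<le> 1"
  shows "Lip_curve M d (L * (t - s)) (\<lambda>r. \<gamma> (s + r * (t - s)))"
  unfolding Lip_curve_def
proof (intro conjI ballI)
  have in01: "s + r * (t - s) \<in> {0..1}" if "r \<in> {0..1}" for r
  proof -
    have "0 \<le> r * (t - s)" using that st by simp
    moreover have "r * (t - s) \<le> 1 * (t - s)" using that st by (intro mult_right_mono) auto
    ultimately have "0 \<le> r * (t - s)" "r * (t - s) \<le> t - s" by auto
    then show ?thesis using st by auto
  qed
  show "\<gamma> (s + r * (t - s)) \<in> M" if "r \<in> {0..1}" for r
    using L in01[OF that] by (auto simp: Lip_curve_def)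
  fix r r' :: real assume r: "r \<in> {0..1}" "r' \<in> {0..1}"
  have "d (\<gamma> (s + r * (t - s))) (\<gamma> (s + r' * (t - s))) \<le> L * \<bar>(s + r * (t - s)) - (s + r' * (t - s))\<bar>"
    using L in01[OF r(1)] in01[OF r(2)] unfolding Lip_curve_def by blast
  also have "(s + r * (t - s)) - (s + r' * (t - s)) = (t - s) * (r - r')" by (simp add: algebra_simps)
  also have "L * \<bar>(t - s) * (r - r')\<bar> = L * (t - s) * \<bar>r - r'\<bar>" using st by (simp add: abs_mult)
  finally show "d (\<gamma> (s + r * (t - s))) (\<gamma> (s + r' * (t - s))) \<le> L * (t - s) * \<bar>r - r'\<bar>" .
qed

lemma Lip_curve_reverse:
  assumes L: "Lip_curve M d L \<gamma>"
  shows "Lip_curve M d L (\<lambda>t. \<gamma> (1 - t))"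
  unfolding Lip_curve_def
proof (intro conjI ballI)
  fix s t :: real assume st: "s \<in> {0..1}" "t \<in> {0..1}"
  have "d (\<gamma> (1 - s)) (\<gamma> (1 - t)) \<le> L * \<bar>(1 - s) - (1 - t)\<bar>"
    using Lip_curveD[OF L, of "1 - s" "1 - t"] st by auto
  then show "d (\<gamma> (1 - s)) (\<gamma> (1 - t)) \<le> L * \<bar>s - t\<bar>" by (simp add: abs_minus_commute)
qed (use L in \<open>auto simp: Lip_curve_def\<close>)

text \<open>Each curve gets a share of the time proportional to its constant, so that both run at
  speed \<open>L1 + L2\<close>. Positive constants keep the switching time \<open>a\<close> strictly
  between 0 and 1.\<close>

lemma Lip_curve_join:
  assumes 1: "Lip_curve M d L1 \<gamma>" "0 < L1" and 2: "Lip_curve M d L2 \<eta>" "0 < L2" and eq: "\<gamma> 1 = \<eta> 0"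
  obtains \<zeta> where "Lip_curve M d (L1 + L2) \<zeta>" "\<zeta> 0 = \<gamma> 0" "\<zeta> 1 = \<eta> 1"
proof -
  define S where "S = L1 + L2"
  define a where "a = L1 / S"
  have S: "S > 0" using 1 2 by (simp add: S_def)
  have a: "0 < a" "a < 1" using 1 2 S by (auto simp: a_def S_def)
  have aL: "L1 = S * a" "L2 = S * (1 - a)" using S by (simp_all add: a_def S_def field_simps)
  define \<zeta> where "\<zeta> t = (if t \<le> a then \<gamma> (t / a) else \<eta> ((t - a) / (1 - a)))" for t
  have i1: "t / a \<in> {0..1}" if "0 \<le> t" "t \<le> a" for t using that a by (auto simp: divide_le_eq)
  have i2: "(t - a) / (1 - a) \<in> {0..1}" if "a \<le> t" "t \<le> 1" for t using that a by (auto simp: divide_le_eq)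
  have inM: "\<zeta> t \<in> M" if "t \<in> {0..1}" for t
    using that 1(1) 2(1) i1[of t] i2[of t] by (auto simp: \<zeta>_def Lip_curve_def)
  have resc: "d (\<beta> ((s - b) / c)) (\<beta> ((t - b) / c)) \<le> S * (t - s)"
    if "Lip_curve M d (S * c) \<beta>" "0 < c" "b \<le> s" "s \<le> t" "t \<le> b + c" for \<beta> b c s t
  proof -
    have "d (\<beta> ((s - b) / c)) (\<beta> ((t - b) / c)) \<le> S * c * \<bar>(s - b) / c - (t - b) / c\<bar>"
      by (rule Lip_curveD[OF that(1)]) (use that in \<open>auto simp: divide_le_eq\<close>)
    also have "\<bar>(s - b) / c - (t - b) / c\<bar> = (t - s) / c"
      using that by (simp add: diff_divide_distrib[symmetric] abs_divide)
    finally show ?thesis using that by simp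
  qed
  note d1 = resc[OF 1(1)[unfolded aL(1)], of 0, simplified] and d2 = resc[OF 2(1)[unfolded aL(2)], of a]
  have za: "\<zeta> a = \<gamma> 1" using a by (simp add: \<zeta>_def)
  have dz: "d (\<zeta> s) (\<zeta> t) \<le> S * (t - s)" if st: "0 \<le> s" "s \<le> t" "t \<le> 1" for s t
  proof (cases "t \<le> a")
    case True
    then show ?thesis using d1[of s t] a st by (simp add: \<zeta>_def)
  next
    case ta: False
    show ?thesis
    proof (cases "s \<le> a")
      case True
      have "d (\<zeta> s) (\<zeta> t) \<le> d (\<zeta> s) (\<zeta> a) + d (\<zeta> a) (\<zeta> t)"
        using st a by (intro triangle inM) auto
      also have "d (\<zeta> s) (\<zeta> a) \<le> S * (a - s)" using d1[of s a] a True st by (simp add: \<zeta>_def)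
      also have "d (\<zeta> a) (\<zeta> t) \<le> S * (t - a)" using d2[of a t] a ta st unfolding za eq by (simp add: \<zeta>_def)
      finally show ?thesis by (simp add: algebra_simps)
    next
      case False
      then show ?thesis using d2[of s t] a ta st by (simp add: \<zeta>_def)
    qed
  qed
  have "Lip_curve M d S \<zeta>"
    unfolding Lip_curve_def
  proof (intro conjI ballI inM)
    fix s t :: real assume "s \<in> {0..1}" "t \<in> {0..1}"
    then show "d (\<zeta> s) (\<zeta> t) \<le> S * \<bar>s - t\<bar>"
      using dz[of s t] dz[of t s] commute[of "\<zeta> s" "\<zeta> t"] by (cases "s \<le> t") auto
  qed
  moreover have "\<zeta> 0 = \<gamma> 0" "\<zeta> 1 = \<eta> 1" using a by (simp_all add: \<zeta>_def)
  ultimately show ?thesis using that unfolding S_def by blast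
qed

end

text \<open>\<open>conv\<close> stands for narrow convergence. Its only links to \<open>d\<close>
  are compactness of bounded sequences and lower semicontinuity; the latter with bound 0 makes
  limits unique. \<open>Lipschitz_connected\<close> makes the infimum over curves finite, so that
  \<open>enn2real\<close> loses nothing.\<close>

locale compact_Lipschitz_connected = Metric_space +
  fixes conv :: "(nat \<Rightarrow> 'a) \<Rightarrow> 'a \<Rightarrow> bool"
  assumes conv_subseq: "\<And>X x r. conv X x \<Longrightarrow> strict_mono (r :: nat \<Rightarrow> nat) \<Longrightarrow> conv (X \<circ> r) x"
    and conv_const: "\<And>x. x \<in> M \<Longrightarrow> conv (\<lambda>_. x) x"
    and bounded_conv_subseq: "\<And>X x C. range X \<subseteq> M \<Longrightarrow> x \<in> M \<Longrightarrow> (\<And>n. d (X n) x \<le> C) \<Longrightarrow>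
      \<exists>r y. strict_mono (r :: nat \<Rightarrow> nat) \<and> y \<in> M \<and> conv (X \<circ> r) y"
    and lower_semicontinuous: "\<And>X Y x y C. range X \<subseteq> M \<Longrightarrow> range Y \<subseteq> M \<Longrightarrow> x \<in> M \<Longrightarrow> y \<in> M \<Longrightarrow>
      conv X x \<Longrightarrow> conv Y y \<Longrightarrow> (\<And>n. d (X n) (Y n) \<le> C) \<Longrightarrow> d x y \<le> C"
    and Lipschitz_connected: "\<And>x y. x \<in> M \<Longrightarrow> y \<in> M \<Longrightarrow> \<exists>L \<gamma>. Lip_curve M d L \<gamma> \<and> \<gamma> 0 = x \<and> \<gamma> 1 = y"
begin

lemma lower_semicontinuous_tendsto:
  assumes XY: "range X \<subseteq> M" "range Y \<subseteq> M" "x \<in> M" "y \<in> M" "conv X x" "conv Y y"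
    and le: "\<And>n. d (X n) (Y n) \<le> a n" and a: "a \<longlonglongrightarrow> l"
  shows "d x y \<le> l"
proof (rule field_le_epsilon)
  fix e :: real assume "0 < e"
  then have "\<forall>\<^sub>F n in sequentially. a n < l + e" using a by (intro order_tendstoD(2)[OF a]) auto
  then obtain N where N: "\<And>n. n \<ge> N \<Longrightarrow> a n < l + e" by (auto simp: eventually_sequentially)
  have sm: "strict_mono (\<lambda>n. n + N)" by (simp add: strict_mono_def)
  show "d x y \<le> l + e"
  proof (rule lower_semicontinuous[OF _ _ XY(3,4) conv_subseq[OF XY(5) sm] conv_subseq[OF XY(6) sm]])
    fix n show "d ((X \<circ> (\<lambda>n. n + N)) n) ((Y \<circ> (\<lambda>n. n + N)) n) \<le> l + e"
      using le[of "n + N"] N[of "n + N"] by simp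
  qed (use XY in auto)
qed

text \<open>A variant of the Arzela-Ascoli argument with lower semicontinuity in place of
  convergence of the distances: only upper bounds pass to the limit, and the Lipschitz condition
  consists of upper bounds. The bound \<open>B\<close> keeps the values at each time in a bounded
  set.\<close>

lemma Lip_curve_limit:
  assumes \<gamma>: "\<And>n. Lip_curve M d (\<Lambda> n) (\<gamma> n)" "\<And>n. \<gamma> n 0 = x" "\<And>n. \<gamma> n 1 = y"
    and \<Lambda>: "\<Lambda> \<longlonglongrightarrow> L" "\<And>n. \<Lambda> n \<le> B" and xy: "x \<in> M" "y \<in> M"
  obtains \<eta> where "Lip_curve M d L \<eta>" "\<eta> 0 = x" "\<eta> 1 = y"
proof -
  obtain q :: "nat \<Rightarrow> real" where q01: "\<And>n. q n \<in> {0..1}"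
    and q: "\<And>t e. t \<in> {0..1} \<Longrightarrow> 0 < e \<Longrightarrow> \<exists>n. \<bar>q n - t\<bar> < e"
    and "\<exists>n. q n = 0" "\<exists>n. q n = 1"
    by (rule dense_time_sequence, rule that)
  then obtain k0 k1 where k01: "q k0 = 0" "q k1 = 1" by blast
  have \<gamma>M: "\<gamma> n t \<in> M" if "t \<in> {0..1}" for n t using \<gamma>(1)[of n] that by (auto simp: Lip_curve_def)
  have \<gamma>L: "d (\<gamma> n s) (\<gamma> n t) \<le> \<Lambda> n * \<bar>s - t\<bar>" if "s \<in> {0..1}" "t \<in> {0..1}" for n s t
    using \<gamma>(1)[of n] that by (auto simp: Lip_curve_def)
  \<comment> \<open>Along \<open>s\<close>, the curves converge at the \<open>n\<close>-th sampled
    time.\<close>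
  define P where "P n s \<longleftrightarrow> (\<exists>z\<in>M. conv (\<lambda>i. \<gamma> (s i) (q n)) z)" for n and s :: "nat \<Rightarrow> nat"
  interpret subseqs P
  proof
    fix n and s :: "nat \<Rightarrow> nat" assume "strict_mono s"
    have "\<exists>r z. strict_mono r \<and> z \<in> M \<and> conv ((\<lambda>i. \<gamma> (s i) (q n)) \<circ> r) z"
    proof (rule bounded_conv_subseq[of "\<lambda>i. \<gamma> (s i) (q n)" x "\<bar>B\<bar>"])
      fix i
      have "d (\<gamma> (s i) (q n)) x \<le> \<Lambda> (s i) * \<bar>q n - 0\<bar>"
        using \<gamma>L[of "q n" 0 "s i"] q01[of n] \<gamma>(2) by simp
      also have "\<dots> \<le> \<bar>B\<bar>" by (rule mult_le_abs[OF \<Lambda>(2)]) (use q01[of n] in auto)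
      finally show "d (\<gamma> (s i) (q n)) x \<le> \<bar>B\<bar>" .
    qed (use \<gamma>M q01 xy in auto)
    then show "\<exists>r'. strict_mono r' \<and> P n (s \<circ> r')" unfolding P_def by (auto simp: o_def)
  qed
  have "P k (diagseq \<circ> ((+) (Suc k)))" for k
  proof (rule diagseq_holds)
    fix r s n assume "strict_mono (r :: nat \<Rightarrow> nat)" "P n s"
    then show "P n (s \<circ> r)" unfolding P_def using conv_subseq[of "\<lambda>i. \<gamma> (s i) (q n)" _ r] by (auto simp: o_def)
  qed
  then have "\<forall>k. \<exists>z. z \<in> M \<and> conv (\<lambda>i. \<gamma> (diagseq (Suc k + i)) (q k)) z"
    unfolding P_def by (simp add: o_def Bex_def)
  then obtain z where z: "\<And>k. z k \<in> M" "\<And>k. conv (\<lambda>i. \<gamma> (diagseq (Suc k + i)) (q k)) (z k)"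
    by metis
  \<comment> \<open>The diagonal sequence comes with convergence at \<open>q k\<close> from index
    \<open>Suc k\<close> on. Larger offsets are allowed so that two times can be compared along the
    same indices.\<close>
  have zc: "conv (\<lambda>i. \<gamma> (diagseq (K + i)) (q k)) (z k)" if "Suc k \<le> K" for k K
  proof -
    have "strict_mono (\<lambda>i. (K - Suc k) + i)" by (simp add: strict_mono_def)
    from conv_subseq[OF z(2)[of k] this] that show ?thesis by (simp add: o_def)
  qed
  have \<Lambda>d: "(\<lambda>i. \<Lambda> (diagseq (K + i))) \<longlonglongrightarrow> L" for K
  proof -
    have "strict_mono (\<lambda>i. diagseq (K + i))"
      using subseq_diagseq by (auto simp: strict_mono_def)
    from LIMSEQ_subseq_LIMSEQ[OF \<Lambda>(1) this] show ?thesis by (simp add: o_def)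
  qed
  have zL: "d (z k) (z l) \<le> L * \<bar>q k - q l\<bar>" for k l
  proof (rule lower_semicontinuous_tendsto)
    let ?K = "Suc (max k l)"
    show "conv (\<lambda>i. \<gamma> (diagseq (?K + i)) (q k)) (z k)" "conv (\<lambda>i. \<gamma> (diagseq (?K + i)) (q l)) (z l)"
      by (rule zc, simp)+
    show "d (\<gamma> (diagseq (?K + n)) (q k)) (\<gamma> (diagseq (?K + n)) (q l)) \<le> \<Lambda> (diagseq (?K + n)) * \<bar>q k - q l\<bar>" for n
      using \<gamma>L q01 by blast
    show "(\<lambda>n. \<Lambda> (diagseq (?K + n)) * \<bar>q k - q l\<bar>) \<longlonglongrightarrow> L * \<bar>q k - q l\<bar>"
      by (intro tendsto_intros \<Lambda>d)
  qed (use z \<gamma>M q01 in auto)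
  \<comment> \<open>At a time where all curves share the value \<open>w\<close>, comparison with the
    constant sequence \<open>w\<close> identifies the limit.\<close>
  have zend: "z k = w" if "q k = t" "\<And>n. \<gamma> n t = w" "w \<in> M" for k t w
  proof -
    have "d (z k) w \<le> 0"
    proof (rule lower_semicontinuous[OF _ _ z(1) that(3) z(2) conv_const[OF that(3)]])
      show "d (\<gamma> (diagseq (Suc k + n)) (q k)) w \<le> 0" for n using that by simp
    qed (use that in auto)
    then show ?thesis using z(1) that(3) by (metis nonneg order_antisym zero)
  qed
  \<comment> \<open>The values at the remaining times come from compactness again, applied to the
    \<open>z k\<close> at sampled times tending to \<open>t\<close>; completeness of
    \<open>d\<close> is not among the assumptions.\<close>
  have "\<exists>i w. w \<in> M \<and> conv (\<lambda>n. z (i n)) w \<and> (\<lambda>n. q (i n)) \<longlonglongrightarrow> t" if t: "t \<in> {0..1}" for t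
  proof -
    have "\<exists>k. \<bar>q k - t\<bar> < 1 / (real n + 1)" for n by (rule q[OF t]) simp
    then obtain j where j: "\<And>n. \<bar>q (j n) - t\<bar> < 1 / (real n + 1)" by metis
    have jt: "(\<lambda>n. q (j n)) \<longlonglongrightarrow> t"
    proof (rule LIM_zero_cancel, rule tendsto_rabs_zero_cancel, rule tendsto_sandwich[OF _ _ tendsto_const])
      show "(\<lambda>n. 1 / (real n + 1)) \<longlonglongrightarrow> 0" using LIMSEQ_inverse_real_of_nat by (simp add: inverse_eq_divide add.commute)
      show "\<forall>\<^sub>F n in sequentially. \<bar>q (j n) - t\<bar> \<le> 1 / (real n + 1)" using j by (simp add: less_imp_le)
    qed auto
    have "\<exists>r w. strict_mono r \<and> w \<in> M \<and> conv ((\<lambda>n. z (j n)) \<circ> r) w"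
    proof (rule bounded_conv_subseq[OF _ z(1)[of 0]])
      fix n
      have "d (z (j n)) (z 0) \<le> L * \<bar>q (j n) - q 0\<bar>" by (rule zL)
      also have "\<dots> \<le> \<bar>L\<bar>" by (rule mult_le_abs[OF order_refl]) (use q01[of "j n"] q01[of 0] in auto)
      finally show "d (z (j n)) (z 0) \<le> \<bar>L\<bar>" .
    qed (use z in auto)
    then obtain r w where r: "strict_mono r" "w \<in> M" "conv (\<lambda>n. z (j (r n))) w" by (auto simp: o_def)
    from LIMSEQ_subseq_LIMSEQ[OF jt r(1)] r show ?thesis
      by (intro exI[of _ "\<lambda>n. j (r n)"] exI[of _ w]) (auto simp: o_def)
  qed
  then obtain i w where iw: "\<And>t. t \<in> {0..1} \<Longrightarrow> w t \<in> M" "\<And>t. t \<in> {0..1} \<Longrightarrow> conv (\<lambda>n. z (i t n)) (w t)"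
    "\<And>t. t \<in> {0..1} \<Longrightarrow> (\<lambda>n. q (i t n)) \<longlonglongrightarrow> t" by metis
  have wL: "d (w s) (w t) \<le> L * \<bar>s - t\<bar>" if st: "s \<in> {0..1}" "t \<in> {0..1}" for s t
  proof (rule lower_semicontinuous_tendsto[OF _ _ iw(1)[OF st(1)] iw(1)[OF st(2)] iw(2)[OF st(1)] iw(2)[OF st(2)] zL])
    show "(\<lambda>n. L * \<bar>q (i s n) - q (i t n)\<bar>) \<longlonglongrightarrow> L * \<bar>s - t\<bar>"
      using iw(3)[OF st(1)] iw(3)[OF st(2)] by (intro tendsto_intros)
  qed (use z in auto)
  \<comment> \<open>The second limit is taken independently at each time. It reproduces the values
    already fixed at sampled times, in particular the endpoints.\<close>
  have wz: "w t = z k" if k: "q k = t" for t k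
  proof -
    have t: "t \<in> {0..1}" using k q01 by blast
    have "d (w t) (z k) \<le> L * \<bar>t - q k\<bar>"
    proof (rule lower_semicontinuous_tendsto[OF _ _ iw(1)[OF t] z(1) iw(2)[OF t] conv_const[OF z(1)] zL])
      show "(\<lambda>n. L * \<bar>q (i t n) - q k\<bar>) \<longlonglongrightarrow> L * \<bar>t - q k\<bar>"
        using iw(3)[OF t] by (intro tendsto_intros)
    qed (use z in auto)
    then have "d (w t) (z k) = 0" using k nonneg[of "w t" "z k"] by simp
    then show ?thesis using z(1) iw(1)[OF t] by simp
  qed
  have "Lip_curve M d L w" unfolding Lip_curve_def using iw(1) wL by auto
  moreover have "w 0 = x" using wz[OF k01(1)] zend[OF k01(1) \<gamma>(2) xy(1)] by simp
  moreover have "w 1 = y" using wz[OF k01(2)] zend[OF k01(2) \<gamma>(3) xy(2)] by simp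
  ultimately show ?thesis by (rule that)
qed

lemma length_dist_attained:
  assumes xy: "x \<in> M" "y \<in> M"
  obtains \<gamma> where "Lip_curve M d (len x y) \<gamma>" "\<gamma> 0 = x" "\<gamma> 1 = y"
    "curve_length {0..1} d \<gamma> = len x y"
proof -
  let ?S = "{\<gamma>\<in>AC {0..1} M d. \<gamma> 0 = x \<and> \<gamma> 1 = y}"
  define I where "I = (INF \<gamma>\<in>?S. ennreal (curve_length {0..1} d \<gamma>))"
  have l: "len x y = enn2real I" by (simp add: length_dist_def I_def)
  obtain L0 \<gamma>0 where 0: "Lip_curve M d L0 \<gamma>0" "\<gamma>0 0 = x" "\<gamma>0 1 = y" using Lipschitz_connected[OF xy] by blast
  have "I \<le> ennreal (curve_length {0..1} d \<gamma>0)"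
    unfolding I_def by (rule INF_lower) (use 0 Lip_curve_AC in auto)
  then have fin: "I < \<top>" using ennreal_less_top le_less_trans by blast
  then have I: "I = ennreal (len x y)" unfolding l by simp
  have l0: "0 \<le> len x y" by (simp add: l)
  \<comment> \<open>The slack \<open>1 / (real n + 1)\<close> makes the bound strictly larger than
    the infimum, so some curve stays below it; arc length turns its length into a Lipschitz
    constant.\<close>
  have "\<exists>\<eta>. Lip_curve M d (len x y + 1 / (real n + 1)) \<eta> \<and> \<eta> 0 = x \<and> \<eta> 1 = y" for n
  proof -
    have "I < ennreal (len x y + 1 / (real n + 1))"
      unfolding I using l0 by (simp add: ennreal_less_iff)
    then obtain \<gamma> where \<gamma>: "\<gamma> \<in> ?S" "ennreal (curve_length {0..1} d \<gamma>) < ennreal (len x y + 1 / (real n + 1))"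
      unfolding I_def INF_less_iff by blast
    have \<gamma>AC: "\<gamma> \<in> AC {0..1} M d" using \<gamma> by blast
    have c0: "0 \<le> curve_length {0..1} d \<gamma>" by (rule curve_length_nonneg[OF \<gamma>AC])
    obtain \<eta> where "Lip_curve M d (curve_length {0..1} d \<gamma>) \<eta>" "\<eta> 0 = \<gamma> 0" "\<eta> 1 = \<gamma> 1"
      using AC_reparametrization[OF \<gamma>AC] by blast
    moreover have "curve_length {0..1} d \<gamma> \<le> len x y + 1 / (real n + 1)"
      using \<gamma>(2) c0 by (simp add: ennreal_less_iff)
    ultimately show ?thesis using Lip_curve_mono \<gamma>(1) by (metis (mono_tags, lifting) mem_Collect_eq)
  qed
  then obtain \<gamma> where \<gamma>: "\<And>n. Lip_curve M d (len x y + 1 / (real n + 1)) (\<gamma> n)"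
     "\<And>n. \<gamma> n 0 = x" "\<And>n. \<gamma> n 1 = y" by metis
  have "(\<lambda>n. 1 / (real n + 1)) \<longlonglongrightarrow> 0" using LIMSEQ_inverse_real_of_nat by (simp add: inverse_eq_divide add.commute)
  then have lim: "(\<lambda>n. len x y + 1 / (real n + 1)) \<longlonglongrightarrow> len x y"
    using tendsto_add[OF tendsto_const] by fastforce
  obtain \<eta> where \<eta>: "Lip_curve M d (len x y) \<eta>" "\<eta> 0 = x" "\<eta> 1 = y"
  proof (rule Lip_curve_limit[OF \<gamma> lim _ xy])
    show "len x y + 1 / (real n + 1) \<le> len x y + 1" for n
      by (simp add: divide_le_eq)
  qed (rule that)
  have "I \<le> ennreal (curve_length {0..1} d \<eta>)"
    unfolding I_def by (rule INF_lower) (use \<eta> Lip_curve_AC in auto)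
  then have "len x y \<le> curve_length {0..1} d \<eta>"
    unfolding I using curve_length_nonneg[OF Lip_curve_AC[OF \<eta>(1)]] by simp
  with Lip_curve_length_le[OF \<eta>(1) l0] have "curve_length {0..1} d \<eta> = len x y" by simp
  with \<eta> show ?thesis by (rule that)
qed

lemma length_dist_nonneg: "0 \<le> len x y"
  by (simp add: length_dist_def)

lemma length_dist_commute_le:
  assumes xy: "x \<in> M" "y \<in> M"
  shows "len y x \<le> len x y"
proof -
  obtain \<gamma> where \<gamma>: "Lip_curve M d (len x y) \<gamma>" "\<gamma> 0 = x" "\<gamma> 1 = y"
    using length_dist_attained[OF xy] by blast
  from length_dist_le[OF Lip_curve_reverse[OF \<gamma>(1)] length_dist_nonneg] \<gamma>(2,3) show ?thesis by simp
qed

lemma Metric_space_length_dist: "Metric_space M (len)"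
proof
  fix x y z
  show "0 \<le> len x y" by (rule length_dist_nonneg)
  show "len x y = len y x"
  proof (cases "x \<in> M \<and> y \<in> M")
    case True
    then show ?thesis using length_dist_commute_le[of x y] length_dist_commute_le[of y x] by auto
  next
    \<comment> \<open>\<open>Metric_space\<close> asks for symmetry off the carrier as well; there
      both infima are taken over the empty set.\<close>
    case False
    then have "{\<gamma>\<in>AC {0..1} M d. \<gamma> 0 = x \<and> \<gamma> 1 = y} = {}" "{\<gamma>\<in>AC {0..1} M d. \<gamma> 0 = y \<and> \<gamma> 1 = x} = {}"
      by (auto simp: AC_def)
    then show ?thesis unfolding length_dist_def by (simp only: INF_empty)
  qed
  show "len x y = 0 \<longleftrightarrow> x = y" if xy: "x \<in> M" "y \<in> M"
  proof
    assume 0: "len x y = 0"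
    obtain \<gamma> where "Lip_curve M d (len x y) \<gamma>" "\<gamma> 0 = x" "\<gamma> 1 = y"
      using length_dist_attained[OF xy] by blast
    then have "d x y \<le> 0" unfolding 0 Lip_curve_def by force
    then show "x = y" using xy by (metis nonneg order_antisym zero)
  next
    assume "x = y"
    have "Lip_curve M d 0 (\<lambda>_. x)" using xy by (simp add: Lip_curve_def)
    from length_dist_le[OF this] \<open>x = y\<close> show "len x y = 0"
      using length_dist_nonneg[of x y] by simp
  qed
  show "len x z \<le> len x y + len y z" if xyz: "x \<in> M" "y \<in> M" "z \<in> M"
  proof (rule field_le_epsilon)
    fix e :: real assume e: "0 < e"
    obtain \<gamma> where \<gamma>: "Lip_curve M d (len x y) \<gamma>" "\<gamma> 0 = x" "\<gamma> 1 = y"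
      using length_dist_attained[OF xyz(1,2)] by blast
    obtain \<eta> where \<eta>: "Lip_curve M d (len y z) \<eta>" "\<eta> 0 = y" "\<eta> 1 = z"
      using length_dist_attained[OF xyz(2,3)] by blast
    \<comment> \<open>\<open>Lip_curve_join\<close> wants positive constants, while
      \<open>len\<close> vanishes for equal points.\<close>
    let ?L1 = "len x y + e/2" and ?L2 = "len y z + e/2"
    have p: "0 < ?L1" "0 < ?L2" using e length_dist_nonneg[of x y] length_dist_nonneg[of y z] by auto
    obtain \<zeta> where "Lip_curve M d (?L1 + ?L2) \<zeta>" "\<zeta> 0 = \<gamma> 0" "\<zeta> 1 = \<eta> 1"
      using Lip_curve_join[OF Lip_curve_mono[OF \<gamma>(1)] p(1) Lip_curve_mono[OF \<eta>(1)] p(2)] e \<gamma>(3) \<eta>(2) by auto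
    with length_dist_le[of "?L1 + ?L2" \<zeta>] p \<gamma> \<eta>
    show "len x z \<le> len x y + len y z + e" by simp
  qed
qed

theorem geodesic_space_length_dist: "geodesic_space M (len)"
  unfolding geodesic_space_def
proof (intro conjI ballI Metric_space_length_dist)
  interpret E: Metric_space M "len" by (rule Metric_space_length_dist)
  fix x y assume xy: "x \<in> M" "y \<in> M"
  define L where "L = len x y"
  have L0: "0 \<le> L" by (simp add: L_def)
  obtain \<gamma> where \<gamma>: "Lip_curve M d L \<gamma>" "\<gamma> 0 = x" "\<gamma> 1 = y"
    unfolding L_def using length_dist_attained[OF xy] by blast
  have \<gamma>M: "\<gamma> t \<in> M" if "t \<in> {0..1}" for t using \<gamma>(1) that by (auto simp: Lip_curve_def)
  have le: "len (\<gamma> s) (\<gamma> t) \<le> L * (t - s)" if "0 \<le> s" "s \<le> t" "t \<le> 1" for s t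
    using length_dist_le[OF Lip_curve_sub[OF \<gamma>(1) that]] L0 that by simp
  \<comment> \<open>If one piece were shorter than its share, the path through
    \<open>\<gamma> s\<close> and \<open>\<gamma> t\<close> would make \<open>len x y\<close>
    smaller than \<open>L\<close>.\<close>
  have eq: "len (\<gamma> s) (\<gamma> t) = L * (t - s)" if st: "0 \<le> s" "s \<le> t" "t \<le> 1" for s t
  proof (rule order_antisym[OF le[OF st]])
    have "L \<le> len (\<gamma> 0) (\<gamma> s) + len (\<gamma> s) (\<gamma> 1)"
      unfolding L_def \<gamma>(2,3)[symmetric] using st by (intro E.triangle \<gamma>M) auto
    also have "len (\<gamma> s) (\<gamma> 1) \<le> len (\<gamma> s) (\<gamma> t) + len (\<gamma> t) (\<gamma> 1)"
      using st by (intro E.triangle \<gamma>M) auto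
    finally show "L * (t - s) \<le> len (\<gamma> s) (\<gamma> t)"
      using le[of 0 s] le[of t 1] st by (simp add: algebra_simps)
  qed
  have eq': "len (\<gamma> s) (\<gamma> t) = L * \<bar>s - t\<bar>" if "s \<in> {0..1}" "t \<in> {0..1}" for s t
    using eq[of s t] eq[of t s] that E.commute[of "\<gamma> s" "\<gamma> t"] by (cases "s \<le> t") auto
  have "Lip_curve M (len) L \<gamma>" unfolding Lip_curve_def using \<gamma>M eq' by simp
  then have AC: "\<gamma> \<in> AC {0..1} M (len)" by (rule Lip_curve_AC)
  \<comment> \<open>By \<open>eq'\<close> the difference quotient equals \<open>L\<close> at all
    other times, so the limit exists everywhere, endpoints included.\<close>
  have "metric_deriv {0..1} (len) \<gamma> t = L" if t: "t \<in> {0..1}" for t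
    unfolding metric_deriv_def
  proof (rule tendsto_Lim)
    show "at t within {0..1} \<noteq> bot"
      using t islimpt_Icc[of 0 1 t] trivial_limit_within[of t "{0..1}"] by auto
    show "((\<lambda>s. len (\<gamma> s) (\<gamma> t) / \<bar>s - t\<bar>) \<longlongrightarrow> L) (at t within {0..1})"
      by (rule tendsto_eventually) (use eq' t in \<open>auto simp: eventually_at_filter\<close>)
  qed
  then have "curve_length {0..1} (len) \<gamma> = (LINT t:{0..1::real}|lebesgue. L)"
    unfolding curve_length_def set_lebesgue_integral_def
    by (intro Bochner_Integration.integral_cong) (auto simp: indicator_def)
  also have "\<dots> = L" by (simp add: set_integral_const_Icc)
  finally show "\<exists>\<gamma>\<in>AC {0..1} M (len). \<gamma> 0 = x \<and> \<gamma> 1 = y \<and>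
      curve_length {0..1} (len) \<gamma> = len x y"
    using AC \<gamma> by (auto simp: L_def)
qed

end

section \<open>Optimal transport on the line\<close>

text \<open>The left-continuous inverse of the distribution function. It is meant for levels
  strictly between 0 and 1, where the set is nonempty and bounded below; hence the open interval in
  \<open>unit_interval\<close>.\<close>

definition quantile :: "real measure \<Rightarrow> real \<Rightarrow> real" where
  "quantile M \<omega> = Inf {x. \<omega> \<le> cdf M x}"

abbreviation unit_interval :: "real measure" where
  "unit_interval \<equiv> restrict_space lborel {0<..<1}"

text \<open>Values in \<open>ennreal\<close> allow infinite distances, so the layer cake formula and
  Fatou's lemma hold for all distributions.\<close>

definition quantile_dist2 :: "real measure \<Rightarrow> real measure \<Rightarrow> ennreal" where
  "quantile_dist2 \<mu> \<nu> = (\<integral>\<^sup>+\<omega>. ennreal ((quantile \<mu> \<omega> - quantile \<nu> \<omega>)\<^sup>2) \<partial>unit_interval)"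

lemma prob_space_unit_interval: "prob_space unit_interval"
  by (auto simp: space_restrict_space emeasure_restrict_space intro!: prob_spaceI)

lemma cdf_distribution_iff: "cdf_distribution M \<longleftrightarrow> real_distribution M"
  by (simp add: cdf_distribution_def)

lemma quantile_le_iff:
  assumes "real_distribution M" "0 < \<omega>" "\<omega> < 1"
  shows "quantile M \<omega> \<le> x \<longleftrightarrow> \<omega> \<le> cdf M x"
proof -
  interpret cdf_distribution M using assms(1) by (simp add: cdf_distribution_iff)
  show ?thesis unfolding quantile_def by (rule pseudoinverse[OF assms(2,3), symmetric])
qed

lemma measurable_quantile:
  assumes "real_distribution M"
  shows "quantile M \<in> borel_measurable unit_interval"
proof -
  interpret cdf_distribution M using assms(1) by (simp add: cdf_distribution_iff)
  have "quantile M \<in> borel_measurable (restrict_space borel {0<..<1})"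
    unfolding quantile_def[abs_def] by (rule measurable_CI)
  moreover have "sets unit_interval = sets (restrict_space borel {0<..<1})"
    by (intro sets_restrict_space_cong) simp
  ultimately show ?thesis by (simp cong: measurable_cong_sets)
qed

lemma distr_quantile:
  assumes "real_distribution M"
  shows "distr unit_interval borel (quantile M) = M"
proof -
  interpret cdf_distribution M using assms(1) by (simp add: cdf_distribution_iff)
  show ?thesis unfolding quantile_def[abs_def] by (rule distr_I_eq_M)
qed

text \<open>A squared difference is the area of the square of pairs \<open>(u, v)\<close> with both
  entries between \<open>x\<close> and \<open>y\<close>. Writing this with \<open>min\<close> and
  \<open>max\<close>, and with a half-open interval, turns expectations into probabilities of events
  \<open>X \<le> a\<close> and \<open>b < Y\<close>, which distribution functions can
  estimate.\<close>

lemma square_diff_layer_cake: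
  fixes x y :: real
  shows "ennreal ((x - y)\<^sup>2) = (\<integral>\<^sup>+u. \<integral>\<^sup>+v. (if x \<le> min u v \<and> max u v < y then 1 else 0)
      + (if y \<le> min u v \<and> max u v < x then 1 else 0) \<partial>lborel \<partial>lborel)"
proof -
  have *: "(\<integral>\<^sup>+u. \<integral>\<^sup>+v. (if x \<le> min u v \<and> max u v < y then 1 else 0)
      + (if y \<le> min u v \<and> max u v < x then 1 else 0) \<partial>lborel \<partial>lborel) = ennreal ((x - y)\<^sup>2)"
    if "x \<le> y" for x y :: real
  proof -
    have "(if x \<le> min u v \<and> max u v < y then 1 else 0) + (if y \<le> min u v \<and> max u v < x then 1 else 0)
       = indicator {x..<y} u * (indicator {x..<y} v :: ennreal)" for u v
      using that by (auto simp: indicator_def)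
    then have "(\<integral>\<^sup>+u. \<integral>\<^sup>+v. (if x \<le> min u v \<and> max u v < y then 1 else 0)
      + (if y \<le> min u v \<and> max u v < x then 1 else 0) \<partial>lborel \<partial>lborel) = ennreal (y - x) * ennreal (y - x)"
      using that by (simp add: nn_integral_cmult nn_integral_multc)
    also have "\<dots> = ennreal ((x - y)\<^sup>2)"
      using that by (simp add: ennreal_mult'[symmetric] power2_eq_square algebra_simps)
    finally show ?thesis .
  qed
  show ?thesis
  proof (cases "x \<le> y")
    case True
    then show ?thesis using *[of x y] by simp
  next
    case False
    then show ?thesis using *[of y x] by (simp add: add.commute power2_commute)
  qed
qed

lemma (in prob_space) nn_integral_square_diff:
  fixes X Y :: "'a \<Rightarrow> real"
  assumes [measurable]: "X \<in> borel_measurable M" "Y \<in> borel_measurable M"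
  shows "(\<integral>\<^sup>+\<omega>. ennreal ((X \<omega> - Y \<omega>)\<^sup>2) \<partial>M) =
    (\<integral>\<^sup>+u. \<integral>\<^sup>+v. emeasure M {\<omega>\<in>space M. X \<omega> \<le> min u v \<and> max u v < Y \<omega>}
      + emeasure M {\<omega>\<in>space M. Y \<omega> \<le> min u v \<and> max u v < X \<omega>} \<partial>lborel \<partial>lborel)"
proof -
  interpret P: pair_sigma_finite M "lborel :: real measure" ..
  let ?S = "\<lambda>u v. emeasure M {\<omega>\<in>space M. X \<omega> \<le> min u v \<and> max u v < Y \<omega>}
      + emeasure M {\<omega>\<in>space M. Y \<omega> \<le> min u v \<and> max u v < X \<omega>}"
  let ?f = "\<lambda>\<omega> u v. (if X \<omega> \<le> min u v \<and> max u v < Y \<omega> then 1 else 0)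
      + (if Y \<omega> \<le> min u v \<and> max u v < X \<omega> then 1 else 0) :: ennreal"
  have "(\<integral>\<^sup>+\<omega>. ennreal ((X \<omega> - Y \<omega>)\<^sup>2) \<partial>M) = (\<integral>\<^sup>+\<omega>. \<integral>\<^sup>+u. \<integral>\<^sup>+v. ?f \<omega> u v \<partial>lborel \<partial>lborel \<partial>M)"
    by (simp only: square_diff_layer_cake)
  also have "\<dots> = (\<integral>\<^sup>+u. \<integral>\<^sup>+\<omega>. \<integral>\<^sup>+v. ?f \<omega> u v \<partial>lborel \<partial>M \<partial>lborel)"
    by (rule P.Fubini'[symmetric]) measurable
  also have "\<dots> = (\<integral>\<^sup>+u. \<integral>\<^sup>+v. \<integral>\<^sup>+\<omega>. ?f \<omega> u v \<partial>M \<partial>lborel \<partial>lborel)"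
    by (intro nn_integral_cong P.Fubini'[symmetric]) measurable
  also have "\<dots> = (\<integral>\<^sup>+u. \<integral>\<^sup>+v. ?S u v \<partial>lborel \<partial>lborel)"
  proof (intro nn_integral_cong)
    fix u v :: real
    have i: "(\<integral>\<^sup>+\<omega>. (if P \<omega> then 1 else 0) \<partial>M) = emeasure M {\<omega>\<in>space M. P \<omega>}" if [measurable]: "Measurable.pred M P" for P
    proof -
      have "(\<integral>\<^sup>+\<omega>. (if P \<omega> then 1 else 0) \<partial>M) = (\<integral>\<^sup>+\<omega>. indicator {\<omega>\<in>space M. P \<omega>} \<omega> \<partial>M)"
        by (intro nn_integral_cong) (auto simp: indicator_def)
      then show ?thesis by simp
    qed
    show "(\<integral>\<^sup>+\<omega>. ?f \<omega> u v \<partial>M) = ?S u v"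
      by (subst nn_integral_add) (auto simp: i)
  qed
  finally show ?thesis .
qed

text \<open>The event \<open>X \<le> a\<close> is covered by the joint event and
  \<open>Y \<le> b\<close>. The bound sees the marginals alone, so it holds for every coupling; a
  negative difference becomes 0 under \<open>ennreal\<close>.\<close>

lemma (in prob_space) emeasure_joint_ge:
  fixes X Y :: "'a \<Rightarrow> real"
  assumes [measurable]: "X \<in> borel_measurable M" "Y \<in> borel_measurable M"
  shows "ennreal (cdf (distr M borel X) a - cdf (distr M borel Y) b) \<le> emeasure M {\<omega>\<in>space M. X \<omega> \<le> a \<and> b < Y \<omega>}"
proof -
  have "prob {\<omega>\<in>space M. X \<omega> \<le> a} \<le> prob ({\<omega>\<in>space M. X \<omega> \<le> a \<and> b < Y \<omega>} \<union> {\<omega>\<in>space M. Y \<omega> \<le> b})"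
    by (intro finite_measure_mono) auto
  also have "\<dots> \<le> prob {\<omega>\<in>space M. X \<omega> \<le> a \<and> b < Y \<omega>} + prob {\<omega>\<in>space M. Y \<omega> \<le> b}"
    by (rule measure_Un_le) auto
  finally have "prob {\<omega>\<in>space M. X \<omega> \<le> a} - prob {\<omega>\<in>space M. Y \<omega> \<le> b} \<le> prob {\<omega>\<in>space M. X \<omega> \<le> a \<and> b < Y \<omega>}"
    by simp
  moreover have "cdf (distr M borel Z) c = prob {\<omega>\<in>space M. Z \<omega> \<le> c}" if "Z \<in> borel_measurable M" for Z :: "'a \<Rightarrow> real" and c
    unfolding cdf_def using that by (subst measure_distr) (auto intro!: arg_cong[where f=prob])
  ultimately show ?thesis by (simp add: emeasure_eq_measure ennreal_leI)
qed

text \<open>For quantile functions the event is the interval of levels from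
  \<open>cdf \<nu> b\<close> to \<open>cdf \<mu> a\<close>. The general lower bound is thus attained
  for all \<open>a\<close> and \<open>b\<close> at once.\<close>

lemma emeasure_quantile_joint:
  assumes "real_distribution \<mu>" "real_distribution \<nu>"
  shows "emeasure unit_interval {\<omega>\<in>space unit_interval. quantile \<mu> \<omega> \<le> a \<and> b < quantile \<nu> \<omega>} = ennreal (cdf \<mu> a - cdf \<nu> b)"
proof -
  interpret M: real_distribution \<mu> by fact
  interpret N: real_distribution \<nu> by fact
  let ?A = "{\<omega>\<in>{0<..<1}. cdf \<nu> b < \<omega> \<and> \<omega> \<le> cdf \<mu> a}"
  have "{\<omega>\<in>space unit_interval. quantile \<mu> \<omega> \<le> a \<and> b < quantile \<nu> \<omega>} = ?A"
    using quantile_le_iff[OF assms(1)] quantile_le_iff[OF assms(2)]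
    by (auto simp: space_restrict_space not_le[symmetric])
  moreover have "emeasure unit_interval ?A = emeasure lborel ?A"
    by (intro emeasure_restrict_space) auto
  moreover have "emeasure lborel ?A = emeasure lborel {cdf \<nu> b<..cdf \<mu> a}"
  proof (rule emeasure_eq_AE)
    \<comment> \<open>Since \<open>cdf \<nu> b\<close> is nonnegative and \<open>cdf \<mu> a\<close>
      at most 1, only the level 1 can be lost in the open interval.\<close>
    show "AE x in lborel. x \<in> ?A \<longleftrightarrow> x \<in> {cdf \<nu> b<..cdf \<mu> a}"
      using AE_lborel_singleton[of 1] 
      by eventually_elim (use N.cdf_nonneg[of b] M.cdf_bounded_prob[of a] in auto)
  qed auto
  moreover have "emeasure lborel {cdf \<nu> b<..cdf \<mu> a} = ennreal (cdf \<mu> a - cdf \<nu> b)"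
    by (cases "cdf \<nu> b \<le> cdf \<mu> a") (auto simp: ennreal_neg)
  ultimately show ?thesis by simp
qed

lemma quantile_dist2_eq:
  assumes "real_distribution \<mu>" "real_distribution \<nu>"
  shows "quantile_dist2 \<mu> \<nu> = (\<integral>\<^sup>+u. \<integral>\<^sup>+v. ennreal (cdf \<mu> (min u v) - cdf \<nu> (max u v))
      + ennreal (cdf \<nu> (min u v) - cdf \<mu> (max u v)) \<partial>lborel \<partial>lborel)"
proof -
  interpret prob_space unit_interval by (rule prob_space_unit_interval)
  show ?thesis
    unfolding quantile_dist2_def nn_integral_square_diff[OF measurable_quantile[OF assms(1)] measurable_quantile[OF assms(2)]]
    by (simp only: emeasure_quantile_joint[OF assms] emeasure_quantile_joint[OF assms(2,1)])
qed

lemma (in prob_space) quantile_dist2_le: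
  fixes X Y :: "'a \<Rightarrow> real"
  assumes [measurable]: "X \<in> borel_measurable M" "Y \<in> borel_measurable M"
  shows "quantile_dist2 (distr M borel X) (distr M borel Y) \<le> (\<integral>\<^sup>+\<omega>. ennreal ((X \<omega> - Y \<omega>)\<^sup>2) \<partial>M)"
  unfolding quantile_dist2_eq[OF real_distribution_distr[OF assms(1)] real_distribution_distr[OF assms(2)]] nn_integral_square_diff[OF assms]
  by (intro nn_integral_mono add_mono emeasure_joint_ge assms)

abbreviation transport_cost :: "('a::euclidean_space \<times> 'a) measure \<Rightarrow> ennreal" where
  "transport_cost \<pi> \<equiv> \<integral>\<^sup>+p. ennreal ((dist (fst p) (snd p))\<^sup>2) \<partial>\<pi>"

text \<open>The joint law of the two quantile functions is a coupling with this cost. Any other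
  coupling is compared with it by \<open>quantile_dist2_le\<close>, with the coordinate projections
  as random variables.\<close>

theorem INF_couplings_eq_quantile_dist2:
  assumes "real_distribution \<mu>" "real_distribution \<nu>"
  shows "(INF \<pi>\<in>couplings \<mu> \<nu>. transport_cost \<pi>) = quantile_dist2 \<mu> \<nu>"
proof (rule antisym)
  interpret M: real_distribution \<mu> by fact
  note [measurable] = measurable_quantile[OF assms(1)] measurable_quantile[OF assms(2)]
  let ?\<pi> = "distr unit_interval (borel \<Otimes>\<^sub>M borel) (\<lambda>\<omega>. (quantile \<mu> \<omega>, quantile \<nu> \<omega>))"
  have "?\<pi> \<in> couplings \<mu> \<nu>"
    unfolding couplings_def
    using distr_quantile[OF assms(1)] distr_quantile[OF assms(2)]
    by (auto simp: distr_distr comp_def)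
  then have "(INF \<pi>\<in>couplings \<mu> \<nu>. transport_cost \<pi>) \<le> transport_cost ?\<pi>"
    by (rule INF_lower)
  also have "\<dots> = quantile_dist2 \<mu> \<nu>"
    unfolding quantile_dist2_def by (subst nn_integral_distr) (auto simp: dist_real_def)
  finally show "(INF \<pi>\<in>couplings \<mu> \<nu>. transport_cost \<pi>) \<le> quantile_dist2 \<mu> \<nu>" .
  show "quantile_dist2 \<mu> \<nu> \<le> (INF \<pi>\<in>couplings \<mu> \<nu>. transport_cost \<pi>)"
  proof (rule INF_greatest)
    fix \<pi> assume "\<pi> \<in> couplings \<mu> \<nu>"
    then have s: "sets \<pi> = sets (borel \<Otimes>\<^sub>M borel)" and d: "distr \<pi> borel fst = \<mu>" "distr \<pi> borel snd = \<nu>"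
      by (auto simp: couplings_def)
    have fm: "fst \<in> borel_measurable \<pi>" and sm: "snd \<in> borel_measurable \<pi>"
      by (simp_all cong: measurable_cong_sets[OF s refl])
    \<comment> \<open>\<open>couplings\<close> prescribes the marginals; the total mass of
      \<open>\<pi>\<close> is read off from the first one.\<close>
    interpret P: prob_space \<pi>
      using M.prob_space_axioms unfolding d(1)[symmetric] by (rule prob_space_distrD[OF fm])
    show "quantile_dist2 \<mu> \<nu> \<le> transport_cost \<pi>"
      using P.quantile_dist2_le[OF fm sm] unfolding d by (simp add: dist_real_def)
  qed
qed

corollary W_eq_quantile_dist2:
  assumes "real_distribution \<mu>" "real_distribution \<nu>"
  shows "W \<mu> \<nu> = sqrt (enn2real (quantile_dist2 \<mu> \<nu>))"
  unfolding W_def INF_couplings_eq_quantile_dist2[OF assms] ..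

text \<open>Weak convergence gives convergence of the distribution functions off the countably many
  atoms. In \<open>quantile_dist2_eq\<close> the integrands therefore converge for almost all
  \<open>u\<close> and \<open>v\<close>, and Fatou's lemma applies to each integral in turn.\<close>

lemma quantile_dist2_liminf:
  assumes \<mu>: "\<And>n. real_distribution (\<mu>s n)" "real_distribution \<mu>" "weak_conv_m \<mu>s \<mu>"
    and \<nu>: "\<And>n. real_distribution (\<nu>s n)" "real_distribution \<nu>" "weak_conv_m \<nu>s \<nu>"
  shows "quantile_dist2 \<mu> \<nu> \<le> liminf (\<lambda>n. quantile_dist2 (\<mu>s n) (\<nu>s n))"
proof -
  have cm: "cdf M \<in> borel_measurable borel" if "real_distribution M" for M
    using that cdf_distribution.measurable_C by (simp add: cdf_distribution_iff)
  have conv: "AE u in lborel. (\<lambda>n. cdf (Ms n) u) \<longlonglongrightarrow> cdf M u"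
    if "real_distribution M" "weak_conv_m Ms M" for Ms M
  proof -
    interpret real_distribution M by fact
    have "AE u in lborel. u \<notin> {x. measure M {x} > 0}"
      by (rule AE_not_in[OF countable_imp_null_set_lborel[OF countable_atoms]])
    then show ?thesis
    proof eventually_elim
      case (elim u)
      then have "isCont (cdf M) u" unfolding isCont_cdf by (simp add: zero_less_measure_iff)
      then show ?case using that(2) by (simp add: weak_conv_m_def weak_conv_def)
    qed
  qed
  let ?f = "\<lambda>M N u v. ennreal (cdf M (min u v) - cdf N (max u v)) + ennreal (cdf N (min u v) - cdf M (max u v))"
  have fm: "(\<lambda>(u,v). ?f M N u v) \<in> borel_measurable (lborel \<Otimes>\<^sub>M lborel)"
    if "real_distribution M" "real_distribution N" for M N
    using cm[OF that(1)] cm[OF that(2)] by measurable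
  have A: "AE u in lborel. AE v in lborel. (\<lambda>n. ?f (\<mu>s n) (\<nu>s n) u v) \<longlonglongrightarrow> ?f \<mu> \<nu> u v"
    using conv[OF \<mu>(2,3)] conv[OF \<nu>(2,3)]
  proof eventually_elim
    case (elim u)
    show ?case using conv[OF \<mu>(2,3)] conv[OF \<nu>(2,3)]
    proof eventually_elim
      case (elim v)
      have "(\<lambda>n. cdf (\<mu>s n) w) \<longlonglongrightarrow> cdf \<mu> w" "(\<lambda>n. cdf (\<nu>s n) w) \<longlonglongrightarrow> cdf \<nu> w" if "w = u \<or> w = v" for w
        using that elim \<open>(\<lambda>n. cdf (\<mu>s n) u) \<longlonglongrightarrow> cdf \<mu> u\<close> \<open>(\<lambda>n. cdf (\<nu>s n) u) \<longlonglongrightarrow> cdf \<nu> u\<close> by auto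
      then show ?case by (intro tendsto_intros tendsto_ennrealI) (auto simp: min_def max_def)
    qed
  qed
  have "quantile_dist2 \<mu> \<nu> = (\<integral>\<^sup>+u. \<integral>\<^sup>+v. ?f \<mu> \<nu> u v \<partial>lborel \<partial>lborel)"
    by (rule quantile_dist2_eq) fact+
  also have "\<dots> \<le> (\<integral>\<^sup>+u. liminf (\<lambda>n. \<integral>\<^sup>+v. ?f (\<mu>s n) (\<nu>s n) u v \<partial>lborel) \<partial>lborel)"
  proof (rule nn_integral_mono_AE)
    show "AE u in lborel. (\<integral>\<^sup>+v. ?f \<mu> \<nu> u v \<partial>lborel) \<le> liminf (\<lambda>n. \<integral>\<^sup>+v. ?f (\<mu>s n) (\<nu>s n) u v \<partial>lborel)"
      using A
    proof eventually_elim
      case (elim u)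
      have "(\<integral>\<^sup>+v. ?f \<mu> \<nu> u v \<partial>lborel) = (\<integral>\<^sup>+v. liminf (\<lambda>n. ?f (\<mu>s n) (\<nu>s n) u v) \<partial>lborel)"
        by (rule nn_integral_cong_AE) (use elim in \<open>eventually_elim, auto dest!: lim_imp_Liminf[rotated]\<close>)
      also have "\<dots> \<le> liminf (\<lambda>n. \<integral>\<^sup>+v. ?f (\<mu>s n) (\<nu>s n) u v \<partial>lborel)"
      proof (rule nn_integral_liminf)
        fix n
        note [measurable] = cm[OF \<mu>(1)[of n]] cm[OF \<nu>(1)[of n]]
        show "?f (\<mu>s n) (\<nu>s n) u \<in> borel_measurable lborel" by measurable
      qed
      finally show ?case .
    qed
  qed
  also have "\<dots> \<le> liminf (\<lambda>n. \<integral>\<^sup>+u. \<integral>\<^sup>+v. ?f (\<mu>s n) (\<nu>s n) u v \<partial>lborel \<partial>lborel)"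
    using fm[OF \<mu>(1) \<nu>(1)] by (intro nn_integral_liminf lborel.borel_measurable_nn_integral) auto
  also have "\<dots> = liminf (\<lambda>n. quantile_dist2 (\<mu>s n) (\<nu>s n))"
    by (simp only: quantile_dist2_eq[OF \<mu>(1) \<nu>(1)])
  finally show ?thesis .
qed

section \<open>The sliced Wasserstein metric\<close>

abbreviation second_moment :: "'a::euclidean_space measure \<Rightarrow> ennreal" where
  "second_moment \<mu> \<equiv> \<integral>\<^sup>+x. ennreal ((norm x)\<^sup>2) \<partial>\<mu>"

lemma P2D:
  assumes "\<mu> \<in> P2"
  shows "prob_space \<mu>" "sets \<mu> = sets borel" "integrable \<mu> (\<lambda>x. (norm x)\<^sup>2)"
  using assms by (auto simp: P2_def)

lemma P2_space:
  assumes "\<mu> \<in> P2" shows "space \<mu> = UNIV"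
  using sets_eq_imp_space_eq[OF P2D(2)[OF assms]] by simp

lemma P2I:
  fixes \<mu> :: "'a::euclidean_space measure"
  assumes "prob_space \<mu>" "sets \<mu> = sets borel" "second_moment \<mu> < \<infinity>"
  shows "\<mu> \<in> P2"
  unfolding P2_def using assms
  by (auto intro!: integrableI_nonneg simp: measurable_cong_sets[OF assms(2) refl])

lemma measurable_P2:
  fixes \<mu> :: "'a::euclidean_space measure"
  assumes "\<mu> \<in> P2" "f \<in> borel_measurable borel" shows "f \<in> borel_measurable \<mu>"
  using assms(2) measurable_cong_sets[OF P2D(2)[OF assms(1)] refl, of "borel :: 'b::topological_space measure"] by simp

lemma P2_second_moment_finite:
  assumes "\<mu> \<in> P2"
  shows "second_moment \<mu> < \<infinity>"
  using P2D(3)[OF assms] by (simp add: nn_integral_eq_integral)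

lemma real_distribution_proj_measure:
  assumes "\<mu> \<in> P2" shows "real_distribution (proj_measure \<theta> \<mu>)"
  unfolding proj_measure_def
  by (rule prob_space.real_distribution_distr[OF P2D(1)[OF assms]]) (rule measurable_P2[OF assms], simp)

lemma measurable_cdf_proj_measure:
  assumes "\<mu> \<in> P2"
  shows "(\<lambda>p. cdf (proj_measure (fst p) \<mu>) (snd p)) \<in> borel_measurable (borel \<Otimes>\<^sub>M borel)"
proof -
  interpret prob_space \<mu> by (rule P2D(1)[OF assms])
  note [measurable_cong] = P2D(2)[OF assms]
  have "cdf (proj_measure \<theta> \<mu>) x = enn2real (\<integral>\<^sup>+y. (if y \<bullet> \<theta> \<le> x then 1 else 0) \<partial>\<mu>)" for \<theta> x
  proof -
    have "cdf (proj_measure \<theta> \<mu>) x = measure \<mu> {y. y \<bullet> \<theta> \<le> x}"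
      unfolding cdf_def proj_measure_def
      by (subst measure_distr) (auto simp: P2_space[OF assms] intro!: arg_cong[where f="measure \<mu>"])
    also have "\<dots> = enn2real (\<integral>\<^sup>+y. indicator {y. y \<bullet> \<theta> \<le> x} y \<partial>\<mu>)"
      by (subst nn_integral_indicator) (auto simp: measure_def)
    also have "(\<integral>\<^sup>+y. indicator {y. y \<bullet> \<theta> \<le> x} y \<partial>\<mu>) = (\<integral>\<^sup>+y. (if y \<bullet> \<theta> \<le> x then 1 else 0) \<partial>\<mu>)"
      by (intro nn_integral_cong) (auto simp: indicator_def)
    finally show ?thesis .
  qed
  then show ?thesis by simp
qed

text \<open>Viewed as a function of direction and level, the quantile embeds the measures into an L2
  space over the product, where \<open>SW\<close> is the norm distance.\<close>

definition proj_quantile :: "'a::euclidean_space measure \<Rightarrow> 'a \<times> real \<Rightarrow> real" where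
  "proj_quantile \<mu> p = quantile (proj_measure (fst p) \<mu>) (snd p)"

text \<open>By \<open>quantile_le_iff\<close> a sublevel set compares the level with a distribution
  function, and that is jointly measurable by Tonelli.\<close>

lemma measurable_proj_quantile:
  fixes \<mu> :: "'a::euclidean_space measure"
  assumes "\<mu> \<in> P2"
  shows "proj_quantile \<mu> \<in> borel_measurable (borel \<Otimes>\<^sub>M unit_interval)"
proof (rule borel_measurableI_le)
  fix y :: real
  have sp: "space ((borel :: 'a measure) \<Otimes>\<^sub>M unit_interval) = UNIV \<times> {0<..<1}"
    by (simp add: space_pair_measure space_restrict_space)
  have id[measurable]: "(\<lambda>x. x) \<in> measurable unit_interval borel"
    by (intro measurable_restrict_space1) simp
  have [measurable]: "(\<lambda>p. cdf (proj_measure (fst p) \<mu>) y) \<in> borel_measurable ((borel :: 'a measure) \<Otimes>\<^sub>M unit_interval)"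
    using measurable_compose[OF _ measurable_cdf_proj_measure[OF assms], of "\<lambda>p. (fst p, y)" "(borel :: 'a measure) \<Otimes>\<^sub>M unit_interval"]
    by simp
  have [measurable]: "snd \<in> borel_measurable ((borel :: 'a measure) \<Otimes>\<^sub>M unit_interval)"
    using measurable_compose[OF measurable_snd id] by simp
  have "{p \<in> space (borel \<Otimes>\<^sub>M unit_interval). proj_quantile \<mu> p \<le> y} =
      {p \<in> space (borel \<Otimes>\<^sub>M unit_interval). snd p \<le> cdf (proj_measure (fst p) \<mu>) y}"
    unfolding sp proj_quantile_def by (auto simp: quantile_le_iff[OF real_distribution_proj_measure[OF assms]])
  also have "\<dots> \<in> sets (borel \<Otimes>\<^sub>M unit_interval)" by measurable
  finally show "{p \<in> space (borel \<Otimes>\<^sub>M unit_interval). proj_quantile \<mu> p \<le> y} \<in> sets (borel \<Otimes>\<^sub>M unit_interval)" .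
qed

section \<open>The uniform measure on the sphere\<close>

lemma emeasure_unit_ball:
  "emeasure lborel (ball (0::'a::euclidean_space) 1) \<noteq> 0" "emeasure lborel (ball (0::'a::euclidean_space) 1) \<noteq> \<infinity>"
proof -
  have "\<not> negligible (ball (0::'a) 1)" by (rule open_not_negligible) auto
  then show "emeasure lborel (ball (0::'a) 1) \<noteq> 0"
    by (auto simp: negligible_iff_null_sets null_sets_def)
  show "emeasure lborel (ball (0::'a) 1) \<noteq> \<infinity>"
    using emeasure_lborel_ball_finite[of "0::'a" 1] by simp
qed

lemma measurable_sgn_borel[measurable]: "(sgn :: 'a::euclidean_space \<Rightarrow> 'a) \<in> borel_measurable borel"
  unfolding sgn_div_norm[abs_def] by measurable

lemma prob_space_sphere_measure: "prob_space (sphere_measure :: 'a::euclidean_space measure)"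
  unfolding sphere_measure_def
  by (intro prob_space.prob_space_distr prob_space_uniform_measure emeasure_unit_ball)
     (simp add: measurable_cong_sets[OF sets_uniform_measure refl])

lemma sets_sphere_measure[simp, measurable_cong]: "sets sphere_measure = sets borel"
  by (simp add: sphere_measure_def)

text \<open>An exceptional set of directions is exchanged for the cone over it, which is Lebesgue
  null in the ball; there, open sets and hyperplanes are easy to judge.\<close>

lemma AE_sphere_measureD:
  assumes "AE \<theta> in (sphere_measure :: 'a::euclidean_space measure). P \<theta>"
  shows "AE y in lborel. y \<in> ball (0::'a) 1 \<longrightarrow> P (sgn y)"
proof -
  have "AE y in uniform_measure lborel (ball (0::'a) 1). P (sgn y)"
    using assms unfolding sphere_measure_def
    by (rule AE_distrD[rotated]) (simp add: measurable_cong_sets[OF sets_uniform_measure refl])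
  then show ?thesis
    using emeasure_unit_ball by (subst (asm) AE_uniform_measure) (auto simp: less_top)
qed

lemma AE_sphere_measureI:
  assumes m: "Measurable.pred borel P" and "\<And>y. y \<noteq> 0 \<Longrightarrow> P (sgn y)"
  shows "AE \<theta> in (sphere_measure :: 'a::euclidean_space measure). P \<theta>"
proof -
  have "AE y in lborel. y \<noteq> (0::'a)" by (rule AE_lborel_singleton)
  then have "AE y in lborel. y \<in> ball (0::'a) 1 \<longrightarrow> P (sgn y)" by eventually_elim (use assms in auto)
  then have "AE y in uniform_measure lborel (ball (0::'a) 1). P (sgn y)"
    by (intro AE_uniform_measureI) auto
  then show ?thesis unfolding sphere_measure_def
    by (subst AE_distr_iff) (use m in \<open>auto simp: measurable_cong_sets[OF sets_uniform_measure refl]\<close>)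
qed

lemma AE_in_sphere: "AE \<theta> in (sphere_measure :: 'a::euclidean_space measure). \<theta> \<in> sphere 0 1"
  by (rule AE_sphere_measureI) (auto simp: norm_sgn)

abbreviation proj_dist2 :: "'a::euclidean_space measure \<Rightarrow> 'a measure \<Rightarrow> 'a \<Rightarrow> ennreal" where
  "proj_dist2 \<mu> \<nu> \<theta> \<equiv> quantile_dist2 (proj_measure \<theta> \<mu>) (proj_measure \<theta> \<nu>)"

definition SW2 :: "'a::euclidean_space measure \<Rightarrow> 'a measure \<Rightarrow> ennreal" where
  "SW2 \<mu> \<nu> = (\<integral>\<^sup>+\<theta>. proj_dist2 \<mu> \<nu> \<theta> \<partial>sphere_measure)"

lemma SW2_eq:
  fixes \<mu> \<nu> :: "'a::euclidean_space measure"
  assumes "\<mu> \<in> P2" "\<nu> \<in> P2"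
  shows "SW2 \<mu> \<nu> = (\<integral>\<^sup>+p. ennreal ((proj_quantile \<mu> p - proj_quantile \<nu> p)\<^sup>2) \<partial>(sphere_measure \<Otimes>\<^sub>M unit_interval))"
    (is ?eq)
    and measurable_proj_dist2:
      "proj_dist2 \<mu> \<nu> \<in> borel_measurable borel"
proof -
  interpret U: prob_space unit_interval by (rule prob_space_unit_interval)
  note m = measurable_proj_quantile[OF assms(1)] measurable_proj_quantile[OF assms(2)]
  have s: "sets (sphere_measure \<Otimes>\<^sub>M unit_interval) = sets ((borel :: 'a measure) \<Otimes>\<^sub>M unit_interval)"
    by (intro sets_pair_measure_cong) auto
  have m': "(\<lambda>p. ennreal ((proj_quantile \<mu> p - proj_quantile \<nu> p)\<^sup>2)) \<in> borel_measurable (borel \<Otimes>\<^sub>M unit_interval)"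
    using m by measurable
  show ?eq
    unfolding SW2_def quantile_dist2_def
    using m' by (subst U.nn_integral_fst[symmetric]) (auto simp: proj_quantile_def measurable_cong_sets[OF s refl])
  have "(\<lambda>\<theta>. \<integral>\<^sup>+\<omega>. ennreal ((proj_quantile \<mu> (\<theta>, \<omega>) - proj_quantile \<nu> (\<theta>, \<omega>))\<^sup>2) \<partial>unit_interval) \<in> borel_measurable borel"
    by (rule U.borel_measurable_nn_integral_fst[OF m'])
  then show "proj_dist2 \<mu> \<nu> \<in> borel_measurable borel"
    by (simp add: quantile_dist2_def proj_quantile_def)
qed

text \<open>Random vectors on a common space couple all projections simultaneously, and taking the
  inner product with \<open>\<theta>\<close> does not increase distances.\<close>

lemma (in prob_space) proj_dist2_distr_le:
  fixes X Y :: "'a \<Rightarrow> 'b::euclidean_space"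
  assumes [measurable]: "X \<in> borel_measurable M" "Y \<in> borel_measurable M" and "norm \<theta> \<le> 1"
  shows "proj_dist2 (distr M borel X) (distr M borel Y) \<theta>
    \<le> (\<integral>\<^sup>+\<omega>. ennreal ((norm (X \<omega> - Y \<omega>))\<^sup>2) \<partial>M)"
proof -
  have "proj_dist2 (distr M borel X) (distr M borel Y) \<theta> =
     quantile_dist2 (distr M borel (\<lambda>\<omega>. X \<omega> \<bullet> \<theta>)) (distr M borel (\<lambda>\<omega>. Y \<omega> \<bullet> \<theta>))"
    by (simp add: proj_measure_def distr_distr comp_def)
  also have "\<dots> \<le> (\<integral>\<^sup>+\<omega>. ennreal ((X \<omega> \<bullet> \<theta> - Y \<omega> \<bullet> \<theta>)\<^sup>2) \<partial>M)"
    by (rule quantile_dist2_le) auto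
  also have "\<dots> \<le> (\<integral>\<^sup>+\<omega>. ennreal ((norm (X \<omega> - Y \<omega>))\<^sup>2) \<partial>M)"
  proof (intro nn_integral_mono ennreal_leI)
    fix \<omega>
    have "\<bar>(X \<omega> - Y \<omega>) \<bullet> \<theta>\<bar> \<le> norm (X \<omega> - Y \<omega>) * norm \<theta>" by (rule Cauchy_Schwarz_ineq2)
    also have "\<dots> \<le> norm (X \<omega> - Y \<omega>)" using assms(3) by (simp add: mult_left_le)
    finally show "(X \<omega> \<bullet> \<theta> - Y \<omega> \<bullet> \<theta>)\<^sup>2 \<le> (norm (X \<omega> - Y \<omega>))\<^sup>2"
      by (simp add: inner_diff_left abs_le_square_iff[symmetric])
  qed
  finally show ?thesis .
qed

lemma nn_integral_sphere_le:
  assumes "\<And>\<theta>. \<theta> \<in> sphere (0::'a::euclidean_space) 1 \<Longrightarrow> f \<theta> \<le> c"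
  shows "(\<integral>\<^sup>+\<theta>. f \<theta> \<partial>(sphere_measure :: 'a measure)) \<le> c"
proof -
  interpret prob_space "sphere_measure :: 'a measure" by (rule prob_space_sphere_measure)
  have "(\<integral>\<^sup>+\<theta>. f \<theta> \<partial>(sphere_measure :: 'a measure)) \<le> (\<integral>\<^sup>+\<theta>. c \<partial>(sphere_measure :: 'a measure))"
    by (rule nn_integral_mono_AE) (use AE_in_sphere in \<open>eventually_elim, use assms in auto\<close>)
  then show ?thesis by (simp add: emeasure_space_1)
qed

lemma ennreal_norm_diff_square_le:
  fixes x y :: "'a::real_normed_vector"
  shows "ennreal ((norm (x - y))\<^sup>2) \<le> 2 * ennreal ((norm x)\<^sup>2) + 2 * ennreal ((norm y)\<^sup>2)"
proof -
  have "(norm (x - y))\<^sup>2 \<le> (norm x + norm y)\<^sup>2" by (intro power_mono norm_triangle_ineq4) auto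
  also have "\<dots> \<le> 2 * (norm x)\<^sup>2 + 2 * (norm y)\<^sup>2"
    using zero_le_power2[of "norm x - norm y"] by (simp add: power2_eq_square algebra_simps)
  finally have "ennreal ((norm (x - y))\<^sup>2) \<le> ennreal (2 * (norm x)\<^sup>2 + 2 * (norm y)\<^sup>2)" by (rule ennreal_leI)
  then show ?thesis by (simp add: ennreal_mult')
qed

lemma distr_pair_P2:
  assumes \<mu>: "\<mu> \<in> P2" and \<nu>: "\<nu> \<in> P2"
  shows "distr (\<mu> \<Otimes>\<^sub>M \<nu>) borel fst = \<mu>" "distr (\<mu> \<Otimes>\<^sub>M \<nu>) borel snd = \<nu>"
proof -
  interpret M: prob_space \<mu> by (rule P2D(1)[OF \<mu>])
  interpret N: prob_space \<nu> by (rule P2D(1)[OF \<nu>])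
  note [measurable_cong] = P2D(2)[OF \<mu>] P2D(2)[OF \<nu>]
  show "distr (\<mu> \<Otimes>\<^sub>M \<nu>) borel fst = \<mu>"
    using N.distr_pair_fst[of \<mu>] P2D(2)[OF \<mu>] by (simp cong: distr_cong)
  show "distr (\<mu> \<Otimes>\<^sub>M \<nu>) borel snd = \<nu>"
  proof (rule measure_eqI)
    fix A assume "A \<in> sets (distr (\<mu> \<Otimes>\<^sub>M \<nu>) borel snd)"
    then have A[measurable]: "A \<in> sets borel" by simp
    have "emeasure (distr (\<mu> \<Otimes>\<^sub>M \<nu>) borel snd) A = emeasure (\<mu> \<Otimes>\<^sub>M \<nu>) (space \<mu> \<times> A)"
      by (subst emeasure_distr)
         (auto simp: space_pair_measure P2_space[OF \<mu>] P2_space[OF \<nu>] intro!: arg_cong[where f="emeasure _"])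
    also have "\<dots> = emeasure \<nu> A"
      by (subst N.emeasure_pair_measure_Times) (auto simp: M.emeasure_space_1)
    finally show "emeasure (distr (\<mu> \<Otimes>\<^sub>M \<nu>) borel snd) A = emeasure \<nu> A" .
  qed (simp add: P2D(2)[OF \<nu>])
qed

text \<open>The product coupling is far from optimal, but it gives a finite bound that is uniform in
  the direction.\<close>

lemma proj_dist2_le:
  assumes \<mu>: "\<mu> \<in> P2" and \<nu>: "\<nu> \<in> P2" and "norm \<theta> \<le> 1"
  shows "proj_dist2 \<mu> \<nu> \<theta> \<le>
    2 * second_moment \<mu> + 2 * second_moment \<nu>"
proof -
  interpret M: prob_space \<mu> by (rule P2D(1)[OF \<mu>])
  interpret N: prob_space \<nu> by (rule P2D(1)[OF \<nu>])
  interpret pair_prob_space \<mu> \<nu> ..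
  note [measurable_cong] = P2D(2)[OF \<mu>] P2D(2)[OF \<nu>]
  note d = distr_pair_P2[OF \<mu> \<nu>]
  have "proj_dist2 \<mu> \<nu> \<theta> \<le> (\<integral>\<^sup>+p. ennreal ((norm (fst p - snd p))\<^sup>2) \<partial>(\<mu> \<Otimes>\<^sub>M \<nu>))"
    using P.proj_dist2_distr_le[of fst snd \<theta>] assms(3) unfolding d by simp
  also have "\<dots> \<le> (\<integral>\<^sup>+p. 2 * ennreal ((norm (fst p))\<^sup>2) + 2 * ennreal ((norm (snd p))\<^sup>2) \<partial>(\<mu> \<Otimes>\<^sub>M \<nu>))"
    by (intro nn_integral_mono ennreal_norm_diff_square_le)
  also have "\<dots> = 2 * second_moment (distr (\<mu> \<Otimes>\<^sub>M \<nu>) borel fst) + 2 * second_moment (distr (\<mu> \<Otimes>\<^sub>M \<nu>) borel snd)"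
    by (simp add: nn_integral_add nn_integral_cmult nn_integral_distr)
  finally show ?thesis unfolding d .
qed

lemma SW2_finite:
  assumes \<mu>: "\<mu> \<in> P2" and \<nu>: "\<nu> \<in> P2"
  shows "SW2 \<mu> \<nu> < \<infinity>"
proof -
  have "SW2 \<mu> \<nu> \<le> 2 * second_moment \<mu> + 2 * second_moment \<nu>"
    unfolding SW2_def by (intro nn_integral_sphere_le proj_dist2_le assms) auto
  also have "\<dots> < \<infinity>" using P2_second_moment_finite[OF \<mu>] P2_second_moment_finite[OF \<nu>]
    by (auto simp: ennreal_mult_less_top less_top)
  finally show ?thesis .
qed

text \<open>\<open>W\<close> and \<open>SW\<close> pass through \<open>enn2real\<close> and a
  Bochner integral, both of which would turn infinity into 0. The uniform bound on the sphere
  excludes this, and all later estimates can be made in \<open>ennreal\<close>.\<close>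

lemma SW_eq_SW2:
  fixes \<mu> \<nu> :: "'a::euclidean_space measure"
  assumes \<mu>: "\<mu> \<in> P2" and \<nu>: "\<nu> \<in> P2"
  shows "SW \<mu> \<nu> = sqrt (enn2real (SW2 \<mu> \<nu>))"
proof -
  define q where "q \<theta> = proj_dist2 \<mu> \<nu> \<theta>" for \<theta>
  have [measurable]: "q \<in> borel_measurable borel"
    unfolding q_def[abs_def] by (rule measurable_proj_dist2[OF assms])
  have [measurable]: "sphere (0 :: 'a) 1 \<in> sets borel" by (intro borel_closed closed_sphere)
  have W: "(W (proj_measure \<theta> \<mu>) (proj_measure \<theta> \<nu>))\<^sup>2 = enn2real (q \<theta>)" for \<theta>
    by (simp add: q_def W_eq_quantile_dist2 real_distribution_proj_measure assms)
  have "(LINT \<theta>:sphere 0 1|sphere_measure. (W (proj_measure \<theta> \<mu>) (proj_measure \<theta> \<nu>))\<^sup>2)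
     = enn2real (\<integral>\<^sup>+\<theta>. ennreal (indicat_real (sphere 0 1) \<theta> * enn2real (q \<theta>)) \<partial>sphere_measure)"
    unfolding W set_lebesgue_integral_def
    by (subst integral_eq_nn_integral) auto
  also have "(\<integral>\<^sup>+\<theta>. ennreal (indicat_real (sphere 0 1) \<theta> * enn2real (q \<theta>)) \<partial>sphere_measure) = SW2 \<mu> \<nu>"
    unfolding SW2_def q_def[symmetric]
  proof (rule nn_integral_cong_AE)
    show "AE \<theta> in sphere_measure. ennreal (indicat_real (sphere 0 1) \<theta> * enn2real (q \<theta>)) = q \<theta>"
      using AE_in_sphere
    proof eventually_elim
      case (elim \<theta>)
      have "q \<theta> \<le> 2 * second_moment \<mu> + 2 * second_moment \<nu>"
        unfolding q_def by (intro proj_dist2_le assms) (use elim in auto)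
      also have "\<dots> < \<infinity>" using P2_second_moment_finite[OF \<mu>] P2_second_moment_finite[OF \<nu>]
        by (auto simp: ennreal_mult_less_top less_top)
      finally show ?case using elim by (simp add: indicator_def)
    qed
  qed
  finally show ?thesis unfolding SW_def by simp
qed

section \<open>Metric properties of the sliced distance\<close>

lemma Minkowski_square:
  fixes f g :: "'a \<Rightarrow> real"
  assumes [measurable]: "f \<in> borel_measurable M" "g \<in> borel_measurable M"
    and fin: "(\<integral>\<^sup>+x. ennreal ((f x)\<^sup>2) \<partial>M) < \<infinity>" "(\<integral>\<^sup>+x. ennreal ((g x)\<^sup>2) \<partial>M) < \<infinity>"
  shows "sqrt (enn2real (\<integral>\<^sup>+x. ennreal ((f x + g x)\<^sup>2) \<partial>M)) \<le>
    sqrt (enn2real (\<integral>\<^sup>+x. ennreal ((f x)\<^sup>2) \<partial>M)) + sqrt (enn2real (\<integral>\<^sup>+x. ennreal ((g x)\<^sup>2) \<partial>M))"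
proof -
  let ?A = "\<integral>\<^sup>+x. ennreal ((f x)\<^sup>2) \<partial>M" and ?B = "\<integral>\<^sup>+x. ennreal ((g x)\<^sup>2) \<partial>M"
  let ?C = "\<integral>\<^sup>+x. ennreal \<bar>f x\<bar> * ennreal \<bar>g x\<bar> \<partial>M"
  define a where "a = enn2real ?A"
  define b where "b = enn2real ?B"
  have a: "?A = ennreal a" "0 \<le> a" using fin(1) by (simp_all add: a_def)
  have b: "?B = ennreal b" "0 \<le> b" using fin(2) by (simp_all add: b_def)
  have "?C\<^sup>2 \<le> (\<integral>\<^sup>+x. (ennreal \<bar>f x\<bar>)^2 \<partial>M) * (\<integral>\<^sup>+x. (ennreal \<bar>g x\<bar>)^2 \<partial>M)"
    by (rule Cauchy_Schwarz_nn_integral) auto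
  also have "(\<integral>\<^sup>+x. (ennreal \<bar>f x\<bar>)^2 \<partial>M) = ?A" by (simp add: ennreal_power)
  also have "(\<integral>\<^sup>+x. (ennreal \<bar>g x\<bar>)^2 \<partial>M) = ?B" by (simp add: ennreal_power)
  finally have CAB: "?C\<^sup>2 \<le> ennreal (a * b)" unfolding a(1) b(1) using a b by (simp add: ennreal_mult)
  have C: "?C \<le> ennreal (sqrt (a * b))"
  proof (cases ?C)
    case (real c)
    then have "c\<^sup>2 \<le> a * b" using CAB a b by (simp add: ennreal_power)
    then have "c \<le> sqrt (a * b)" by (rule real_le_rsqrt)
    then show ?thesis using real by (simp add: ennreal_leI)
  next
    \<comment> \<open>An infinite mixed term would have an infinite square, against the
      Cauchy-Schwarz bound \<open>CAB\<close>.\<close>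
    case top
    then show ?thesis using CAB by (simp add: power2_eq_square top_unique)
  qed
  have "(\<integral>\<^sup>+x. ennreal ((f x + g x)\<^sup>2) \<partial>M) \<le> (\<integral>\<^sup>+x. ennreal ((f x)\<^sup>2) + 2 * (ennreal \<bar>f x\<bar> * ennreal \<bar>g x\<bar>) + ennreal ((g x)\<^sup>2) \<partial>M)"
  proof (rule nn_integral_mono)
    fix x
    have "f x * g x \<le> \<bar>f x\<bar> * \<bar>g x\<bar>" by (metis abs_ge_self abs_mult)
    then have "(f x + g x)\<^sup>2 \<le> (f x)\<^sup>2 + 2 * (\<bar>f x\<bar> * \<bar>g x\<bar>) + (g x)\<^sup>2" by (simp add: power2_sum)
    then have "ennreal ((f x + g x)\<^sup>2) \<le> ennreal ((f x)\<^sup>2 + 2 * (\<bar>f x\<bar> * \<bar>g x\<bar>) + (g x)\<^sup>2)" by (rule ennreal_leI)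
    then show "ennreal ((f x + g x)\<^sup>2) \<le> ennreal ((f x)\<^sup>2) + 2 * (ennreal \<bar>f x\<bar> * ennreal \<bar>g x\<bar>) + ennreal ((g x)\<^sup>2)"
      by (simp add: ennreal_mult')
  qed
  also have "\<dots> = ?A + 2 * ?C + ?B" by (simp add: nn_integral_add nn_integral_cmult)
  also have "\<dots> \<le> ennreal a + 2 * ennreal (sqrt (a * b)) + ennreal b"
    unfolding a(1) b(1) using C by (intro add_mono mult_left_mono) auto
  also have "\<dots> = ennreal (a + 2 * sqrt (a * b) + b)" using a b by (simp add: ennreal_mult')
  also have "a + 2 * sqrt (a * b) + b = (sqrt a + sqrt b)\<^sup>2"
    using a b by (simp add: power2_sum real_sqrt_mult)
  finally have "enn2real (\<integral>\<^sup>+x. ennreal ((f x + g x)\<^sup>2) \<partial>M) \<le> (sqrt a + sqrt b)\<^sup>2"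
    by (rule enn2real_leI[rotated]) simp
  then have "sqrt (enn2real (\<integral>\<^sup>+x. ennreal ((f x + g x)\<^sup>2) \<partial>M)) \<le> sqrt a + sqrt b"
    using a b by (intro real_le_lsqrt) auto
  then show ?thesis by (simp add: a_def b_def)
qed

lemma SW_triangle:
  fixes \<mu> \<nu> \<rho> :: "'a::euclidean_space measure"
  assumes \<mu>: "\<mu> \<in> P2" and \<nu>: "\<nu> \<in> P2" and \<rho>: "\<rho> \<in> P2"
  shows "SW \<mu> \<rho> \<le> SW \<mu> \<nu> + SW \<nu> \<rho>"
proof -
  let ?M = "(sphere_measure :: 'a measure) \<Otimes>\<^sub>M unit_interval"
  have s: "sets ?M = sets (borel \<Otimes>\<^sub>M unit_interval)" by (intro sets_pair_measure_cong) auto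
  have m: "proj_quantile \<eta> \<in> borel_measurable ?M" if "\<eta> \<in> P2" for \<eta>
    using measurable_proj_quantile[OF that] by (simp add: measurable_cong_sets[OF s refl])
  let ?f = "\<lambda>p. proj_quantile \<mu> p - proj_quantile \<nu> p" and ?g = "\<lambda>p. proj_quantile \<nu> p - proj_quantile \<rho> p"
  have "sqrt (enn2real (\<integral>\<^sup>+x. ennreal ((?f x + ?g x)\<^sup>2) \<partial>?M)) \<le>
    sqrt (enn2real (\<integral>\<^sup>+x. ennreal ((?f x)\<^sup>2) \<partial>?M)) + sqrt (enn2real (\<integral>\<^sup>+x. ennreal ((?g x)\<^sup>2) \<partial>?M))"
    using SW2_finite[OF \<mu> \<nu>] SW2_finite[OF \<nu> \<rho>] unfolding SW2_eq[OF \<mu> \<nu>] SW2_eq[OF \<nu> \<rho>]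
    by (intro Minkowski_square borel_measurable_diff m assms)
  then show ?thesis
    by (simp add: SW_eq_SW2 assms SW2_eq)
qed

text \<open>Swapping coordinates yields symmetry for all measures, also outside \<open>P2\<close>,
  as \<open>Metric_space\<close> demands.\<close>

lemma couplings_swap_le:
  "(INF \<pi>\<in>couplings \<mu> \<nu>. transport_cost \<pi>) \<le>
   (INF \<pi>\<in>couplings \<nu> \<mu>. transport_cost \<pi>)"
  for \<mu> \<nu> :: "'a::euclidean_space measure"
proof (rule INF_greatest)
  fix \<pi> assume "\<pi> \<in> couplings \<nu> \<mu>"
  then have s[measurable_cong]: "sets \<pi> = sets (borel \<Otimes>\<^sub>M borel)" and d: "distr \<pi> borel fst = \<nu>" "distr \<pi> borel snd = \<mu>"
    by (auto simp: couplings_def)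
  let ?\<pi> = "distr \<pi> (borel \<Otimes>\<^sub>M borel) (\<lambda>p. (snd p, fst p))"
  have "?\<pi> \<in> couplings \<mu> \<nu>"
    using d by (auto simp: couplings_def distr_distr comp_def)
  then have "(INF \<pi>\<in>couplings \<mu> \<nu>. transport_cost \<pi>) \<le> transport_cost ?\<pi>"
    by (rule INF_lower)
  also have "\<dots> = transport_cost \<pi>"
    by (subst nn_integral_distr) (auto simp: dist_commute)
  finally show "(INF \<pi>\<in>couplings \<mu> \<nu>. transport_cost \<pi>) \<le> transport_cost \<pi>" .
qed

lemma W_commute: "W \<mu> \<nu> = W \<nu> \<mu>"
  unfolding W_def using couplings_swap_le[of \<mu> \<nu>] couplings_swap_le[of \<nu> \<mu>] by (simp add: antisym)

lemma SW_commute: "SW \<mu> \<nu> = SW \<nu> \<mu>"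
  unfolding SW_def by (simp add: W_commute)

lemma SW_nonneg: "0 \<le> SW \<mu> \<nu>"
  unfolding SW_def set_lebesgue_integral_def
  by (intro real_sqrt_ge_zero Bochner_Integration.integral_nonneg) auto

lemma SW_eq_0_imp_AE_proj_eq:
  assumes \<mu>: "\<mu> \<in> P2" and \<nu>: "\<nu> \<in> P2" and "SW \<mu> \<nu> = 0"
  shows "AE \<theta> in sphere_measure. proj_measure \<theta> \<mu> = proj_measure \<theta> \<nu>"
proof -
  have [measurable]: "proj_dist2 \<mu> \<nu> \<in> borel_measurable borel"
    by (rule measurable_proj_dist2[OF \<mu> \<nu>])
  have "SW2 \<mu> \<nu> = 0"
    using assms(3) SW2_finite[OF \<mu> \<nu>] unfolding SW_eq_SW2[OF \<mu> \<nu>] by (auto simp: enn2real_eq_0_iff)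
  then have "AE \<theta> in sphere_measure. proj_dist2 \<mu> \<nu> \<theta> = 0"
    unfolding SW2_def by (subst (asm) nn_integral_0_iff_AE) auto
  then show ?thesis
  proof eventually_elim
    case (elim \<theta>)
    note r = real_distribution_proj_measure[OF \<mu>, of \<theta>] real_distribution_proj_measure[OF \<nu>, of \<theta>]
    note [measurable] = measurable_quantile[OF r(1)] measurable_quantile[OF r(2)]
    have "AE \<omega> in unit_interval. quantile (proj_measure \<theta> \<mu>) \<omega> = quantile (proj_measure \<theta> \<nu>) \<omega>"
      using elim unfolding quantile_dist2_def by (subst (asm) nn_integral_0_iff_AE) auto
    then have "distr unit_interval borel (quantile (proj_measure \<theta> \<mu>)) = distr unit_interval borel (quantile (proj_measure \<theta> \<nu>))"
      by (intro distr_cong_AE) auto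
    then show ?case unfolding distr_quantile[OF r(1)] distr_quantile[OF r(2)] .
  qed
qed

section \<open>The Cramer-Wold theorem\<close>

text \<open>The image of \<open>w \<mu>\<close> under the inner product with \<open>k\<close>,
  normalised, is a distribution on the line, and the hypothesis equates the characteristic
  functions. For zero total weight nothing can be normalised, but then \<open>w\<close> vanishes
  almost everywhere for both measures.\<close>

lemma Levy_uniqueness_weighted:
  fixes \<mu> \<nu> :: "'a::euclidean_space measure" and w :: "'a \<Rightarrow> real"
  assumes "prob_space \<mu>" "sets \<mu> = sets borel" "prob_space \<nu>" "sets \<nu> = sets borel"
    and w[measurable]: "w \<in> borel_measurable borel" and w0: "\<And>x. 0 \<le> w x" and wC: "\<And>x. w x \<le> C"
    and eq: "\<And>t. (CLINT x|\<mu>. w x *\<^sub>R iexp (t * (x \<bullet> k))) = (CLINT x|\<nu>. w x *\<^sub>R iexp (t * (x \<bullet> k)))"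
    and B[measurable]: "B \<in> sets borel"
  shows "(LINT x|\<mu>. w x * indicat_real B (x \<bullet> k)) = (LINT x|\<nu>. w x * indicat_real B (x \<bullet> k))"
proof -
  define c where "c = (LINT x|\<mu>. w x)"
  have "of_real (LINT x|\<mu>. w x) = (of_real (LINT x|\<nu>. w x) :: complex)"
    using eq[of 0] by (simp add: scaleR_conv_of_real)
  then have c\<nu>: "c = (LINT x|\<nu>. w x)" by (simp add: c_def)
  have c0: "0 \<le> c" unfolding c_def by (intro Bochner_Integration.integral_nonneg w0)
  have int: "integrable M w" if "prob_space M" "sets M = sets borel" for M :: "'a measure"
  proof -
    interpret prob_space M by fact
    show ?thesis by (rule integrable_const_bound[of _ C]) (use w0 wC w that in \<open>auto cong: measurable_cong_sets\<close>)
  qed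
  show ?thesis
  proof (cases "c = 0")
    case True
    have "(LINT x|M. w x * indicat_real B (x \<bullet> k)) = 0"
      if M: "prob_space M" "sets M = sets borel" "(LINT x|M. w x) = 0" for M :: "'a measure"
    proof -
      have "AE x in M. w x = 0"
        using integral_nonneg_eq_0_iff_AE[OF int[OF M(1,2)]] w0 M(3) by auto
      then show ?thesis by (intro integral_eq_zero_AE) (auto elim: eventually_mono)
    qed
    from this[of \<mu>] this[of \<nu>] show ?thesis using assms(1-4) True c\<nu> by (simp add: c_def)
  next
    case False
    then have c: "c > 0" using c0 by simp
    define D where "D M = distr (density M (\<lambda>x. ennreal (w x / c))) borel (\<lambda>x. x \<bullet> k)" for M
    have D: "real_distribution (D M)"
      "char (D M) t = (CLINT x|M. w x *\<^sub>R iexp (t * (x \<bullet> k))) / c"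
      "measure (D M) B = (LINT x|M. w x * indicat_real B (x \<bullet> k)) / c"
      if M: "prob_space M" "sets M = sets borel" "(LINT x|M. w x) = c" for M :: "'a measure" and t
    proof -
      note [measurable_cong] = M(2)
      interpret prob_space "density M (\<lambda>x. ennreal (w x / c))"
      proof (rule prob_spaceI)
        have "emeasure (density M (\<lambda>x. ennreal (w x / c))) (space M) = (\<integral>\<^sup>+x. ennreal (w x / c) \<partial>M)"
          by (subst emeasure_density) (auto intro!: nn_integral_cong simp: indicator_def)
        also have "\<dots> = ennreal (LINT x|M. w x / c)"
          using int[OF M(1,2)] w0 c by (intro nn_integral_eq_integral) auto
        also have "\<dots> = 1" using c M(3) by simp
        finally show "emeasure (density M (\<lambda>x. ennreal (w x / c))) (space (density M (\<lambda>x. ennreal (w x / c)))) = 1" by simp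
      qed
      show rd: "real_distribution (D M)" unfolding D_def by (rule real_distribution_distr) simp
      have "char (D M) t = (CLINT x|M. (w x / c) *\<^sub>R iexp (t * (x \<bullet> k)))"
        unfolding char_def D_def using w0 c by (simp add: integral_distr integral_density)
      also have "\<dots> = (CLINT x|M. (w x *\<^sub>R iexp (t * (x \<bullet> k))) / c)"
        by (intro Bochner_Integration.integral_cong) (auto simp: scaleR_conv_of_real)
      finally show "char (D M) t = (CLINT x|M. w x *\<^sub>R iexp (t * (x \<bullet> k))) / c" by simp
      have "measure (D M) B = (LINT x|D M. indicat_real B x)"
        using rd by (simp add: real_distribution.space_eq_univ D_def)
      also have "\<dots> = (LINT x|M. (w x / c) *\<^sub>R indicat_real B (x \<bullet> k))"
        unfolding D_def by (subst integral_distr, simp, simp, subst integral_density) (use w0 c in auto)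
      finally show "measure (D M) B = (LINT x|M. w x * indicat_real B (x \<bullet> k)) / c" by simp
    qed
    have "D \<mu> = D \<nu>"
      using D[OF assms(1,2) c_def[symmetric]] D[OF assms(3,4) c\<nu>[symmetric]] eq
      by (intro Levy_uniqueness ext) auto
    then show ?thesis
      using D(3)[OF assms(1,2) c_def[symmetric]] D(3)[OF assms(3,4) c\<nu>[symmetric]] c by simp
  qed
qed

text \<open>Induction over the coordinates: each step adds one indicator by Levy's theorem on the
  line, while the frequency \<open>\<xi>\<close> stays arbitrary for the next step. Levy's theorem
  needs a nonnegative weight, so the exponential is split into cosine and sine, each raised by
  1.\<close>

lemma char_eq_imp_box_char_eq:
  fixes \<mu> \<nu> :: "'a::euclidean_space measure" and B :: "'a \<Rightarrow> real set"
  assumes \<mu>: "prob_space \<mu>" "sets \<mu> = sets borel" and \<nu>: "prob_space \<nu>" "sets \<nu> = sets borel"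
    and eq: "\<And>\<xi>. (CLINT x|\<mu>. iexp (x \<bullet> \<xi>)) = (CLINT x|\<nu>. iexp (x \<bullet> \<xi>))"
    and B[measurable]: "\<And>b. B b \<in> sets borel" and "finite S"
  shows "(CLINT x|\<mu>. (\<Prod>b\<in>S. indicat_real (B b) (x \<bullet> b)) *\<^sub>R iexp (x \<bullet> \<xi>)) =
     (CLINT x|\<nu>. (\<Prod>b\<in>S. indicat_real (B b) (x \<bullet> b)) *\<^sub>R iexp (x \<bullet> \<xi>))"
  using \<open>finite S\<close>
proof (induction S arbitrary: \<xi>)
  case empty
  then show ?case using eq by simp
next
  case (insert k S)
  define H where "H x = (\<Prod>b\<in>S. indicat_real (B b) (x \<bullet> b))" for x
  have H[measurable]: "H \<in> borel_measurable borel" unfolding H_def by measurable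
  have H0: "0 \<le> H x" and H1: "H x \<le> 1" for x
    unfolding H_def by (auto intro!: prod_nonneg prod_le_1 simp: indicator_def)
  have IH: "(CLINT x|\<mu>. H x *\<^sub>R iexp (x \<bullet> \<xi>)) = (CLINT x|\<nu>. H x *\<^sub>R iexp (x \<bullet> \<xi>))" for \<xi>
    using insert.IH[of \<xi>] by (simp add: H_def)
  have intc: "integrable M (\<lambda>x. H x *\<^sub>R iexp (f x))"
    if M: "prob_space M" "sets M = sets borel" and [measurable]: "f \<in> borel_measurable borel" for M :: "'a measure" and f :: "'a \<Rightarrow> real"
  proof -
    interpret prob_space M by fact
    note [measurable_cong] = M(2)
    show ?thesis by (rule integrable_const_bound[of _ 1]) (use H0 H1 in \<open>auto simp: norm_mult\<close>)
  qed
  have lin: "(CLINT x|M. g0 x + c1 * g1 x + c2 * g2 x) = (CLINT x|M. g0 x) + c1 * (CLINT x|M. g1 x) + c2 * (CLINT x|M. g2 x)"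
    if "integrable M g0" "integrable M g1" "integrable M g2" for M :: "'a measure" and g0 g1 g2 :: "'a \<Rightarrow> complex" and c1 c2
    using that by simp
  have in1: "t * (x \<bullet> k) = x \<bullet> (t *\<^sub>R k)" for t x by simp
  let ?B = "\<lambda>x. indicat_real (B k) (x \<bullet> k)"
  have f0: "(LINT x|\<mu>. H x * ?B x) = (LINT x|\<nu>. H x * ?B x)"
    by (rule Levy_uniqueness_weighted[OF \<mu> \<nu> H H0 H1 _ B]) (simp only: in1 IH)
  have int: "integrable M (\<lambda>x. H x * T (x \<bullet> \<xi>) * ?B x)"
    if M: "prob_space M" "sets M = sets borel" and [measurable]: "T \<in> borel_measurable borel" and T: "\<And>a. \<bar>T a\<bar> \<le> 1"
    for M :: "'a measure" and T :: "real \<Rightarrow> real"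
  proof -
    interpret prob_space M by fact
    note [measurable_cong] = M(2)
    show ?thesis
    proof (rule integrable_const_bound[of _ 1])
      have "\<bar>H x * T (x \<bullet> \<xi>) * ?B x\<bar> \<le> 1 * 1 * 1" for x
        unfolding abs_mult using H0[of x] H1[of x] T by (intro mult_mono) (auto simp: indicator_def)
      then show "AE x in M. norm (H x * T (x \<bullet> \<xi>) * ?B x) \<le> 1" by simp
    qed measurable
  qed
  \<comment> \<open>As \<open>T\<close> is a combination of \<open>iexp a\<close> and
    \<open>iexp (- a)\<close>, it merely shifts the frequency \<open>t *\<^sub>R k\<close> by
    \<open>\<xi>\<close> in either direction, and the induction hypothesis covers all
    frequencies.\<close>
  have trig: "(LINT x|\<mu>. H x * T (x \<bullet> \<xi>) * ?B x) = (LINT x|\<nu>. H x * T (x \<bullet> \<xi>) * ?B x)"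
    if Tm[measurable]: "T \<in> borel_measurable borel" and T: "\<And>a. \<bar>T a\<bar> \<le> 1"
      and pq: "\<And>a. of_real (T a) = p * iexp a + q * iexp (- a)" for T :: "real \<Rightarrow> real" and p q :: complex
  proof -
    have T2: "0 \<le> 1 + T a" "1 + T a \<le> 2" for a using T[of a] by linarith+
    have id: "(H x * (1 + T a)) *\<^sub>R iexp b = H x *\<^sub>R iexp b + p * (H x *\<^sub>R iexp (b + a)) + q * (H x *\<^sub>R iexp (b - a))" for x and a b :: real
    proof -
      have "iexp (b + a) = iexp b * iexp a" "iexp (b - a) = iexp b * iexp (- a)"
        by (simp_all add: exp_add[symmetric] algebra_simps)
      moreover have "h * (1 + (p * u + q * v)) * e = h * e + p * (h * (e * u)) + q * (h * (e * v))" for h e u v :: complex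
        by (simp add: algebra_simps)
      ultimately show ?thesis by (simp only: scaleR_conv_of_real of_real_mult of_real_add of_real_1 pq)
    qed
    \<comment> \<open>The weight now lies between 0 and 2. The share of \<open>H\<close> alone is
      known from \<open>f0\<close> and is subtracted afterwards.\<close>
    have "(LINT x|\<mu>. (H x * (1 + T (x \<bullet> \<xi>))) * ?B x) = (LINT x|\<nu>. (H x * (1 + T (x \<bullet> \<xi>))) * ?B x)"
    proof (rule Levy_uniqueness_weighted[OF \<mu> \<nu> _ _ _ _ B])
      show "0 \<le> H x * (1 + T (x \<bullet> \<xi>))" for x by (intro mult_nonneg_nonneg H0 T2)
      show "H x * (1 + T (x \<bullet> \<xi>)) \<le> 1 * 2" for x by (intro mult_mono H1 T2) simp_all
      have "(CLINT x|M. (H x * (1 + T (x \<bullet> \<xi>))) *\<^sub>R iexp (t * (x \<bullet> k))) = (CLINT x|M. H x *\<^sub>R iexp (x \<bullet> (t *\<^sub>R k)))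
         + p * (CLINT x|M. H x *\<^sub>R iexp (x \<bullet> (t *\<^sub>R k + \<xi>))) + q * (CLINT x|M. H x *\<^sub>R iexp (x \<bullet> (t *\<^sub>R k - \<xi>)))"
        if M: "prob_space M" "sets M = sets borel" for M t
        unfolding id in1 inner_add_right[symmetric] inner_diff_right[symmetric] by (rule lin) (rule intc[OF M], measurable)+
      from this[OF \<mu>] this[OF \<nu>]
      show "(CLINT x|\<mu>. (H x * (1 + T (x \<bullet> \<xi>))) *\<^sub>R iexp (t * (x \<bullet> k))) = (CLINT x|\<nu>. (H x * (1 + T (x \<bullet> \<xi>))) *\<^sub>R iexp (t * (x \<bullet> k)))" for t
        by (simp only: IH)
    qed measurable
    moreover have "(LINT x|M. (H x * (1 + T (x \<bullet> \<xi>))) * ?B x) = (LINT x|M. H x * ?B x) + (LINT x|M. H x * T (x \<bullet> \<xi>) * ?B x)"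
      if M: "prob_space M" "sets M = sets borel" for M
      using int[OF M, of "\<lambda>_. 1"] int[OF M Tm T] by (simp add: distrib_left distrib_right)
    ultimately show ?thesis using f0 \<mu> \<nu> by simp
  qed
  have cos: "(LINT x|\<mu>. H x * cos (x \<bullet> \<xi>) * ?B x) = (LINT x|\<nu>. H x * cos (x \<bullet> \<xi>) * ?B x)"
    by (rule trig[of cos "1/2" "1/2"]) (auto simp: cos_of_real[symmetric] cos_exp_eq)
  have sin: "(LINT x|\<mu>. H x * sin (x \<bullet> \<xi>) * ?B x) = (LINT x|\<nu>. H x * sin (x \<bullet> \<xi>) * ?B x)"
    by (rule trig[of sin "- \<i>/2" "\<i>/2"]) (simp_all only: cis_conv_exp[symmetric], auto simp: complex_eq_iff)
  have "(CLINT x|M. (\<Prod>b\<in>insert k S. indicat_real (B b) (x \<bullet> b)) *\<^sub>R iexp (x \<bullet> \<xi>)) =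
      Complex (LINT x|M. H x * cos (x \<bullet> \<xi>) * ?B x) (LINT x|M. H x * sin (x \<bullet> \<xi>) * ?B x)"
    if M: "prob_space M" "sets M = sets borel" for M :: "'a measure"
  proof -
    interpret prob_space M by fact
    note [measurable_cong] = M(2)
    have P: "(\<Prod>b\<in>insert k S. indicat_real (B b) (x \<bullet> b)) = ?B x * H x" for x
      using insert.hyps by (simp add: H_def)
    have i: "complex_integrable M (\<lambda>x. (?B x * H x) *\<^sub>R iexp (x \<bullet> \<xi>))"
      by (rule integrable_const_bound[of _ 1])
         (use H0 H1 in \<open>auto simp: norm_mult indicator_def\<close>)
    have "Re (CLINT x|M. (?B x * H x) *\<^sub>R iexp (x \<bullet> \<xi>)) = (LINT x|M. Re ((?B x * H x) *\<^sub>R iexp (x \<bullet> \<xi>)))"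
      "Im (CLINT x|M. (?B x * H x) *\<^sub>R iexp (x \<bullet> \<xi>)) = (LINT x|M. Im ((?B x * H x) *\<^sub>R iexp (x \<bullet> \<xi>)))"
      by (rule integral_Re[OF i, symmetric], rule integral_Im[OF i, symmetric])
    then show ?thesis
      unfolding P by (intro complex_eqI) (simp_all only: complex.sel scaleR_complex.sel Re_exp Im_exp, simp_all add: mult_ac)
  qed
  from this[OF \<mu>] this[OF \<nu>] show ?case by (simp only: cos sin)
qed

theorem measure_eqI_char:
  fixes \<mu> \<nu> :: "'a::euclidean_space measure"
  assumes \<mu>: "prob_space \<mu>" "sets \<mu> = sets borel" and \<nu>: "prob_space \<nu>" "sets \<nu> = sets borel"
    and eq: "\<And>\<xi>. (CLINT x|\<mu>. iexp (x \<bullet> \<xi>)) = (CLINT x|\<nu>. iexp (x \<bullet> \<xi>))"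
  shows "\<mu> = \<nu>"
proof -
  interpret M: prob_space \<mu> by fact
  interpret N: prob_space \<nu> by fact
  have box: "measure M (box a b) = Re (CLINT x|M. (\<Prod>i\<in>Basis. indicat_real {a \<bullet> i<..<b \<bullet> i} (x \<bullet> i)) *\<^sub>R iexp (x \<bullet> 0))"
    if M: "prob_space M" "sets M = sets borel" for M :: "'a measure" and a b
  proof -
    interpret prob_space M by fact
    have sp: "space M = UNIV" using sets_eq_imp_space_eq[OF M(2)] by simp
    have "(\<Prod>i\<in>Basis. indicat_real {a \<bullet> i<..<b \<bullet> i} (x \<bullet> i)) = indicat_real (box a b) x" for x
    proof (cases "x \<in> box a b")
      case True
      then show ?thesis by (auto simp: indicator_def mem_box intro!: prod.neutral)
    next
      case False
      then obtain i where "i \<in> Basis" "x \<bullet> i \<notin> {a \<bullet> i<..<b \<bullet> i}" by (auto simp: mem_box)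
      then show ?thesis using False by (auto simp: indicator_def intro!: prod_zero)
    qed
    then have "(CLINT x|M. (\<Prod>i\<in>Basis. indicat_real {a \<bullet> i<..<b \<bullet> i} (x \<bullet> i)) *\<^sub>R iexp (x \<bullet> 0)) = (CLINT x|M. of_real (indicat_real (box a b) x))"
      by (simp add: scaleR_conv_of_real)
    also have "\<dots> = of_real (measure M (box a b))"
      unfolding integral_complex_of_real using M(2) sp by simp
    finally show ?thesis by simp
  qed
  show ?thesis
  proof (rule measure_eqI_generator_eq[where \<Omega>=UNIV and E="range (\<lambda>(a, b). box a b)" and A="\<lambda>n. box (- (real n *\<^sub>R One)) (real n *\<^sub>R One)"])
    show "Int_stable (range (\<lambda>(a, b). box a b :: 'a set))"
      by (auto simp: Int_stable_def box_Int_box)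
    show "sets \<mu> = sigma_sets UNIV (range (\<lambda>(a, b). box a b))" "sets \<nu> = sigma_sets UNIV (range (\<lambda>(a, b). box a b))"
      using \<mu>(2) \<nu>(2) by (simp_all add: borel_eq_box)
    show "emeasure \<mu> X = emeasure \<nu> X" if "X \<in> range (\<lambda>(a, b). box a b)" for X
    proof -
      from that obtain a b where X: "X = box a b" by auto
      have "(CLINT x|\<mu>. (\<Prod>i\<in>Basis. indicat_real {a \<bullet> i<..<b \<bullet> i} (x \<bullet> i)) *\<^sub>R iexp (x \<bullet> 0)) =
        (CLINT x|\<nu>. (\<Prod>i\<in>Basis. indicat_real {a \<bullet> i<..<b \<bullet> i} (x \<bullet> i)) *\<^sub>R iexp (x \<bullet> 0))"
        by (rule char_eq_imp_box_char_eq[OF \<mu> \<nu> eq]) auto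
      then have "measure \<mu> X = measure \<nu> X" unfolding X by (simp only: box[OF \<mu>] box[OF \<nu>])
      then show ?thesis by (simp add: M.emeasure_eq_measure N.emeasure_eq_measure)
    qed
    show "(\<Union>n. box (- (real n *\<^sub>R One)) (real n *\<^sub>R One)) = (UNIV :: 'a set)" by (rule UN_box_eq_UNIV)
  qed auto
qed

lemma continuous_char:
  fixes \<mu> :: "'a::euclidean_space measure"
  assumes \<mu>: "prob_space \<mu>" "sets \<mu> = sets borel"
  shows "continuous_on UNIV (\<lambda>\<xi>. CLINT x|\<mu>. iexp (x \<bullet> \<xi>))"
proof (rule continuous_on_sequentiallyI)
  interpret prob_space \<mu> by fact
  note [measurable_cong] = \<mu>(2)
  fix u :: "nat \<Rightarrow> 'a" and a assume u: "u \<longlonglongrightarrow> a"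
  show "(\<lambda>n. CLINT x|\<mu>. iexp (x \<bullet> u n)) \<longlonglongrightarrow> (CLINT x|\<mu>. iexp (x \<bullet> a))"
  proof (rule integral_dominated_convergence[where w="\<lambda>_. 1"])
    show "AE x in \<mu>. (\<lambda>n. iexp (x \<bullet> u n)) \<longlonglongrightarrow> iexp (x \<bullet> a)"
      using u by (intro AE_I2 tendsto_intros)
  qed auto
qed

text \<open>Along a ray, the characteristic function is that of a projection, so the two functions
  agree on almost every ray. Where they differ is an open set by continuity; being null as well, it
  is empty.\<close>

theorem Cramer_Wold:
  fixes \<mu> \<nu> :: "'a::euclidean_space measure"
  assumes \<mu>: "prob_space \<mu>" "sets \<mu> = sets borel" and \<nu>: "prob_space \<nu>" "sets \<nu> = sets borel"
    and ae: "AE \<theta> in sphere_measure. proj_measure \<theta> \<mu> = proj_measure \<theta> \<nu>"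
  shows "\<mu> = \<nu>"
proof (rule measure_eqI_char[OF \<mu> \<nu>])
  fix \<xi> :: 'a
  define \<phi> where "\<phi> M \<xi> = (CLINT x|M. iexp (x \<bullet> \<xi>))" for M and \<xi> :: 'a
  \<comment> \<open>The scaling brings the given frequency into the open unit ball, where the null
    sets of directions are available.\<close>
  define c where "c = norm \<xi> + 1"
  have c: "c > 0" unfolding c_def by (smt (verit) norm_ge_zero)
  have ch: "\<phi> M (t *\<^sub>R \<theta>) = char (proj_measure \<theta> M) t" if "sets M = sets borel" for M :: "'a measure" and t \<theta>
  proof -
    note [measurable_cong] = that
    show ?thesis unfolding \<phi>_def char_def proj_measure_def by (subst integral_distr) auto
  qed
  have "AE y in lborel. y \<in> ball (0::'a) 1 \<longrightarrow> \<phi> \<mu> (c *\<^sub>R y) = \<phi> \<nu> (c *\<^sub>R y)"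
    using AE_sphere_measureD[OF ae]
  proof eventually_elim
    case (elim y)
    have "y = norm y *\<^sub>R sgn y" by (cases "y = 0") (simp_all add: sgn_div_norm)
    then have cy: "c *\<^sub>R y = (c * norm y) *\<^sub>R sgn y" by (metis scaleR_scaleR)
    show ?case unfolding cy ch[OF \<mu>(2)] ch[OF \<nu>(2)] using elim by simp
  qed
  then have AE: "AE y in lebesgue. y \<notin> {y \<in> ball (0::'a) 1. \<phi> \<mu> (c *\<^sub>R y) \<noteq> \<phi> \<nu> (c *\<^sub>R y)}"
    by (intro AE_completion) auto
  let ?N = "{y \<in> ball (0::'a) 1. \<phi> \<mu> (c *\<^sub>R y) \<noteq> \<phi> \<nu> (c *\<^sub>R y)}"
  have "continuous_on UNIV (\<lambda>y. \<phi> \<mu> (c *\<^sub>R y) - \<phi> \<nu> (c *\<^sub>R y))"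
    unfolding \<phi>_def
    by (intro continuous_on_diff continuous_on_compose2[OF continuous_char[OF \<mu>]] continuous_on_compose2[OF continuous_char[OF \<nu>]] continuous_intros) auto
  then have "open ((\<lambda>y. \<phi> \<mu> (c *\<^sub>R y) - \<phi> \<nu> (c *\<^sub>R y)) -` (- {0}))"
    by (rule open_vimage[rotated]) auto
  then have "open (ball 0 1 \<inter> ((\<lambda>y. \<phi> \<mu> (c *\<^sub>R y) - \<phi> \<nu> (c *\<^sub>R y)) -` (- {0})))" by auto
  also have "ball 0 1 \<inter> ((\<lambda>y. \<phi> \<mu> (c *\<^sub>R y) - \<phi> \<nu> (c *\<^sub>R y)) -` (- {0})) = ?N" by auto
  finally have "open ?N" .
  moreover have "negligible ?N"
    using AE unfolding negligible_iff_null_sets completion.null_sets_iff_AE by auto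
  ultimately have "?N = {}" using open_not_negligible by blast
  moreover have "(1 / c) *\<^sub>R \<xi> \<in> ball 0 1" using c by (simp add: c_def)
  ultimately have "\<phi> \<mu> (c *\<^sub>R ((1 / c) *\<^sub>R \<xi>)) = \<phi> \<nu> (c *\<^sub>R ((1 / c) *\<^sub>R \<xi>))" by blast
  then show "(CLINT x|\<mu>. iexp (x \<bullet> \<xi>)) = (CLINT x|\<nu>. iexp (x \<bullet> \<xi>))"
    using c by (simp add: \<phi>_def)
qed

section \<open>Narrow compactness\<close>

lemma summable_ternary:
  fixes c :: "nat \<Rightarrow> real"
  assumes "\<And>j. \<bar>c j\<bar> \<le> 1"
  shows "summable (\<lambda>j. c j / 3 ^ Suc j)"
proof (rule summable_comparison_test[of _ "\<lambda>j. (1/3) ^ Suc j"])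
  show "\<exists>N. \<forall>n\<ge>N. norm (c n / 3 ^ Suc n) \<le> (1/3) ^ Suc n"
    using assms by (auto simp: power_one_over divide_right_mono intro!: exI[of _ 0] divide_right_mono)
  show "summable (\<lambda>j. (1/3 :: real) ^ Suc j)"
    using summable_mult[OF summable_geometric[of "1/3::real"], of "1/3"] by simp
qed

text \<open>In base 3 the terms after the first nonzero one add up to at most half of it. In base 2
  they could cancel it completely, which is why binary digits are placed in base 3.\<close>

lemma ternary_gap:
  fixes c :: "nat \<Rightarrow> real"
  assumes c: "\<And>j. \<bar>c j\<bar> \<le> 1" and z: "\<And>j. j < k \<Longrightarrow> c j = 0" and k: "\<bar>c k\<bar> = 1"
  shows "1 / (2 * 3 ^ Suc k) \<le> \<bar>\<Sum>j. c j / 3 ^ Suc j\<bar>"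
proof -
  let ?f = "\<lambda>j. c j / 3 ^ Suc j"
  have sf: "summable ?f" by (rule summable_ternary[OF c])
  have "suminf ?f = (\<Sum>n. ?f (n + Suc k)) + sum ?f {..<Suc k}"
    by (rule suminf_split_initial_segment[OF sf])
  also have "sum ?f {..<Suc k} = ?f k" using z by simp
  finally have s: "suminf ?f = (\<Sum>n. ?f (n + Suc k)) + ?f k" .
  have geo: "(\<lambda>n. (1/3 :: real) ^ n * (1 / 3 ^ (k + 2))) sums (1 / (1 - 1/3) * (1 / 3 ^ (k + 2)))"
    by (intro sums_mult2 geometric_sums) simp
  have le: "norm (?f (n + Suc k)) \<le> (1/3) ^ n * (1 / 3 ^ (k + 2))" for n
  proof -
    have "norm (?f (n + Suc k)) = \<bar>c (n + Suc k)\<bar> / 3 ^ (n + (k + 2))" by (simp add: abs_divide)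
    also have "\<dots> \<le> 1 / 3 ^ (n + (k + 2))" by (intro divide_right_mono c) simp
    also have "\<dots> = (1/3) ^ n * (1 / 3 ^ (k + 2))" by (simp add: power_add power_one_over)
    finally show ?thesis .
  qed
  have "\<bar>\<Sum>n. ?f (n + Suc k)\<bar> \<le> (\<Sum>n. (1/3) ^ n * (1 / 3 ^ (k + 2)))"
    using norm_suminf_le[OF le sums_summable[OF geo]] by simp
  also have "\<dots> = 1 / (1 - 1/3) * (1 / 3 ^ (k + 2))" using geo by (rule sums_unique[symmetric])
  also have "\<dots> = 1 / (2 * 3 ^ Suc k)" by simp
  finally have tail: "\<bar>\<Sum>n. ?f (n + Suc k)\<bar> \<le> 1 / (2 * 3 ^ Suc k)" .
  have "\<bar>?f k\<bar> = 2 * (1 / (2 * 3 ^ Suc k))" using k by (simp add: abs_divide)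
  then show ?thesis using tail unfolding s by linarith
qed

definition bin_digit :: "nat \<Rightarrow> real \<Rightarrow> real" where
  "bin_digit j y = of_int (\<lfloor>2 ^ Suc j * y\<rfloor> mod 2)"

lemma bin_digit_cases: "bin_digit j y = 0 \<or> bin_digit j y = 1"
  unfolding bin_digit_def by auto

text \<open>Each further digit is the remainder of the next floor modulo 2, so common digits force
  \<open>2 ^ m * y\<close> and \<open>2 ^ m * z\<close> to have the same floor.\<close>

lemma bin_digits_eq_imp_close:
  assumes "0 \<le> y" "y < 1" "0 \<le> z" "z < 1" and eq: "\<And>j. j < m \<Longrightarrow> bin_digit j y = bin_digit j z"
  shows "\<bar>y - z\<bar> \<le> 1 / 2 ^ m"
proof -
  have "\<lfloor>2 ^ m * y\<rfloor> = \<lfloor>2 ^ m * z\<rfloor>" using eq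
  proof (induction m)
    case 0
    have "\<lfloor>y\<rfloor> = 0" "\<lfloor>z\<rfloor> = 0" using assms by (simp_all add: floor_eq_iff)
    then show ?case by simp
  next
    case (Suc m)
    have d: "\<lfloor>2 ^ Suc m * w\<rfloor> = 2 * \<lfloor>2 ^ m * w\<rfloor> + \<lfloor>2 ^ Suc m * w\<rfloor> mod 2" for w :: real
    proof -
      have "\<lfloor>2 ^ Suc m * w\<rfloor> div 2 = \<lfloor>2 ^ m * w\<rfloor>"
        using floor_divide_real_eq_div[of 2 "2 ^ Suc m * w"] by simp
      then show ?thesis using mult_div_mod_eq[of 2 "\<lfloor>2 ^ Suc m * w\<rfloor>"] by simp
    qed
    have "\<lfloor>2 ^ Suc m * y\<rfloor> mod 2 = \<lfloor>2 ^ Suc m * z\<rfloor> mod 2"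
      using Suc.prems[of m] by (simp add: bin_digit_def)
    then show ?case using d[of y] d[of z] Suc.IH Suc.prems by simp
  qed
  then have "\<bar>2 ^ m * y - 2 ^ m * z\<bar> < 1" by linarith
  then have "2 ^ m * \<bar>y - z\<bar> < 1" by (simp add: right_diff_distrib[symmetric] abs_mult)
  then show ?thesis by (simp add: pos_le_divide_eq mult.commute)
qed

section \<open>Coding vectors by real numbers\<close>

definition compress :: "'a::real_normed_vector \<Rightarrow> 'a" where
  "compress x = (1 / (1 + norm x)) *\<^sub>R x"

definition decompress :: "'a::real_normed_vector \<Rightarrow> 'a" where
  "decompress y = (1 / (1 - norm y)) *\<^sub>R y"

lemma one_plus_norm_pos: "0 < 1 + norm x"
  by (smt (verit) norm_ge_zero)

lemma norm_compress: "norm (compress x) = norm x / (1 + norm x)"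
  using one_plus_norm_pos[of x] by (simp add: compress_def)

lemma norm_compress_less: "norm (compress x) < 1"
  using one_plus_norm_pos[of x] by (simp add: norm_compress)

lemma decompress_compress: "decompress (compress x) = x"
proof -
  have "1 - norm (compress x) = 1 / (1 + norm x)"
    using one_plus_norm_pos[of x] by (simp add: norm_compress field_simps)
  then show ?thesis using one_plus_norm_pos[of x] by (simp add: decompress_def compress_def)
qed

lemma measurable_compress[measurable]: "(compress :: 'a::euclidean_space \<Rightarrow> 'a) \<in> borel_measurable borel"
  unfolding compress_def[abs_def] by measurable

text \<open>The code interleaves the binary digits of all coordinates into one base-3 expansion.
  As only the digits 0 and 1 occur, close codes have many common digits.\<close>

definition coord_digit :: "nat \<Rightarrow> 'a::euclidean_space \<Rightarrow> real" where
  "coord_digit k x = bin_digit (snd (prod_decode k)) ((1 + x \<bullet> from_nat_into Basis (fst (prod_decode k))) / 2)"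

definition digit_code :: "'a::euclidean_space \<Rightarrow> real" where
  "digit_code x = (\<Sum>k. coord_digit k x / 3 ^ Suc k)"

lemma coord_digit_cases: "coord_digit k x = 0 \<or> coord_digit k x = 1"
  unfolding coord_digit_def by (rule bin_digit_cases)

lemma measurable_digit_code[measurable]: "(digit_code :: 'a::euclidean_space \<Rightarrow> real) \<in> borel_measurable borel"
  unfolding digit_code_def[abs_def] coord_digit_def[abs_def] bin_digit_def[abs_def] by measurable

lemma summable_digit_code: "summable (\<lambda>k. coord_digit k x / 3 ^ Suc k)"
  by (rule summable_ternary) (use coord_digit_cases[of _ x] in \<open>smt (verit)\<close>)

lemma digit_code_bounds: "0 \<le> digit_code x" "digit_code x \<le> 1"
proof -
  have b: "0 \<le> coord_digit k x" "coord_digit k x \<le> 1" for k using coord_digit_cases[of k x] by auto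
  show "0 \<le> digit_code x" unfolding digit_code_def by (intro suminf_nonneg summable_digit_code) (simp add: b)
  have g: "(\<lambda>k. (1/2 :: real) ^ Suc k) sums 1" by (rule power_half_series)
  have "coord_digit k x / 3 ^ Suc k \<le> (1/2) ^ Suc k" for k
    unfolding power_one_over by (intro frac_le power_mono b) simp_all
  then have "digit_code x \<le> (\<Sum>k. (1/2) ^ Suc k)"
    unfolding digit_code_def by (intro suminf_le summable_digit_code sums_summable[OF g])
  then show "digit_code x \<le> 1" unfolding sums_unique[OF g, symmetric] .
qed

text \<open>A first disagreement at a position below \<open>n\<close> would separate the codes by
  the gap of \<open>ternary_gap\<close>.\<close>

lemma digit_code_close_imp_digits_eq:
  assumes "\<bar>digit_code x - digit_code y\<bar> < 1 / (2 * 3 ^ n)" "k < n"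
  shows "coord_digit k x = coord_digit k y"
proof (rule ccontr)
  assume ne: "coord_digit k x \<noteq> coord_digit k y"
  define i where "i = (LEAST k. coord_digit k x \<noteq> coord_digit k y)"
  have i: "coord_digit i x \<noteq> coord_digit i y" unfolding i_def by (rule LeastI[of _ k]) (rule ne)
  have less: "coord_digit j x = coord_digit j y" if "j < i" for j using not_less_Least that unfolding i_def by blast
  have ik: "i \<le> k" unfolding i_def by (rule Least_le) (rule ne)
  have "1 / (2 * 3 ^ Suc i) \<le> \<bar>\<Sum>j. (coord_digit j x - coord_digit j y) / 3 ^ Suc j\<bar>"
  proof (rule ternary_gap)
    show "\<bar>coord_digit j x - coord_digit j y\<bar> \<le> 1" for j using coord_digit_cases[of j x] coord_digit_cases[of j y] by auto
    show "coord_digit j x - coord_digit j y = 0" if "j < i" for j using less[OF that] by simp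
    show "\<bar>coord_digit i x - coord_digit i y\<bar> = 1" using i coord_digit_cases[of i x] coord_digit_cases[of i y] by auto
  qed
  also have "(\<Sum>j. (coord_digit j x - coord_digit j y) / 3 ^ Suc j) = digit_code x - digit_code y"
    unfolding digit_code_def diff_divide_distrib by (rule suminf_diff[symmetric]) (rule summable_digit_code)+
  finally have "1 / (2 * 3 ^ Suc i) < (1 :: real) / (2 * 3 ^ n)" using assms(1) by linarith
  moreover have "(1::real) / (2 * 3 ^ n) \<le> 1 / (2 * 3 ^ Suc i)"
  proof -
    have "(3::real) ^ Suc i \<le> 3 ^ n" using ik assms(2) by (intro power_increasing) auto
    then show ?thesis by (intro divide_left_mono mult_left_mono mult_pos_pos) auto
  qed
  ultimately show False by simp
qed

text \<open>This is uniform continuity of decoding, and it contains injectivity. The code itself may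
  jump where a binary digit does.\<close>

lemma digit_code_uniform:
  fixes e :: real
  assumes "0 < e"
  shows "\<exists>d>0. \<forall>x y :: 'a::euclidean_space. norm x < 1 \<longrightarrow> norm y < 1 \<longrightarrow>
    \<bar>digit_code x - digit_code y\<bar> < d \<longrightarrow> dist x y < e"
proof -
  \<comment> \<open>The digits belong to \<open>(1 + x \<bullet> b) / 2\<close>, so \<open>m\<close>
    common ones bound a coordinate difference by \<open>2 / 2 ^ m\<close>; summing over the basis
    gives less than \<open>e\<close>.\<close>
  obtain m where m: "1 / 2 ^ m < e / (2 * real DIM('a))"
    using real_arch_pow_inv[of "e / (2 * real DIM('a))" "1/2"] assms by (auto simp: power_one_over)
  define idx where "idx = to_nat_on (Basis :: 'a set)"
  have idx: "from_nat_into Basis (idx b) = b" if "b \<in> Basis" for b :: 'a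
    unfolding idx_def using that by (simp add: countable_finite)
  \<comment> \<open>Past this position, the first \<open>m\<close> digits of every coordinate have
    occurred.\<close>
  define N where "N = Suc (Max ((\<lambda>(b, j). prod_encode (idx b, j)) ` ((Basis :: 'a set) \<times> {..m})))"
  have N: "prod_encode (idx b, j) < N" if "b \<in> Basis" "j < m" for b :: 'a and j
    unfolding N_def using that by (intro le_imp_less_Suc Max_ge) auto
  show ?thesis
  proof (intro exI[of _ "1 / (2 * 3 ^ N)"] conjI allI impI)
    fix x y :: 'a assume xy: "norm x < 1" "norm y < 1" and close: "\<bar>digit_code x - digit_code y\<bar> < 1 / (2 * 3 ^ N)"
    have "\<bar>(x - y) \<bullet> b\<bar> \<le> 2 * (1 / 2 ^ m)" if b: "b \<in> Basis" for b
    proof -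
      have "\<bar>x \<bullet> b\<bar> < 1" "\<bar>y \<bullet> b\<bar> < 1" using Basis_le_norm[OF b, of x] Basis_le_norm[OF b, of y] xy by auto
      then have "\<bar>(1 + x \<bullet> b) / 2 - (1 + y \<bullet> b) / 2\<bar> \<le> 1 / 2 ^ m"
      proof (intro bin_digits_eq_imp_close)
        fix j assume j: "j < m"
        have "coord_digit (prod_encode (idx b, j)) x = coord_digit (prod_encode (idx b, j)) y"
          by (rule digit_code_close_imp_digits_eq[OF close N[OF b j]])
        then show "bin_digit j ((1 + x \<bullet> b) / 2) = bin_digit j ((1 + y \<bullet> b) / 2)"
          by (simp add: coord_digit_def idx[OF b])
      qed auto
      moreover have "(1 + x \<bullet> b) / 2 - (1 + y \<bullet> b) / 2 = ((x - y) \<bullet> b) / 2"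
        by (simp add: inner_diff_left diff_divide_distrib[symmetric])
      ultimately show ?thesis by (simp add: abs_divide)
    qed
    then have "(\<Sum>b\<in>Basis. \<bar>(x - y) \<bullet> b\<bar>) \<le> real DIM('a) * (2 * (1 / 2 ^ m))"
      by (intro sum_bounded_above)
    moreover have "real DIM('a) * (2 * (1 / 2 ^ m)) < e"
      using m by (simp add: pos_less_divide_eq algebra_simps)
    ultimately show "dist x y < e"
      unfolding dist_norm using norm_le_l1[of "x - y"] by linarith
  qed simp
qed

text \<open>A weak limit of code distributions may charge limits of codes that are no codes
  themselves, so decoding is wanted on the whole line. Uniform continuity extends it to the closure
  of the set of codes, and Dugundji's theorem from there.\<close>

lemma digit_code_left_inverse:
  obtains g :: "real \<Rightarrow> 'a::euclidean_space" where "continuous_on UNIV g" "\<And>x. norm x < 1 \<Longrightarrow> g (digit_code x) = x"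
proof -
  let ?B = "ball (0::'a) 1"
  define G where "G z = (SOME x. x \<in> ?B \<and> digit_code x = z)" for z
  have G: "G (digit_code x) = x" if x: "x \<in> ?B" for x
  proof -
    have "G (digit_code x) \<in> ?B \<and> digit_code (G (digit_code x)) = digit_code x"
      unfolding G_def by (rule someI[of _ x]) (use x in auto)
    then have "dist (G (digit_code x)) x < e" if "0 < e" for e
      using digit_code_uniform[OF that, where 'a='a] x by auto
    then show ?thesis by (metis dist_nz less_irrefl)
  qed
  have "uniformly_continuous_on (digit_code ` ?B) G"
    unfolding uniformly_continuous_on_def
  proof (intro allI impI)
    fix e :: real assume "0 < e"
    then obtain d where "d > 0" "\<And>x y :: 'a. norm x < 1 \<Longrightarrow> norm y < 1 \<Longrightarrow> \<bar>digit_code x - digit_code y\<bar> < d \<Longrightarrow> dist x y < e"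
      using digit_code_uniform by blast
    then show "\<exists>d>0. \<forall>x\<in>digit_code ` ?B. \<forall>x'\<in>digit_code ` ?B. dist x' x < d \<longrightarrow> dist (G x') (G x) < e"
      by (intro exI[of _ d]) (auto simp: G dist_real_def)
  qed
  from uniformly_continuous_on_extension_on_closure[OF this]
  obtain h where h: "uniformly_continuous_on (closure (digit_code ` ?B)) h" "\<And>z. z \<in> digit_code ` ?B \<Longrightarrow> G z = h z" by metis
  have "continuous_on (closure (digit_code ` ?B)) h" by (rule uniformly_continuous_imp_continuous[OF h(1)])
  then obtain g where g: "continuous_on UNIV g" "\<And>z. z \<in> closure (digit_code ` ?B) \<Longrightarrow> g z = h z"
    by (rule Dugundji[of UNIV UNIV "closure (digit_code ` ?B)" h, rotated 3]) auto
  have "g (digit_code x) = x" if "norm x < 1" for x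
  proof -
    have x: "x \<in> ?B" using that by simp
    then have im: "digit_code x \<in> digit_code ` ?B" by (rule imageI)
    have "digit_code x \<in> closure (digit_code ` ?B)" by (rule subsetD[OF closure_subset im])
    then show ?thesis using g(2) h(2)[OF im] G[OF x] by simp
  qed
  with g(1) show ?thesis by (rule that)
qed

definition narrow_conv :: "(nat \<Rightarrow> 'a::euclidean_space measure) \<Rightarrow> 'a measure \<Rightarrow> bool" where
  "narrow_conv X \<mu> \<longleftrightarrow> (\<forall>f :: 'a \<Rightarrow> real. continuous_on UNIV f \<longrightarrow> (\<exists>C. \<forall>x. \<bar>f x\<bar> \<le> C) \<longrightarrow>
     (\<lambda>n. LINT x|X n. f x) \<longlonglongrightarrow> (LINT x|\<mu>. f x))"

text \<open>The truncations at level \<open>K\<close> are bounded and continuous, so narrow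
  convergence transfers the bound to each of them; Fatou's lemma lets \<open>K\<close> grow.\<close>

lemma second_moment_narrow_limit:
  fixes X :: "nat \<Rightarrow> 'a::euclidean_space measure"
  assumes X: "\<And>n. prob_space (X n)" "\<And>n. sets (X n) = sets borel"
    and \<mu>: "prob_space \<mu>" "sets \<mu> = sets borel" and conv: "narrow_conv X \<mu>"
    and C: "\<And>n. second_moment (X n) \<le> ennreal C" "0 \<le> C"
  shows "second_moment \<mu> \<le> ennreal C"
proof -
  note [measurable_cong] = \<mu>(2) X(2)
  let ?f = "\<lambda>K x. min ((norm x)\<^sup>2) (real K) :: real"
  have nn: "(\<integral>\<^sup>+x. ennreal (?f K x) \<partial>M) = ennreal (LINT x|M. ?f K x)" if M: "prob_space M" "sets M = sets borel" for M :: "'a measure" and K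
  proof -
    interpret prob_space M by fact
    note [measurable_cong] = M(2)
    show ?thesis by (intro nn_integral_eq_integral integrable_const_bound[of _ "real K"]) auto
  qed
  have bound: "(\<integral>\<^sup>+x. ennreal (?f K x) \<partial>\<mu>) \<le> ennreal C" for K
  proof -
    have "(\<lambda>n. LINT x|X n. ?f K x) \<longlonglongrightarrow> (LINT x|\<mu>. ?f K x)"
      using conv unfolding narrow_conv_def
      by (auto intro!: continuous_intros exI[of _ "real K"] elim!: allE[of _ "?f K"])
    moreover have "(LINT x|X n. ?f K x) \<le> C" for n
    proof -
      have "ennreal (LINT x|X n. ?f K x) \<le> second_moment (X n)"
        unfolding nn[OF X, symmetric] by (intro nn_integral_mono ennreal_leI) auto
      then have "ennreal (LINT x|X n. ?f K x) \<le> ennreal C" using C(1) order_trans by blast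
      then show ?thesis using C(2) by simp
    qed
    ultimately have "(LINT x|\<mu>. ?f K x) \<le> C" by (intro LIMSEQ_le_const2) auto
    then show ?thesis unfolding nn[OF \<mu>] by (rule ennreal_leI)
  qed
  have "second_moment \<mu> = (\<integral>\<^sup>+x. liminf (\<lambda>K. ennreal (?f K x)) \<partial>\<mu>)"
  proof (rule nn_integral_cong)
    fix x :: 'a
    obtain N where N: "(norm x)\<^sup>2 \<le> real N" using real_arch_simple by blast
    have "\<forall>\<^sub>F K in sequentially. ennreal (?f K x) = ennreal ((norm x)\<^sup>2)"
      by (rule eventually_sequentiallyI[of N]) (use N in \<open>auto simp: min_def\<close>)
    then have "(\<lambda>K. ennreal (?f K x)) \<longlonglongrightarrow> ennreal ((norm x)\<^sup>2)" by (rule tendsto_eventually)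
    from lim_imp_Liminf[OF sequentially_bot this]
    show "ennreal ((norm x)\<^sup>2) = liminf (\<lambda>K. ennreal (?f K x))" by (rule sym)
  qed
  also have "\<dots> \<le> liminf (\<lambda>K. \<integral>\<^sup>+x. ennreal (?f K x) \<partial>\<mu>)" by (rule nn_integral_liminf) measurable
  also have "\<dots> \<le> ennreal C"
    by (rule order_trans[OF Liminf_mono[of _ "\<lambda>_. ennreal C"]]) (use bound in \<open>auto simp: Liminf_const\<close>)
  finally show ?thesis .
qed

text \<open>The codes lie in \<open>{0..1}\<close>, so tightness on the line is free. The moment
  bound serves to exclude mass of the limit at \<open>1 \<le> norm (g z)\<close>, that is at
  infinity; elsewhere decoding is continuous, and the limit is pulled back along it.\<close>

theorem Prokhorov_second_moment:
  fixes X :: "nat \<Rightarrow> 'a::euclidean_space measure"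
  assumes X: "\<And>n. prob_space (X n)" "\<And>n. sets (X n) = sets borel"
    and C: "\<And>n. second_moment (X n) \<le> ennreal C" "0 \<le> C"
  obtains r \<mu> where "strict_mono (r :: nat \<Rightarrow> nat)" "\<mu> \<in> P2" "narrow_conv (X \<circ> r) \<mu>"
proof -
  note [measurable_cong] = X(2)
  define e where "e x = digit_code (compress x)" for x :: 'a
  have em[measurable]: "e \<in> borel_measurable borel" unfolding e_def[abs_def] by measurable
  obtain g :: "real \<Rightarrow> 'a" where g: "continuous_on UNIV g" "\<And>x. norm x < 1 \<Longrightarrow> g (digit_code x) = x"
    by (rule digit_code_left_inverse, rule that)
  have ge: "g (e x) = compress x" for x unfolding e_def by (rule g(2)[OF norm_compress_less])
  have gm[measurable]: "g \<in> borel_measurable borel" by (rule borel_measurable_continuous_onI[OF g(1)])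
  define Y where "Y n = distr (X n) borel e" for n
  have Yr: "real_distribution (Y n)" for n
    unfolding Y_def by (rule prob_space.real_distribution_distr[OF X(1)]) measurable
  have "tight Y"
    unfolding tight_def
  proof (intro conjI allI impI Yr)
    fix \<epsilon> :: real assume "0 < \<epsilon>"
    have "measure (Y n) {-1<..1} = 1" for n
    proof -
      have "e x \<in> {-1<..1}" for x using digit_code_bounds[of "compress x"] by (simp add: e_def)
      then have "e -` {-1<..1} \<inter> space (X n) = space (X n)" by auto
      then show ?thesis unfolding Y_def by (subst measure_distr) (auto simp: prob_space.prob_space[OF X(1)])
    qed
    then show "\<exists>a b. a < b \<and> (\<forall>n. 1 - \<epsilon> < measure (Y n) {a<..b})"
      using \<open>0 < \<epsilon>\<close> by (intro exI[of _ "-1"] exI[of _ 1]) auto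
  qed
  from tight_imp_convergent_subsubsequence[OF this strict_mono_id]
  obtain r m where r: "strict_mono r" and m: "real_distribution m" and wc: "weak_conv_m (Y \<circ> id \<circ> r) m" by blast
  interpret m: real_distribution m by fact
  have Yr': "real_distribution ((Y \<circ> id \<circ> r) n)" for n using Yr by simp
  have mass: "measure m {z. norm (g z) \<ge> 1} \<le> C / (real K)\<^sup>2" if K: "K > 0" for K :: nat
  proof -
    \<comment> \<open>A continuous ramp that vanishes at \<open>compress x\<close> for
      \<open>norm x \<le> real K\<close> and equals 1 from norm 1 on. It turns Chebyshev's
      inequality into one for a continuous function, which passes to the weak limit.\<close>
    define cut where "cut y = max 0 (min 1 ((1 + real K) * norm y - real K))" for y :: 'a
    have cutc: "continuous_on UNIV cut" unfolding cut_def[abs_def] by (intro continuous_intros)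
    then have [measurable]: "cut \<in> borel_measurable borel" by (rule borel_measurable_continuous_onI)
    have cut01: "0 \<le> cut y" "cut y \<le> 1" for y by (auto simp: cut_def)
    have "continuous_on UNIV (\<lambda>z. cut (g z))"
      by (rule continuous_on_compose2[OF cutc g(1)]) auto
    then have "(\<lambda>n. LINT z|(Y \<circ> id \<circ> r) n. cut (g z)) \<longlonglongrightarrow> (LINT z|m. cut (g z))"
      using cut01 by (intro weak_conv_imp_integral_bdd_continuous_conv[OF Yr' m wc, of _ 1])
        (auto simp: continuous_on_eq_continuous_at)
    moreover have "(LINT z|(Y \<circ> id \<circ> r) n. cut (g z)) \<le> C / (real K)\<^sup>2" for n
    proof -
      have "(LINT z|(Y \<circ> id \<circ> r) n. cut (g z)) = (LINT x|X (r n). cut (compress x))"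
        by (simp add: Y_def integral_distr ge)
      also have "\<dots> = enn2real (\<integral>\<^sup>+x. ennreal (cut (compress x)) \<partial>X (r n))"
        by (rule integral_eq_nn_integral) (auto simp: cut01)
      also have "\<dots> \<le> C / (real K)\<^sup>2"
      proof (rule enn2real_leI)
        have "(\<integral>\<^sup>+x. ennreal (cut (compress x)) \<partial>X (r n)) \<le> (\<integral>\<^sup>+x. ennreal ((norm x)\<^sup>2) * ennreal (1 / (real K)\<^sup>2) \<partial>X (r n))"
        proof (rule nn_integral_mono)
          fix x :: 'a
          have "cut (compress x) \<le> (norm x)\<^sup>2 / (real K)\<^sup>2"
          proof (cases "norm x \<le> real K")
            case True
            have "(1 + real K) * (norm x / (1 + norm x)) \<le> real K"
              using True one_plus_norm_pos[of x] by (simp add: field_simps)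
            then have "cut (compress x) = 0" by (simp add: cut_def norm_compress)
            then show ?thesis by simp
          next
            case False
            then have "(real K)\<^sup>2 \<le> (norm x)\<^sup>2" by (intro power_mono) auto
            then have "1 \<le> (norm x)\<^sup>2 / (real K)\<^sup>2" using K by simp
            then show ?thesis using cut01(2)[of "compress x"] by linarith
          qed
          then show "ennreal (cut (compress x)) \<le> ennreal ((norm x)\<^sup>2) * ennreal (1 / (real K)\<^sup>2)"
            by (simp add: ennreal_mult'[symmetric] ennreal_leI)
        qed
        also have "\<dots> = second_moment (X (r n)) * ennreal (1 / (real K)\<^sup>2)"
          by (rule nn_integral_multc) measurable
        also have "\<dots> \<le> ennreal C * ennreal (1 / (real K)\<^sup>2)" by (intro mult_right_mono C) simp
        also have "\<dots> = ennreal (C / (real K)\<^sup>2)" using C(2) by (simp add: ennreal_mult'[symmetric])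
        finally show "(\<integral>\<^sup>+x. ennreal (cut (compress x)) \<partial>X (r n)) \<le> ennreal (C / (real K)\<^sup>2)" .
      qed (use C(2) in auto)
      finally show ?thesis .
    qed
    ultimately have lim: "(LINT z|m. cut (g z)) \<le> C / (real K)\<^sup>2" by (intro LIMSEQ_le_const2) auto
    have "measure m {z. norm (g z) \<ge> 1} = (LINT z|m. indicat_real {z. norm (g z) \<ge> 1} z)" by simp
    also have "\<dots> \<le> (LINT z|m. cut (g z))"
    proof (rule integral_mono)
      show "integrable m (indicat_real {z. 1 \<le> norm (g z)})" by (intro integrable_real_indicator) (auto simp: m.emeasure_eq_measure)
      show "integrable m (\<lambda>z. cut (g z))" by (rule m.integrable_const_bound[of _ 1]) (use cut01 in auto)
      fix z
      show "indicat_real {z. 1 \<le> norm (g z)} z \<le> cut (g z)"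
      proof (cases "1 \<le> norm (g z)")
        case True
        then have "(1 + real K) * 1 \<le> (1 + real K) * norm (g z)" by (intro mult_left_mono) auto
        then have "1 \<le> (1 + real K) * norm (g z) - real K" by (simp only: le_diff_eq mult_1_right)
        then show ?thesis using True by (simp add: cut_def)
      qed (simp add: cut01)
    qed
    finally show ?thesis using lim by simp
  qed
  have mass0: "measure m {z. norm (g z) \<ge> 1} = 0"
  proof (rule antisym)
    have "(\<lambda>K. C * (1 / real (Suc K))\<^sup>2) \<longlonglongrightarrow> C * 0\<^sup>2"
      using LIMSEQ_inverse_real_of_nat by (intro tendsto_intros) (simp add: inverse_eq_divide)
    then have "(\<lambda>K. C / (real (Suc K))\<^sup>2) \<longlonglongrightarrow> 0" by (simp add: power_one_over divide_inverse power_inverse)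
    then show "measure m {z. norm (g z) \<ge> 1} \<le> 0"
      by (rule LIMSEQ_le_const) (intro exI[of _ 0] allI impI mass, simp)
  qed simp
  \<comment> \<open>The value 0 is assigned on a set that is null for \<open>m\<close> by
    \<open>mass0\<close>.\<close>
  define D where "D z = (if norm (g z) < 1 then decompress (g z) else 0)" for z
  have De: "D (e x) = x" for x using norm_compress_less[of x] by (simp add: D_def ge decompress_compress)
  have Dm[measurable]: "D \<in> borel_measurable borel"
    unfolding D_def[abs_def] decompress_def[abs_def] by measurable
  define \<mu> where "\<mu> = distr m borel D"
  have \<mu>p: "prob_space \<mu>" unfolding \<mu>_def by (rule m.prob_space_distr) simp
  have \<mu>s: "sets \<mu> = sets borel" by (simp add: \<mu>_def)
  have opn: "open {z. norm (g z) < 1}"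
    using g(1) by (intro open_Collect_less continuous_intros) auto
  have conv: "narrow_conv (X \<circ> r) \<mu>"
    unfolding narrow_conv_def
  proof (intro allI impI)
    fix f :: "'a \<Rightarrow> real" assume f: "continuous_on UNIV f" and "\<exists>B. \<forall>x. \<bar>f x\<bar> \<le> B"
    then obtain B where B: "\<And>x. \<bar>f x\<bar> \<le> B" by blast
    have [measurable]: "f \<in> borel_measurable borel" by (rule borel_measurable_continuous_onI[OF f])
    have cont: "isCont (\<lambda>z. f (D z)) z" if "norm (g z) < 1" for z
    proof -
      have "continuous_on {z. norm (g z) < 1} (\<lambda>z. f (decompress (g z)))"
        unfolding decompress_def
        by (intro continuous_on_compose2[OF f] continuous_intros continuous_on_subset[OF g(1)]) auto
      then have "continuous_on {z. norm (g z) < 1} (\<lambda>z. f (D z))"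
        by (rule continuous_on_cong[THEN iffD1, rotated 2]) (auto simp: D_def)
      then show ?thesis using opn that by (simp add: continuous_on_eq_continuous_at)
    qed
    \<comment> \<open>The decoded test function is continuous on an open set of full measure only,
      so weak convergence is used for almost everywhere continuous functions.\<close>
    have "emeasure m {z. \<not> isCont (\<lambda>z. f (D z)) z} \<le> emeasure m {z. norm (g z) \<ge> 1}"
    proof (rule emeasure_mono)
      show "{z. \<not> isCont (\<lambda>z. f (D z)) z} \<subseteq> {z. norm (g z) \<ge> 1}" using cont not_less by blast
    qed measurable
    then have "emeasure m {z. \<not> isCont (\<lambda>z. f (D z)) z} = 0"
      using mass0 by (simp add: m.emeasure_eq_measure)
    then have "(\<lambda>n. LINT z|(Y \<circ> id \<circ> r) n. f (D z)) \<longlonglongrightarrow> (LINT z|m. f (D z))"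
      using B by (intro weak_conv_imp_bdd_ae_continuous_conv[OF Yr' m wc, of _ B]) auto
    then show "(\<lambda>n. LINT x|(X \<circ> r) n. f x) \<longlonglongrightarrow> (LINT x|\<mu>. f x)"
      by (simp add: Y_def \<mu>_def integral_distr De)
  qed
  have "second_moment \<mu> \<le> ennreal C"
    by (rule second_moment_narrow_limit[OF _ _ \<mu>p \<mu>s conv _ C(2)]) (use X C in auto)
  then have "second_moment \<mu> < \<infinity>" using le_less_trans[OF _ ennreal_less_top] by auto
  then have "\<mu> \<in> P2" by (rule P2I[OF \<mu>p \<mu>s])
  with r show ?thesis using conv by (rule that)
qed

section \<open>Geodesics\<close>

lemma narrow_conv_subseq:
  assumes "narrow_conv X x" "strict_mono r"
  shows "narrow_conv (X \<circ> r) x"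
  unfolding narrow_conv_def
proof (intro allI impI)
  fix f :: "'a \<Rightarrow> real" assume "continuous_on UNIV f" "\<exists>C. \<forall>x. \<bar>f x\<bar> \<le> C"
  then have "(\<lambda>n. LINT x|X n. f x) \<longlonglongrightarrow> (LINT x|x. f x)"
    using assms(1) unfolding narrow_conv_def by blast
  from LIMSEQ_subseq_LIMSEQ[OF this assms(2)]
  show "(\<lambda>n. LINT x|(X \<circ> r) n. f x) \<longlonglongrightarrow> (LINT x|x. f x)" by (simp add: o_def)
qed

lemma narrow_conv_const: "narrow_conv (\<lambda>_. x) x"
  by (simp add: narrow_conv_def)

lemma narrow_conv_proj_measure:
  fixes X :: "nat \<Rightarrow> 'a::euclidean_space measure"
  assumes "\<And>n. X n \<in> P2" "x \<in> P2" "narrow_conv X x"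
  shows "weak_conv_m (\<lambda>n. proj_measure \<theta> (X n)) (proj_measure \<theta> x)"
proof (rule integral_bdd_continuous_conv_imp_weak_conv)
  show "real_distribution (proj_measure \<theta> (X n))" for n by (rule real_distribution_proj_measure) fact
  show "real_distribution (proj_measure \<theta> x)" by (rule real_distribution_proj_measure) fact
  fix f :: "real \<Rightarrow> real" assume f: "\<And>x. isCont f x" "\<And>x. \<bar>f x\<bar> \<le> 1"
  have fc: "continuous_on UNIV f" using f(1) by (simp add: continuous_on_eq_continuous_at)
  have [measurable]: "f \<in> borel_measurable borel" by (rule borel_measurable_continuous_onI[OF fc])
  have i: "(LINT y|proj_measure \<theta> M. f y) = (LINT y|M. f (y \<bullet> \<theta>))" if "M \<in> P2" for M
    unfolding proj_measure_def
    by (rule integral_distr) (auto intro: measurable_P2[OF that])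
  have "continuous_on UNIV (\<lambda>y. f (y \<bullet> \<theta>))"
    by (intro continuous_on_compose2[OF fc] continuous_intros) auto
  then show "(\<lambda>n. LINT y|proj_measure \<theta> (X n). f y) \<longlonglongrightarrow> (LINT y|proj_measure \<theta> x. f y)"
    using assms(3) f(2) unfolding i[OF assms(1)] i[OF assms(2)] narrow_conv_def by blast
qed

lemma SW_le_iff:
  assumes "\<mu> \<in> P2" "\<nu> \<in> P2" "0 \<le> C"
  shows "SW \<mu> \<nu> \<le> C \<longleftrightarrow> SW2 \<mu> \<nu> \<le> ennreal (C\<^sup>2)"
proof -
  obtain s where s: "SW2 \<mu> \<nu> = ennreal s" "0 \<le> s" using SW2_finite[OF assms(1,2)] by (cases "SW2 \<mu> \<nu>") auto
  have "SW \<mu> \<nu> = sqrt s" using s by (simp add: SW_eq_SW2 assms)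
  moreover have "sqrt s \<le> C \<longleftrightarrow> s \<le> C\<^sup>2"
    using s(2) assms(3) by (metis real_le_rsqrt real_le_lsqrt real_sqrt_ge_zero sqrt_le_D)
  ultimately show ?thesis using s by simp
qed

text \<open>Narrow convergence passes to every projection, where
  \<open>quantile_dist2_liminf\<close> applies; Fatou's lemma handles the integral over
  directions.\<close>

lemma SW_lower_semicontinuous:
  fixes X Y :: "nat \<Rightarrow> 'a::euclidean_space measure"
  assumes X: "\<And>n. X n \<in> P2" "x \<in> P2" "narrow_conv X x" and Y: "\<And>n. Y n \<in> P2" "y \<in> P2" "narrow_conv Y y"
    and le: "\<And>n. SW (X n) (Y n) \<le> C"
  shows "SW x y \<le> C"
proof -
  have C: "0 \<le> C" using SW_nonneg le order_trans by blast
  have "SW2 x y \<le> (\<integral>\<^sup>+\<theta>. liminf (\<lambda>n. proj_dist2 (X n) (Y n) \<theta>) \<partial>sphere_measure)"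
    unfolding SW2_def
    by (intro nn_integral_mono quantile_dist2_liminf real_distribution_proj_measure narrow_conv_proj_measure assms)
  also have "\<dots> \<le> liminf (\<lambda>n. SW2 (X n) (Y n))"
    unfolding SW2_def using measurable_proj_dist2[OF X(1) Y(1)]
    by (intro nn_integral_liminf) (simp add: measurable_cong_sets[OF sets_sphere_measure refl])
  also have "\<dots> \<le> liminf (\<lambda>n. ennreal (C\<^sup>2))"
    by (rule Liminf_mono) (use le SW_le_iff[OF X(1) Y(1) C] in auto)
  also have "\<dots> = ennreal (C\<^sup>2)" by (simp add: Liminf_const)
  finally show ?thesis using SW_le_iff[OF X(2) Y(2) C] by simp
qed

section \<open>Second moments through the distance to the Dirac mass at the origin\<close>

lemma Dirac_P2: "return borel (0 :: 'a::euclidean_space) \<in> P2"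
  by (rule P2I) (simp_all add: prob_space_return nn_integral_return)

lemma quantile_return_0:
  assumes "0 < \<omega>" "\<omega> < 1"
  shows "quantile (return borel 0) \<omega> = 0"
proof -
  have r: "real_distribution (return borel (0::real))"
    by (simp add: real_distribution_def real_distribution_axioms_def prob_space_return)
  have "cdf (return borel (0::real)) x = (if 0 \<le> x then 1 else 0)" for x
    unfolding cdf_def by (simp add: measure_return indicator_def)
  then have "quantile (return borel 0) \<omega> \<le> x \<longleftrightarrow> 0 \<le> x" for x
    unfolding quantile_le_iff[OF r assms] using assms by simp
  from this[of 0] this[of "quantile (return borel 0) \<omega>"] show ?thesis by simp
qed

lemma SW2_Dirac:
  fixes \<mu> :: "'a::euclidean_space measure"
  assumes \<mu>: "\<mu> \<in> P2"
  shows "SW2 \<mu> (return borel 0) = (\<integral>\<^sup>+x. \<integral>\<^sup>+\<theta>. ennreal ((x \<bullet> \<theta>)\<^sup>2) \<partial>sphere_measure \<partial>\<mu>)"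
proof -
  interpret M: prob_space \<mu> by (rule P2D(1)[OF \<mu>])
  interpret S: prob_space "sphere_measure :: 'a measure" by (rule prob_space_sphere_measure)
  interpret P: pair_sigma_finite \<mu> "sphere_measure :: 'a measure" ..
  note [measurable_cong] = P2D(2)[OF \<mu>]
  have "proj_dist2 \<mu> (return borel 0) \<theta> = (\<integral>\<^sup>+x. ennreal ((x \<bullet> \<theta>)\<^sup>2) \<partial>\<mu>)" for \<theta>
  proof -
    note r = real_distribution_proj_measure[OF \<mu>, of \<theta>]
    note [measurable] = measurable_quantile[OF r]
    have p: "proj_measure \<theta> (return borel (0::'a)) = return borel 0"
      unfolding proj_measure_def by (subst distr_return) auto
    have "proj_dist2 \<mu> (return borel 0) \<theta> =
       (\<integral>\<^sup>+\<omega>. ennreal ((quantile (proj_measure \<theta> \<mu>) \<omega>)\<^sup>2) \<partial>unit_interval)"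
      unfolding quantile_dist2_def p
      by (rule nn_integral_cong) (simp add: space_restrict_space quantile_return_0)
    also have "\<dots> = (\<integral>\<^sup>+x. ennreal (x\<^sup>2) \<partial>distr unit_interval borel (quantile (proj_measure \<theta> \<mu>)))"
      by (subst nn_integral_distr) auto
    also have "\<dots> = (\<integral>\<^sup>+x. ennreal (x\<^sup>2) \<partial>distr \<mu> borel (\<lambda>x. x \<bullet> \<theta>))"
      unfolding distr_quantile[OF r] by (simp add: proj_measure_def)
    also have "\<dots> = (\<integral>\<^sup>+x. ennreal ((x \<bullet> \<theta>)\<^sup>2) \<partial>\<mu>)" by (subst nn_integral_distr) auto
    finally show ?thesis .
  qed
  then have "SW2 \<mu> (return borel 0) = (\<integral>\<^sup>+\<theta>. \<integral>\<^sup>+x. ennreal ((x \<bullet> \<theta>)\<^sup>2) \<partial>\<mu> \<partial>sphere_measure)"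
    by (simp add: SW2_def)
  also have "\<dots> = (\<integral>\<^sup>+x. \<integral>\<^sup>+\<theta>. ennreal ((x \<bullet> \<theta>)\<^sup>2) \<partial>sphere_measure \<partial>\<mu>)"
    by (rule P.Fubini') measurable
  finally show ?thesis .
qed

text \<open>Rotation invariance would give the exact value, but a positive constant suffices: the
  quadratic form is continuous on the compact sphere, and a zero there would confine almost all
  directions to a hyperplane.\<close>

lemma sphere_second_moment_pos:
  obtains c where "0 < c" "\<And>x :: 'a::euclidean_space. ennreal (c * (norm x)\<^sup>2) \<le> (\<integral>\<^sup>+\<theta>. ennreal ((x \<bullet> \<theta>)\<^sup>2) \<partial>sphere_measure)"
proof -
  interpret S: prob_space "sphere_measure :: 'a measure" by (rule prob_space_sphere_measure)
  define Q where "Q x = (LINT \<theta>|sphere_measure. (x \<bullet> \<theta>)\<^sup>2)" for x :: 'a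
  have bd: "AE \<theta> in (sphere_measure :: 'a measure). (x \<bullet> \<theta>)\<^sup>2 \<le> (norm x)\<^sup>2" for x
    using AE_in_sphere
  proof eventually_elim
    case (elim \<theta>)
    have "\<bar>x \<bullet> \<theta>\<bar> \<le> norm x * norm \<theta>" by (rule Cauchy_Schwarz_ineq2)
    then show ?case using elim by (simp add: abs_le_square_iff[symmetric])
  qed
  have int: "integrable (sphere_measure :: 'a measure) (\<lambda>\<theta>. (x \<bullet> \<theta>)\<^sup>2)" for x
    by (rule S.integrable_const_bound[of _ "(norm x)\<^sup>2"]) (use bd in auto)
  have nnQ: "(\<integral>\<^sup>+\<theta>. ennreal ((x \<bullet> \<theta>)\<^sup>2) \<partial>sphere_measure) = ennreal (Q x)" for x
    unfolding Q_def by (rule nn_integral_eq_integral[OF int]) simp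
  have Qc: "continuous_on (sphere 0 1) Q"
  proof (rule continuous_on_sequentiallyI)
    fix u :: "nat \<Rightarrow> 'a" and a assume u: "\<forall>n. u n \<in> sphere 0 1" "u \<longlonglongrightarrow> a"
    show "(\<lambda>n. Q (u n)) \<longlonglongrightarrow> Q a"
      unfolding Q_def
    proof (rule integral_dominated_convergence[where w="\<lambda>_. 1"])
      show "AE \<theta> in sphere_measure. (\<lambda>n. (u n \<bullet> \<theta>)\<^sup>2) \<longlonglongrightarrow> (a \<bullet> \<theta>)\<^sup>2"
        using u by (intro AE_I2 tendsto_intros)
      show "AE \<theta> in sphere_measure. norm ((u n \<bullet> \<theta>)\<^sup>2) \<le> 1" for n
        using bd[of "u n"] u(1) by simp
    qed auto
  qed
  have "(sphere 0 1 :: 'a set) \<noteq> {}" by simp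
  then obtain x0 where x0: "x0 \<in> sphere 0 1" "\<And>x. x \<in> sphere 0 1 \<Longrightarrow> Q x0 \<le> Q x"
    using continuous_attains_inf[OF compact_sphere _ Qc] by blast
  have "Q x0 \<noteq> 0"
  proof
    assume "Q x0 = 0"
    then have "AE \<theta> in sphere_measure. (x0 \<bullet> \<theta>)\<^sup>2 = 0"
      unfolding Q_def by (subst (asm) integral_nonneg_eq_0_iff_AE[OF int]) auto
    then have "AE y in lborel. y \<in> ball (0::'a) 1 \<longrightarrow> (x0 \<bullet> sgn y)\<^sup>2 = 0" by (rule AE_sphere_measureD)
    then have "AE y in lebesgue. y \<notin> ball (0::'a) 1 - {y. x0 \<bullet> y = 0}"
      by (intro AE_completion) (auto elim!: eventually_mono simp: sgn_div_norm)
    then have "negligible (ball (0::'a) 1 - {y. x0 \<bullet> y = 0})"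
      unfolding negligible_iff_null_sets completion.null_sets_iff_AE by auto
    moreover have "negligible {y. x0 \<bullet> y = 0}" using x0(1) by (intro negligible_hyperplane) auto
    ultimately have "negligible (ball (0::'a) 1)"
      by (metis negligible_Un Un_Diff_cancel2 negligible_subset sup_ge1)
    then show False using open_not_negligible[of "ball (0::'a) 1"] by auto
  qed
  moreover have "0 \<le> Q x" for x unfolding Q_def by (intro Bochner_Integration.integral_nonneg) auto
  ultimately have pos: "0 < Q x0" by (simp add: order_le_neq_trans)
  show ?thesis
  proof (rule that[OF pos])
    fix x :: 'a
    show "ennreal (Q x0 * (norm x)\<^sup>2) \<le> (\<integral>\<^sup>+\<theta>. ennreal ((x \<bullet> \<theta>)\<^sup>2) \<partial>sphere_measure)"
    proof (cases "x = 0")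
      case False
      have "Q x = (norm x)\<^sup>2 * Q (sgn x)"
      proof -
        have "norm x *\<^sub>R sgn x = x" using False by (simp add: sgn_div_norm)
        then have "x \<bullet> \<theta> = norm x * (sgn x \<bullet> \<theta>)" for \<theta> by (metis inner_scaleR_left)
        then have "(x \<bullet> \<theta>)\<^sup>2 = (norm x)\<^sup>2 * (sgn x \<bullet> \<theta>)\<^sup>2" for \<theta>
          by (simp only: power_mult_distrib)
        then show ?thesis unfolding Q_def by simp
      qed
      moreover have "Q x0 \<le> Q (sgn x)" using False by (intro x0(2)) (simp add: norm_sgn)
      ultimately have "Q x0 * (norm x)\<^sup>2 \<le> Q x" by (simp add: mult.commute mult_right_mono)
      then show ?thesis unfolding nnQ by (rule ennreal_leI)
    qed simp
  qed
qed

text \<open>By the triangle inequality the distances to the Dirac mass at 0 are bounded by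
  \<open>B\<close>; their squares dominate \<open>c\<close> times the second moments.\<close>

lemma SW_bounded_imp_second_moment_bounded:
  fixes X :: "nat \<Rightarrow> 'a::euclidean_space measure"
  assumes X: "\<And>n. X n \<in> P2" and x: "x \<in> P2" and le: "\<And>n. SW (X n) x \<le> C"
  obtains K where "0 \<le> K" "\<And>n. second_moment (X n) \<le> ennreal K"
proof -
  obtain c where c: "0 < c" "\<And>x :: 'a. ennreal (c * (norm x)\<^sup>2) \<le> (\<integral>\<^sup>+\<theta>. ennreal ((x \<bullet> \<theta>)\<^sup>2) \<partial>sphere_measure)"
    by (rule sphere_second_moment_pos, rule that)
  define B where "B = C + SW x (return borel 0)"
  have C: "0 \<le> C" using SW_nonneg le order_trans by blast
  then have B: "0 \<le> B" using SW_nonneg[of x "return borel 0"] by (simp add: B_def)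
  have "second_moment (X n) \<le> ennreal (B\<^sup>2 / c)" for n
  proof -
    have nm: "(\<lambda>y. ennreal ((norm y)\<^sup>2)) \<in> borel_measurable (X n)"
      by (rule measurable_P2[OF X]) measurable
    have "SW (X n) (return borel 0) \<le> B"
      using SW_triangle[OF X x Dirac_P2, of n] le[of n] by (simp add: B_def)
    then have "SW2 (X n) (return borel 0) \<le> ennreal (B\<^sup>2)" by (simp add: SW_le_iff[OF X Dirac_P2 B])
    moreover have "ennreal c * second_moment (X n) \<le> SW2 (X n) (return borel 0)"
    proof -
      have "ennreal c * second_moment (X n) = (\<integral>\<^sup>+y. ennreal c * ennreal ((norm y)\<^sup>2) \<partial>X n)"
        by (rule nn_integral_cmult[OF nm, symmetric])
      also have "\<dots> \<le> SW2 (X n) (return borel 0)"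
        unfolding SW2_Dirac[OF X] using c by (intro nn_integral_mono) (simp add: ennreal_mult'[symmetric])
      finally show ?thesis .
    qed
    ultimately have "ennreal c * second_moment (X n) \<le> ennreal (B\<^sup>2)" by simp
    moreover obtain s where s: "second_moment (X n) = ennreal s" "0 \<le> s"
      using P2_second_moment_finite[OF X[of n]] by (cases "second_moment (X n)") auto
    ultimately have "c * s \<le> B\<^sup>2" using c(1) by (simp add: ennreal_mult'[symmetric])
    then have "s \<le> B\<^sup>2 / c" using c(1) by (simp add: pos_le_divide_eq mult.commute)
    then show ?thesis unfolding s(1) by (rule ennreal_leI)
  qed
  then show ?thesis using c(1) by (intro that[of "B\<^sup>2 / c"]) auto
qed

text \<open>Independent points with laws \<open>\<mu>\<close> and \<open>\<nu>\<close> are joined by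
  segments. The common space couples the curve at any two times, and the displacement is
  proportional to the time difference.\<close>

lemma Lip_curve_interpolation:
  fixes \<mu> \<nu> :: "'a::euclidean_space measure"
  assumes \<mu>: "\<mu> \<in> P2" and \<nu>: "\<nu> \<in> P2"
  obtains L \<gamma> where "Lip_curve P2 SW L \<gamma>" "\<gamma> 0 = \<mu>" "\<gamma> 1 = \<nu>"
proof -
  interpret M: prob_space \<mu> by (rule P2D(1)[OF \<mu>])
  interpret N: prob_space \<nu> by (rule P2D(1)[OF \<nu>])
  interpret pair_prob_space \<mu> \<nu> ..
  note [measurable_cong] = P2D(2)[OF \<mu>] P2D(2)[OF \<nu>]
  let ?P = "\<mu> \<Otimes>\<^sub>M \<nu>"
  define Z where "Z t p = (1 - t) *\<^sub>R fst p + t *\<^sub>R snd p" for t and p :: "'a \<times> 'a"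
  have Zm[measurable]: "Z t \<in> borel_measurable ?P" for t unfolding Z_def by measurable
  define \<gamma> where "\<gamma> t = distr ?P borel (Z t)" for t
  let ?b = "\<lambda>p :: 'a \<times> 'a. 2 * ennreal ((norm (fst p))\<^sup>2) + 2 * ennreal ((norm (snd p))\<^sup>2)"
  define A where "A = (\<integral>\<^sup>+p. ?b p \<partial>?P)"
  have "A = 2 * second_moment (distr ?P borel fst) + 2 * second_moment (distr ?P borel snd)"
    unfolding A_def by (simp add: nn_integral_add nn_integral_cmult nn_integral_distr)
  then have Afin: "A < \<infinity>"
    unfolding distr_pair_P2[OF \<mu> \<nu>] using P2_second_moment_finite[OF \<mu>] P2_second_moment_finite[OF \<nu>]
    by (auto simp: ennreal_mult_less_top less_top)
  note sq = ennreal_norm_diff_square_le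
  have \<gamma>P: "\<gamma> t \<in> P2" if t: "t \<in> {0..1}" for t
  proof -
    have "second_moment (\<gamma> t) = (\<integral>\<^sup>+p. ennreal ((norm (Z t p))\<^sup>2) \<partial>?P)"
      unfolding \<gamma>_def by (subst nn_integral_distr) auto
    also have "\<dots> \<le> A"
      unfolding A_def
    proof (rule nn_integral_mono)
      fix p :: "'a \<times> 'a"
      have "norm ((1 - t) *\<^sub>R fst p) \<le> norm (fst p)" "norm (- (t *\<^sub>R snd p)) \<le> norm (snd p)"
        using t by (auto simp: mult_left_le_one_le)
      then have le: "(norm ((1 - t) *\<^sub>R fst p))\<^sup>2 \<le> (norm (fst p))\<^sup>2" "(norm (- (t *\<^sub>R snd p)))\<^sup>2 \<le> (norm (snd p))\<^sup>2"
        by (auto intro!: power_mono simp del: norm_scaleR)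
      have "ennreal ((norm (Z t p))\<^sup>2) = ennreal ((norm ((1 - t) *\<^sub>R fst p - - (t *\<^sub>R snd p)))\<^sup>2)" by (simp add: Z_def)
      also have "\<dots> \<le> 2 * ennreal ((norm ((1 - t) *\<^sub>R fst p))\<^sup>2) + 2 * ennreal ((norm (- (t *\<^sub>R snd p)))\<^sup>2)" by (rule sq)
      also have "\<dots> \<le> ?b p"
        by (intro add_mono mult_left_mono ennreal_leI le) auto
      finally show "ennreal ((norm (Z t p))\<^sup>2) \<le> ?b p" .
    qed
    finally have "second_moment (\<gamma> t) < \<infinity>" using Afin by simp
    then show ?thesis unfolding \<gamma>_def by (intro P2I P.prob_space_distr) simp_all
  qed
  define a where "a = enn2real A"
  have a: "A = ennreal a" "0 \<le> a" using Afin by (simp_all add: a_def)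
  have SWle: "SW (\<gamma> s) (\<gamma> t) \<le> sqrt a * \<bar>s - t\<bar>" if st: "s \<in> {0..1}" "t \<in> {0..1}" for s t
  proof -
    have "SW2 (\<gamma> s) (\<gamma> t) \<le> (\<integral>\<^sup>+p. ennreal ((norm (Z s p - Z t p))\<^sup>2) \<partial>?P)"
      unfolding SW2_def \<gamma>_def by (intro nn_integral_sphere_le P.proj_dist2_distr_le Zm) auto
    also have "\<dots> \<le> (\<integral>\<^sup>+p. ennreal ((s - t)\<^sup>2) * ?b p \<partial>?P)"
    proof (rule nn_integral_mono)
      fix p :: "'a \<times> 'a"
      have "Z s p - Z t p = (t - s) *\<^sub>R (fst p - snd p)" by (simp add: Z_def algebra_simps)
      then have "ennreal ((norm (Z s p - Z t p))\<^sup>2) = ennreal ((s - t)\<^sup>2) * ennreal ((norm (fst p - snd p))\<^sup>2)"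
        by (simp add: power_mult_distrib ennreal_mult' power2_commute)
      also have "\<dots> \<le> ennreal ((s - t)\<^sup>2) * ?b p"
        by (intro mult_left_mono sq) simp
      finally show "ennreal ((norm (Z s p - Z t p))\<^sup>2) \<le> ennreal ((s - t)\<^sup>2) * ?b p" .
    qed
    also have "\<dots> = ennreal ((s - t)\<^sup>2) * A" unfolding A_def by (rule nn_integral_cmult) measurable
    also have "\<dots> = ennreal ((sqrt a * \<bar>s - t\<bar>)\<^sup>2)"
      using a by (simp add: power_mult_distrib ennreal_mult'[symmetric] mult.commute)
    finally show ?thesis using a(2) by (subst SW_le_iff[OF \<gamma>P[OF st(1)] \<gamma>P[OF st(2)]]) auto
  qed
  have "Lip_curve P2 SW (sqrt a) \<gamma>" unfolding Lip_curve_def using \<gamma>P SWle by blast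
  moreover have "Z 0 = fst" "Z 1 = snd" by (auto simp: Z_def)
  then have "\<gamma> 0 = \<mu>" "\<gamma> 1 = \<nu>" unfolding \<gamma>_def using distr_pair_P2[OF \<mu> \<nu>] by simp_all
  ultimately show ?thesis by (rule that)
qed

section \<open>The sliced distance as an instance of the abstract setting\<close>

lemma Metric_space_SW: "Metric_space (P2 :: 'a::euclidean_space measure set) SW"
proof
  fix \<mu> \<nu> :: "'a measure" assume P: "\<mu> \<in> P2" "\<nu> \<in> P2"
  show "SW \<mu> \<nu> = 0 \<longleftrightarrow> \<mu> = \<nu>"
  proof
    assume "SW \<mu> \<nu> = 0"
    then show "\<mu> = \<nu>"
      using P by (intro Cramer_Wold P2D SW_eq_0_imp_AE_proj_eq)
  next
    assume "\<mu> = \<nu>"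
    then have "SW2 \<mu> \<nu> = 0" by (simp add: SW2_def quantile_dist2_def)
    then show "SW \<mu> \<nu> = 0" by (simp add: SW_eq_SW2 P)
  qed
qed (auto simp: SW_nonneg intro: SW_commute SW_triangle)

interpretation SW: compact_Lipschitz_connected "P2 :: 'a::euclidean_space measure set" SW narrow_conv
proof (rule compact_Lipschitz_connected.intro[OF Metric_space_SW], unfold_locales)
  fix X :: "nat \<Rightarrow> 'a measure" and x C
  assume X: "range X \<subseteq> P2" "x \<in> P2" "\<And>n. SW (X n) x \<le> C"
  have XP: "X n \<in> P2" for n using X(1) by blast
  obtain K where K: "0 \<le> K" "\<And>n. second_moment (X n) \<le> ennreal K"
    by (rule SW_bounded_imp_second_moment_bounded[OF XP X(2,3)], rule that)
  show "\<exists>r y. strict_mono (r :: nat \<Rightarrow> nat) \<and> y \<in> P2 \<and> narrow_conv (X \<circ> r) y"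
  proof (rule Prokhorov_second_moment[OF P2D(1)[OF XP] P2D(2)[OF XP] K(2,1)])
    fix r \<mu> assume "strict_mono (r :: nat \<Rightarrow> nat)" "\<mu> \<in> P2" "narrow_conv (X \<circ> r) \<mu>"
    then show ?thesis by blast
  qed
next
  fix X Y :: "nat \<Rightarrow> 'a measure" and x y C
  assume "range X \<subseteq> P2" "range Y \<subseteq> P2" "x \<in> P2" "y \<in> P2" "narrow_conv X x" "narrow_conv Y y" "\<And>n. SW (X n) (Y n) \<le> C"
  then show "SW x y \<le> C" by (intro SW_lower_semicontinuous[of X x Y y]) auto
next
  fix x y :: "'a measure" assume "x \<in> P2" "y \<in> P2"
  then show "\<exists>L \<gamma>. Lip_curve P2 SW L \<gamma> \<and> \<gamma> 0 = x \<and> \<gamma> 1 = y"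
    using Lip_curve_interpolation by metis
qed (auto intro: narrow_conv_subseq narrow_conv_const)

lemma ell_SW_eq_length_dist: "ell_SW = length_dist P2 SW"
  by (intro ext) (simp add: ell_SW_def length_dist_def)

theorem proposition4p5:
  assumes "CARD('n::finite) \<ge> 2"
  shows "(\<forall>\<mu>\<in>(P2 :: (real ^ 'n) measure set). \<forall>\<nu>\<in>P2.
           \<exists>\<gamma>\<in>AC {0..1} P2 SW.
             \<gamma> 0 = \<mu> \<and> \<gamma> 1 = \<nu> \<and> ell_SW \<mu> \<nu> = curve_length {0..1} SW \<gamma>)
       \<and> geodesic_space (P2 :: (real ^ 'n) measure set) ell_SW"
proof (intro conjI ballI)
  fix \<mu> \<nu> :: "(real ^ 'n) measure" assume "\<mu> \<in> P2" "\<nu> \<in> P2"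
  then obtain \<gamma> where "Lip_curve P2 SW (length_dist P2 SW \<mu> \<nu>) \<gamma>" "\<gamma> 0 = \<mu>" "\<gamma> 1 = \<nu>"
    "curve_length {0..1} SW \<gamma> = length_dist P2 SW \<mu> \<nu>"
    by (rule SW.length_dist_attained)
  then show "\<exists>\<gamma>\<in>AC {0..1} P2 SW. \<gamma> 0 = \<mu> \<and> \<gamma> 1 = \<nu> \<and> ell_SW \<mu> \<nu> = curve_length {0..1} SW \<gamma>"
    by (intro bexI[of _ \<gamma>] Lip_curve_AC) (auto simp: ell_SW_eq_length_dist)
qed (simp add: ell_SW_eq_length_dist SW.geodesic_space_length_dist)

end
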